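(* Let $k\ge 1$ be a fixed integer and let $N\to\infty$ through multiples of $k$. Let $A_N$ be an $N\times N$ $k$-checkerboard matrix with mean matrix $\overline{A}_N$, and let $B_N$ be an independent $N\times N$ GOE matrix. Assume that, with probability $1-o(1)$, $\{\overline{A}_N,B_N\}$ has $k$ eigenvalues at $\frac{N^{3/2}}{k}+O(N)$ and $k$ eigenvalues at $-\frac{N^{3/2}}{k}+O(N)$. Then, with probability $1-o(1)$, $\{A_N,B_N\}$ has a blip containing $k$ eigenvalues at $\frac{N^{3/2}}{k}+O(N)$, a blip containing $k$ eigenvalues at $-\frac{N^{3/2}}{k}+O(N)$, and $N-2k$ eigenvalues of $O(N)$.
   Context: Here $\{X,Y\}=XY+YX$. The $N\times N$ Gaussian Orthogonal Ensemble (GOE) consists of real symmetric matrices $(a_{ij})$ whose entries $a_{ij}$, $i\le j$, are independent with $a_{ij}=a_{ji}\sim N(0,1)$ for $i\ne j$ and $a_{ii}\sim N(0,2)$. An $N\times N$ $k$-checkerboard matrix is a real symmetric random matrix $(m_{ij})$ with $m_{ij}=1$ if $i\equiv j\pmod k$ and $m_{ij}=a_{ij}$ if $i\not\equiv j\pmod k$, where $a_{ij}=a_{ji}$ and the distinct $a_{ij}$ are independent samples of a distribution with mean $0$, variance $1$ and finite higher moments. Its mean matrix $\overline{A}_N$ has entries $1$ where $i\equiv j\pmod k$ and $0$ elsewhere. A bound $O(N)$ means bounded in absolute value by $CN$ for a constant $C$ not depending on $N$. *)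

theory Defs
  imports "HOL-Probability.Probability" "Jordan_Normal_Form.Char_Poly"
begin

section \<open>Random matrix ensembles\<close>

definition entry_law :: "real measure \<Rightarrow> bool" where
  "entry_law D \<longleftrightarrow> real_distribution D \<and> (\<forall>p::nat. integrable D (\<lambda>x. x ^ p)) \<and>
     prob_space.expectation D (\<lambda>x. x) = 0 \<and> prob_space.variance D (\<lambda>x. x) = 1"

text \<open>A random matrix is a map from the sample space to matrices; indices run over \<open>0, \<dots>, N - 1\<close>,
  which does not affect congruences between two indices.\<close>

definition checkerboard_matrix ::
  "'a measure \<Rightarrow> real measure \<Rightarrow> nat \<Rightarrow> nat \<Rightarrow> ('a \<Rightarrow> real mat) \<Rightarrow> bool" where
  "checkerboard_matrix M D k N A \<longleftrightarrow>
     (\<forall>\<omega>\<in>space M. A \<omega> \<in> carrier_mat N N \<and> transpose_mat (A \<omega>) = A \<omega> \<and>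
        (\<forall>i<N. \<forall>j<N. i mod k = j mod k \<longrightarrow> A \<omega> $$ (i, j) = 1)) \<and>
     prob_space.indep_vars M (\<lambda>_. borel) (\<lambda>ij \<omega>. A \<omega> $$ ij)
       {(i, j). i < j \<and> j < N \<and> i mod k \<noteq> j mod k} \<and>
     (\<forall>i j. i < j \<and> j < N \<and> i mod k \<noteq> j mod k \<longrightarrow> distr M borel (\<lambda>\<omega>. A \<omega> $$ (i, j)) = D)"

definition mean_checkerboard :: "nat \<Rightarrow> nat \<Rightarrow> real mat" where
  "mean_checkerboard k N = Matrix.mat N N (\<lambda>(i, j). if i mod k = j mod k then 1 else 0)"

text \<open>The second parameter of \<open>normal_density\<close> is the standard deviation.\<close>

definition goe_matrix :: "'a measure \<Rightarrow> nat \<Rightarrow> ('a \<Rightarrow> real mat) \<Rightarrow> bool" where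
  "goe_matrix M N B \<longleftrightarrow>
     (\<forall>\<omega>\<in>space M. B \<omega> \<in> carrier_mat N N \<and> transpose_mat (B \<omega>) = B \<omega>) \<and>
     prob_space.indep_vars M (\<lambda>_. borel) (\<lambda>ij \<omega>. B \<omega> $$ ij) {(i, j). i \<le> j \<and> j < N} \<and>
     (\<forall>i j. i < j \<and> j < N \<longrightarrow>
        distributed M lborel (\<lambda>\<omega>. B \<omega> $$ (i, j)) (normal_density 0 1)) \<and>
     (\<forall>i<N. distributed M lborel (\<lambda>\<omega>. B \<omega> $$ (i, i)) (normal_density 0 (sqrt 2)))"

definition indep_random_matrices ::
  "'a measure \<Rightarrow> nat \<Rightarrow> ('a \<Rightarrow> real mat) \<Rightarrow> ('a \<Rightarrow> real mat) \<Rightarrow> bool" where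
  "indep_random_matrices M N A B \<longleftrightarrow>
     prob_space.indep_var M
       (Pi\<^sub>M ({..<N} \<times> {..<N}) (\<lambda>_. borel)) (\<lambda>\<omega>. \<lambda>ij\<in>{..<N} \<times> {..<N}. A \<omega> $$ ij)
       (Pi\<^sub>M ({..<N} \<times> {..<N}) (\<lambda>_. borel)) (\<lambda>\<omega>. \<lambda>ij\<in>{..<N} \<times> {..<N}. B \<omega> $$ ij)"

definition anticommutator :: "real mat \<Rightarrow> real mat \<Rightarrow> real mat" where
  "anticommutator X Y = X * Y + Y * X"

section \<open>Eigenvalues in a window\<close>

text \<open>Eigenvalues are counted with multiplicity.\<close>

definition eig_count :: "real mat \<Rightarrow> real set \<Rightarrow> nat" where
  "eig_count X S = size (filter_mset (\<lambda>x. x \<in> S) (proots (char_poly X)))"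

text \<open>Here \<open>C\<close> is the constant implied by the \<open>O(N)\<close>.\<close>

definition two_blips :: "nat \<Rightarrow> nat \<Rightarrow> real \<Rightarrow> real mat \<Rightarrow> bool" where
  "two_blips k N C X \<longleftrightarrow>
     eig_count X (cball (real N powr (3/2) / real k) (C * real N)) = k \<and>
     eig_count X (cball (- (real N powr (3/2) / real k)) (C * real N)) = k"

definition two_blips_and_bulk :: "nat \<Rightarrow> nat \<Rightarrow> real \<Rightarrow> real mat \<Rightarrow> bool" where
  "two_blips_and_bulk k N C X \<longleftrightarrow>
     two_blips k N C X \<and> int (eig_count X (cball 0 (C * real N))) = int N - 2 * int k"

section \<open>Probability \<open>1 - o(1)\<close>\<close>

text \<open>Inner probability, which spares side conditions about measurability of events: it is the
  ordinary probability of any measurable event, see below.\<close>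

definition inner_prob :: "'a measure \<Rightarrow> 'a set \<Rightarrow> real" where
  "inner_prob M S = (SUP E\<in>{E\<in>sets M. E \<subseteq> S}. measure M E)"

lemma inner_prob_eq_measure:
  assumes "prob_space M" and "S \<in> sets M"
  shows "inner_prob M S = measure M S"
proof -
  interpret prob_space M by fact
  show ?thesis
    unfolding inner_prob_def
    by (rule cSup_eq_maximum) (use assms(2) in \<open>auto intro: finite_measure_mono\<close>)
qed

definition multiples_at_top :: "nat \<Rightarrow> nat filter" where
  "multiples_at_top k = inf at_top (principal {N. k dvd N})"

text \<open>\<open>P C N \<omega>\<close> is an event involving an \<open>O(N)\<close> with implied constant \<open>C\<close>. In the first definition
  one constant serves for probability \<open>1 - o(1)\<close>. In the second, which is the usual meaning of
  an \<open>O(N)\<close> in probability, the constant, still not depending on \<open>N\<close>, may depend on the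
  probability \<open>\<epsilon>\<close> that is lost. The two differ in substance: the trace of
  \<open>{mean_checkerboard k N, B}\<close> is \<open>N\<close> times a Gaussian variable whose law does not depend on \<open>N\<close>,
  so that its eigenvalues can be located up to \<open>O(N)\<close> only in the second sense.\<close>

definition whp_O :: "nat \<Rightarrow> (nat \<Rightarrow> 'a measure) \<Rightarrow> (real \<Rightarrow> nat \<Rightarrow> 'a \<Rightarrow> bool) \<Rightarrow> bool" where
  "whp_O k M P \<longleftrightarrow>
     (\<exists>C. ((\<lambda>N. inner_prob (M N) {\<omega> \<in> space (M N). P C N \<omega>}) \<longlongrightarrow> 1) (multiples_at_top k))"

definition whp_O_tight :: "nat \<Rightarrow> (nat \<Rightarrow> 'a measure) \<Rightarrow> (real \<Rightarrow> nat \<Rightarrow> 'a \<Rightarrow> bool) \<Rightarrow> bool" where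
  "whp_O_tight k M P \<longleftrightarrow>
     (\<forall>\<epsilon>>0. \<exists>C. \<forall>\<^sub>F N in multiples_at_top k.
        inner_prob (M N) {\<omega> \<in> space (M N). P C N \<omega>} \<ge> 1 - \<epsilon>)"

end

theory Submission
  imports Defs "Jordan_Normal_Form.Spectral_Radius" "HOL-Real_Asymp.Real_Asymp"
begin

text \<open>
  Write \<open>Z\<close> for the mean matrix of \<open>A\<close> and \<open>W = A - Z\<close>.  Then \<open>{A, B} = {Z, B} + {W, B}\<close>, and the
  whole proof rests on one estimate: with probability \<open>1 - o(1)\<close> the operator norms of \<open>W\<close> and
  \<open>B\<close> are at most an absolute constant times \<open>sqrt N\<close> (\<open>op_bound_whp\<close>, with \<open>goe_diagonal_event\<close>
  for the diagonal of \<open>B\<close>), so that the perturbation \<open>{W, B}\<close> has norm \<open>O(N)\<close>.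

  Given this, the rest is deterministic (\<open>two_blips_and_bulk_perturb\<close>).  The quadratic form of
  \<open>{Z, B}\<close> is \<open>x \<mapsto> 2 \<langle>Z x, B x\<rangle>\<close>.  It vanishes on the kernel of \<open>Z\<close>, which has codimension \<open>k\<close>,
  so \<open>{Z, B}\<close> has at most \<open>k\<close> positive and at most \<open>k\<close> negative eigenvalues: the two blips exhaust
  them.  By Weyl's inequality (\<open>weyl_card_le\<close>) the \<open>k\<close> eigenvalues of either blip stay in place up
  to \<open>O(N)\<close> under the perturbation, and nothing appears beyond them.  On the kernel of \<open>Z\<close> the form
  of \<open>{A, B}\<close> is that of \<open>{W, B}\<close>, hence \<open>O(N)\<close>, so by the min-max principle
  (\<open>card_eigenvalues_greater_le\<close>) at most \<open>k\<close> eigenvalues of \<open>{A, B}\<close> exceed \<open>O(N)\<close> in either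
  direction.  The remaining \<open>N - 2k\<close> form the bulk.

  The norm estimate has to cope with entries that only have finite moments.  They are truncated at
  a small power \<open>K\<close> of \<open>N\<close>, which by a high moment changes nothing with probability \<open>1 - o(1)\<close>.
  Bernstein's bound for a bilinear form \<open>\<langle>x, V y\<rangle>\<close> and a union bound over a lattice net of
  \<open>exp (O(N))\<close> points would finish the proof if the coordinates of \<open>x\<close> and \<open>y\<close> were all of the order
  \<open>1 / sqrt N\<close>.  In general the coordinates are split at two thresholds \<open>\<tau> < \<theta>\<close>
  (\<open>op_bound_of_classes\<close>).
    \<^item> Coordinates beyond \<open>\<theta>\<close> are so few that norms and inner products of pairs of columns of \<open>V\<close>
      suffice (\<open>ip_mv_le_of_gram\<close>).
    \<^item> If all coordinates of \<open>x\<close> are below \<open>\<tau>\<close> and all those of \<open>y\<close> below \<open>\<theta>\<close>, then Bernstein's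
      bound beats the cardinality of the whole net.
    \<^item> If the coordinates of both vectors lie between \<open>\<tau>\<close> and \<open>\<theta>\<close>, Bernstein's bound is weaker, but
      such vectors are sparse and the net has only \<open>exp (O(N powr (3/4) * ln N))\<close> points of this kind.

  As the norm bound holds with a fixed constant and with probability \<open>1 - o(1)\<close>, both readings of
  the \<open>O(N)\<close> pass from \<open>{Z, B}\<close> to \<open>{A, B}\<close>.
\<close>

section \<open>Vectors and matrices as functions\<close>

text \<open>Vectors of length \<open>N\<close> are functions on \<open>nat\<close> of which only the values below \<open>N\<close> matter, and
  similarly for matrices: \<open>ip\<close> is the inner product and \<open>mv\<close> the product of a matrix and a vector.\<close>

definition ip :: "nat \<Rightarrow> (nat \<Rightarrow> real) \<Rightarrow> (nat \<Rightarrow> real) \<Rightarrow> real" where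
  "ip N x y = (\<Sum>i<N. x i * y i)"

definition mv :: "nat \<Rightarrow> (nat \<Rightarrow> nat \<Rightarrow> real) \<Rightarrow> (nat \<Rightarrow> real) \<Rightarrow> nat \<Rightarrow> real" where
  "mv N a x i = (\<Sum>j<N. a i j * x j)"

text \<open>The vectors \<open>u 0, \<dots>, u (N - 1)\<close> form an orthonormal basis of eigenvectors of \<open>a\<close>, with
  eigenvalues \<open>l 0, \<dots>, l (N - 1)\<close> in no particular order.\<close>

definition eigenbasis ::
  "nat \<Rightarrow> (nat \<Rightarrow> nat \<Rightarrow> real) \<Rightarrow> (nat \<Rightarrow> real) \<Rightarrow> (nat \<Rightarrow> nat \<Rightarrow> real) \<Rightarrow> bool" where
  "eigenbasis N a l u \<longleftrightarrow>
     (\<forall>i<N. \<forall>j<N. ip N (u i) (u j) = (if i = j then 1 else 0)) \<and>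
     (\<forall>i<N. \<forall>r<N. mv N a (u i) r = l i * u i r)"

lemma ip_commute: "ip N x y = ip N y x"
  by (simp add: ip_def mult.commute)

lemma ip_self_nonneg: "0 \<le> ip N x x"
  by (auto simp: ip_def intro!: sum_nonneg)

lemma ip_self_pos: "i < N \<Longrightarrow> x i \<noteq> 0 \<Longrightarrow> 0 < ip N x x"
  unfolding ip_def by (rule sum_pos2[of _ i]) (auto simp: zero_less_mult_iff linorder_neq_iff)

lemma ip_add_left: "ip N (\<lambda>i. x i + y i) z = ip N x z + ip N y z"
  by (simp add: ip_def sum.distrib algebra_simps)

lemma ip_scale_left: "ip N (\<lambda>i. c * x i) y = c * ip N x y"
  by (simp add: ip_def sum_distrib_left mult.assoc)

lemma ip_scale_right: "ip N y (\<lambda>i. c * x i) = c * ip N y x"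
  by (simp add: ip_def sum_distrib_left algebra_simps)

lemma ip_sum_left: "ip N (\<lambda>r. \<Sum>j\<in>J. c j * u j r) y = (\<Sum>j\<in>J. c j * ip N (u j) y)"
proof -
  have "ip N (\<lambda>r. \<Sum>j\<in>J. c j * u j r) y = (\<Sum>r<N. \<Sum>j\<in>J. c j * u j r * y r)"
    by (simp add: ip_def sum_distrib_right)
  also have "\<dots> = (\<Sum>j\<in>J. \<Sum>r<N. c j * u j r * y r)" by (rule sum.swap)
  finally show ?thesis by (simp add: ip_def sum_distrib_left mult.assoc)
qed

lemma ip_sum_right: "ip N y (\<lambda>r. \<Sum>j\<in>J. c j * u j r) = (\<Sum>j\<in>J. c j * ip N y (u j))"
  by (subst (1 2) ip_commute) (rule ip_sum_left)

lemma ip_cong: "(\<And>i. i < N \<Longrightarrow> x i = x' i) \<Longrightarrow> (\<And>i. i < N \<Longrightarrow> y i = y' i) \<Longrightarrow> ip N x y = ip N x' y'"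
  by (simp add: ip_def)

lemma mv_sum: "mv N a (\<lambda>r. \<Sum>j\<in>J. c j * u j r) i = (\<Sum>j\<in>J. c j * mv N a (u j) i)"
proof -
  have "mv N a (\<lambda>r. \<Sum>j\<in>J. c j * u j r) i = ip N (a i) (\<lambda>r. \<Sum>j\<in>J. c j * u j r)"
    by (simp add: mv_def ip_def)
  then show ?thesis by (simp add: ip_sum_right) (simp add: mv_def ip_def)
qed

lemma ip_mv_swap:
  assumes "\<And>i j. i < N \<Longrightarrow> j < N \<Longrightarrow> a i j = a j i"
  shows "ip N (mv N a x) y = ip N x (mv N a y)"
proof -
  have "ip N (mv N a x) y = (\<Sum>i<N. \<Sum>j<N. a i j * x j * y i)"
    by (simp add: ip_def mv_def sum_distrib_right)
  also have "\<dots> = (\<Sum>j<N. \<Sum>i<N. a i j * x j * y i)" by (rule sum.swap)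
  also have "\<dots> = (\<Sum>j<N. \<Sum>i<N. x j * (a j i * y i))"
    by (intro sum.cong refl) (use assms in auto)
  finally show ?thesis by (simp add: ip_def mv_def sum_distrib_left)
qed

section \<open>The spectral theorem for real symmetric matrices\<close>

text \<open>A complex eigenvector \<open>p + \<i> q\<close> exists; symmetry forces the imaginary part of the eigenvalue to
  vanish, and then \<open>p\<close> or \<open>q\<close> is a real eigenvector.\<close>

lemma real_eigenvector_exists:
  fixes a :: "nat \<Rightarrow> nat \<Rightarrow> real"
  assumes sym: "\<And>i j. i < N \<Longrightarrow> j < N \<Longrightarrow> a i j = a j i" and N: "N > 0"
  obtains e v where "ip N v v = 1" and "\<And>i. i < N \<Longrightarrow> mv N a v i = e * v i"
proof -
  note result = that
  define A where "A = Matrix.mat N N (\<lambda>(i, j). complex_of_real (a i j))"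
  have A: "A \<in> carrier_mat N N" by (simp add: A_def)
  obtain z where "eigenvalue A z"
    using spectrum_non_empty[OF A N] by (auto simp: spectrum_def)
  then obtain w where "eigenvector A w z" by (auto simp: eigenvalue_def)
  then have w: "w \<in> carrier_vec N" "w \<noteq> 0\<^sub>v N" "A *\<^sub>v w = z \<cdot>\<^sub>v w"
    using A by (auto simp: eigenvector_def)
  define p q where "p i = Re (w $ i)" and "q i = Im (w $ i)" for i
  have ev: "(\<Sum>j<N. complex_of_real (a i j) * w $ j) = z * w $ i" if "i < N" for i
  proof -
    have "(A *\<^sub>v w) $ i = (z \<cdot>\<^sub>v w) $ i" using w by simp
    then show ?thesis using that w(1)
      by (auto simp: A_def scalar_prod_def lessThan_atLeast0 row_def)
  qed
  have evp: "mv N a p i = Re z * p i - Im z * q i" if "i < N" for i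
    using arg_cong[OF ev[OF that], of Re] by (simp add: mv_def p_def q_def)
  have evq: "mv N a q i = Re z * q i + Im z * p i" if "i < N" for i
    using arg_cong[OF ev[OF that], of Im] by (simp add: mv_def p_def q_def)
  have "ip N (mv N a p) q = ip N p (mv N a q)" by (rule ip_mv_swap) (rule sym)
  moreover have "ip N (mv N a p) q = Re z * ip N p q - Im z * ip N q q"
    by (simp add: ip_def evp sum_subtractf sum_distrib_left algebra_simps)
  moreover have "ip N p (mv N a q) = Re z * ip N p q + Im z * ip N p p"
    by (simp add: ip_def evq sum.distrib sum_distrib_left algebra_simps)
  ultimately have *: "Im z * (ip N p p + ip N q q) = 0" by (simp add: algebra_simps)
  obtain i where i: "i < N" "w $ i \<noteq> 0" using w(1,2) by (metis carrier_vecD eq_vecI index_zero_vec(1) zero_carrier_vec)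
  have "p i \<noteq> 0 \<or> q i \<noteq> 0" using i(2) by (auto simp: p_def q_def complex_eq_iff)
  then have pos: "ip N p p > 0 \<or> ip N q q > 0" using ip_self_pos i(1) by blast
  then have Im: "Im z = 0" using * ip_self_nonneg[of N p] ip_self_nonneg[of N q] by auto
  have fin: thesis if "ip N x x > 0" "\<And>i. i < N \<Longrightarrow> mv N a x i = Re z * x i" for x
  proof (rule result[of _ "Re z"])
    let ?v = "\<lambda>i. (1 / sqrt (ip N x x)) * x i"
    show "ip N ?v ?v = 1" using that(1) by (simp only: ip_scale_left ip_scale_right) (simp add: field_simps)
    show "mv N a ?v i = Re z * ?v i" if "i < N" for i
    proof -
      have "mv N a ?v i = (1 / sqrt (ip N x x)) * mv N a x i" by (simp add: mv_def sum_distrib_left algebra_simps)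
      then show ?thesis using \<open>\<And>i. i < N \<Longrightarrow> mv N a x i = Re z * x i\<close>[OF that] by simp
    qed
  qed
  show thesis using pos
  proof
    assume "ip N p p > 0" then show thesis by (rule fin) (simp add: evp Im)
  next
    assume "ip N q q > 0" then show thesis by (rule fin) (simp add: evq Im)
  qed
qed


text \<open>Householder reflection: a symmetric orthogonal involution that exchanges the first
  standard basis vector with the unit vector \<open>v\<close> (the identity if they coincide).\<close>

lemma householder_exists:
  assumes v: "ip (Suc N) v v = 1"
  shows "\<exists>h :: nat \<Rightarrow> nat \<Rightarrow> real. (\<forall>i j. h i j = h j i) \<and>
    (\<forall>i<Suc N. \<forall>j<Suc N. (\<Sum>r<Suc N. h i r * h r j) = (if i = j then 1 else 0)) \<and>
    (\<forall>i<Suc N. h i 0 = v i)"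
proof (cases "v 0 = 1")
  case True
  have "(\<Sum>i<N. v (Suc i) * v (Suc i)) = 0"
    using v True by (simp add: ip_def sum.lessThan_Suc_shift del: sum.lessThan_Suc)
  then have "v (Suc i) = 0" if "i < N" for i
    using that by (subst (asm) sum_nonneg_eq_0_iff) auto
  then have "(if i = 0 then 1 else 0) = v i" if "i < Suc N" for i
    using that True by (cases i) auto
  moreover have "(\<Sum>r<Suc N. (if i = r then 1 else 0) * (if r = j then 1 else 0)) = (if i = j then 1 else (0::real))"
    if "i < Suc N" for i j
    using that by (simp add: if_distrib cong: if_cong)
  ultimately show ?thesis
    by (intro exI[of _ "\<lambda>i j. if i = j then 1 else 0"] conjI allI impI) (simp_all del: sum.lessThan_Suc)
next
  case False
  define w where "w i = v i - (if i = 0 then 1 else 0)" for i :: nat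
  define s where "s = ip (Suc N) w w"
  have s: "s = 2 - 2 * v 0"
    using v by (simp add: s_def ip_def w_def sum.lessThan_Suc_shift algebra_simps del: sum.lessThan_Suc)
  then have s0: "s \<noteq> 0" using False by simp
  define h where "h i j = (if i = j then 1 else 0) - 2 * w i * w j / s" for i j :: nat
  show ?thesis
  proof (intro exI[of _ h] conjI allI impI)
    show "h i j = h j i" for i j by (simp add: h_def)
    show "h i 0 = v i" if "i < Suc N" for i
    proof -
      have "w 0 = - s / 2" by (simp add: w_def s)
      then have "2 * w i * w 0 / s = - w i" using s0 by simp
      then show ?thesis by (simp add: h_def w_def)
    qed
    show "(\<Sum>r<Suc N. h i r * h r j) = (if i = j then 1 else 0)" if "i < Suc N" "j < Suc N" for i j
    proof -
      have "(\<Sum>r<Suc N. h i r * h r j) =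
        (\<Sum>r<Suc N. (if i = r then (if r = j then 1 else 0) else 0)
           - (if i = r then 2 * w r * w j / s else 0)
           - (if r = j then 2 * w i * w r / s else 0) + 4 * w i * w j / s\<^sup>2 * (w r * w r))"
        by (intro sum.cong refl) (simp add: h_def algebra_simps power2_eq_square)
      also have "\<dots> = (if i = j then 1 else 0) - 2 * w i * w j / s - 2 * w i * w j / s
          + 4 * w i * w j / s\<^sup>2 * s"
        using that unfolding sum.distrib sum_subtractf sum_distrib_left[symmetric]
        by (simp add: s_def ip_def del: sum.lessThan_Suc)
      also have "\<dots> = (if i = j then 1 else 0)" using s0 by (simp add: power2_eq_square)
      finally show ?thesis .
    qed
  qed
qed

text \<open>Induction on the dimension: a Householder reflection moves an eigenvector to the first
  coordinate axis and thereby splits off a block of size one.\<close>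

theorem spectral_theorem:
  fixes a :: "nat \<Rightarrow> nat \<Rightarrow> real"
  assumes "\<And>i j. i < N \<Longrightarrow> j < N \<Longrightarrow> a i j = a j i"
  shows "\<exists>l u. eigenbasis N a l u"
  using assms
proof (induction N arbitrary: a)
  case 0
  then show ?case by (simp add: eigenbasis_def)
next
  case (Suc N)
  note sym = Suc.prems
  obtain e v where v: "ip (Suc N) v v = 1" "\<And>i. i < Suc N \<Longrightarrow> mv (Suc N) a v i = e * v i"
    by (rule real_eigenvector_exists[OF sym zero_less_Suc]) (assumption+, rule that)
  obtain h where h: "\<And>i j. h i j = h j i"
    "\<And>i j. i < Suc N \<Longrightarrow> j < Suc N \<Longrightarrow> (\<Sum>r<Suc N. h i r * h r j) = (if i = j then 1 else 0)"
    "\<And>i. i < Suc N \<Longrightarrow> h i 0 = v i"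
    using householder_exists[OF v(1)] by blast
  let ?H = "mv (Suc N) h"
  have HH: "?H (?H x) i = x i" if "i < Suc N" for x i
  proof -
    have "?H (?H x) i = (\<Sum>j<Suc N. \<Sum>r<Suc N. h i j * h j r * x r)"
      by (simp add: mv_def sum_distrib_left mult.assoc del: sum.lessThan_Suc)
    also have "\<dots> = (\<Sum>r<Suc N. (\<Sum>j<Suc N. h i j * h j r) * x r)"
      by (subst sum.swap) (simp add: sum_distrib_right del: sum.lessThan_Suc)
    also have "\<dots> = (\<Sum>r<Suc N. (if i = r then 1 else 0) * x r)"
      by (intro sum.cong refl) (use that h(2) in \<open>auto simp del: sum.lessThan_Suc\<close>)
    also have "\<dots> = x i" using that by (simp add: if_distrib[of "\<lambda>t. t * _"] del: sum.lessThan_Suc cong: if_cong)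
    finally show ?thesis .
  qed
  have HHip: "ip (Suc N) (?H x) (?H y) = ip (Suc N) x y" for x y
  proof -
    have "ip (Suc N) (?H x) (?H y) = ip (Suc N) x (?H (?H y))"
      by (rule ip_mv_swap) (rule h(1))
    also have "\<dots> = ip (Suc N) x y" by (rule ip_cong) (auto simp: HH)
    finally show ?thesis .
  qed
  have mv_cong: "mv (Suc N) c x i = mv (Suc N) c y i" if "\<And>j. j < Suc N \<Longrightarrow> x j = y j" for c x y i
    using that by (simp add: mv_def del: sum.lessThan_Suc)
  \<comment> \<open>the matrix \<open>a\<close> in the reflected basis; its first row and column vanish off the diagonal\<close>
  define b where "b i j = ip (Suc N) (\<lambda>r. h r i) (mv (Suc N) a (\<lambda>r. h r j))" for i j
  have bsym: "b i j = b j i" for i j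
    unfolding b_def by (subst ip_mv_swap[symmetric]) (use sym in \<open>auto simp: ip_commute\<close>)
  have mvb: "mv (Suc N) b x i = ?H (mv (Suc N) a (?H x)) i" for x i
  proof -
    have "?H (mv (Suc N) a (?H x)) i = ip (Suc N) (\<lambda>r. h r i) (mv (Suc N) a (\<lambda>r. \<Sum>j<Suc N. x j * h r j))"
      unfolding ip_def mv_def[of _ h] by (subst (1) h(1)) (simp add: mult.commute del: sum.lessThan_Suc)
    also have "\<dots> = (\<Sum>j<Suc N. x j * b i j)"
      unfolding b_def by (subst ip_sum_right[symmetric], rule ip_cong) (auto simp: mv_sum simp del: sum.lessThan_Suc)
    finally show ?thesis by (simp add: mv_def mult.commute del: sum.lessThan_Suc)
  qed
  have b0: "b i 0 = (if i = 0 then e else 0)" if "i < Suc N" for i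
  proof -
    have "mv (Suc N) a (\<lambda>r. h r 0) r = e * h r 0" if "r < Suc N" for r
      using v(2)[OF that] h(3)[OF that] mv_cong[of "\<lambda>r. h r 0" v a r] h(3) by simp
    then have "b i 0 = ip (Suc N) (\<lambda>r. h r i) (\<lambda>r. e * h r 0)"
      unfolding b_def by (intro ip_cong) auto
    also have "\<dots> = e * (\<Sum>r<Suc N. h i r * h r 0)"
      unfolding ip_scale_right by (simp add: ip_def h(1)[of _ i] del: sum.lessThan_Suc)
    finally show ?thesis using h(2)[OF that, of 0] by simp
  qed
  obtain l u where lu: "eigenbasis N (\<lambda>i j. b (Suc i) (Suc j)) l u"
    using Suc.IH[of "\<lambda>i j. b (Suc i) (Suc j)"] bsym by blast
  define l' where "l' i = (case i of 0 \<Rightarrow> e | Suc i \<Rightarrow> l i)" for i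
  define u' :: "nat \<Rightarrow> nat \<Rightarrow> real" where
    "u' i r = (case i of 0 \<Rightarrow> (if r = 0 then 1 else 0) | Suc i \<Rightarrow> (case r of 0 \<Rightarrow> 0 | Suc r \<Rightarrow> u i r))" for i r
  have orth: "ip (Suc N) (u' i) (u' j) = (if i = j then 1 else 0)" if "i < Suc N" "j < Suc N" for i j
    using that lu by (cases i; cases j) (auto simp: ip_def u'_def eigenbasis_def sum.lessThan_Suc_shift
        simp del: sum.lessThan_Suc)
  have eig: "mv (Suc N) b (u' i) r = l' i * u' i r" if i: "i < Suc N" and r: "r < Suc N" for i r
  proof (cases i)
    case 0
    then show ?thesis using b0[OF r]
      by (simp add: mv_def u'_def l'_def sum.lessThan_Suc_shift del: sum.lessThan_Suc)
  next
    case (Suc i')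
    have *: "(\<Sum>j<N. b (Suc q) (Suc j) * u i' j) = l i' * u i' q" if "q < N" for q
      using lu that i Suc by (auto simp: eigenbasis_def mv_def)
    have "b 0 (Suc j) = 0" if "j < N" for j using b0[of "Suc j"] that bsym[of 0 "Suc j"] by simp
    then show ?thesis using * r Suc
      by (cases r) (simp_all add: mv_def u'_def l'_def sum.lessThan_Suc_shift del: sum.lessThan_Suc)
  qed
  have "eigenbasis (Suc N) a l' (\<lambda>i. ?H (u' i))"
    unfolding eigenbasis_def
  proof (intro conjI allI impI)
    fix i j assume "i < Suc N" "j < Suc N"
    then show "ip (Suc N) (?H (u' i)) (?H (u' j)) = (if i = j then 1 else 0)"
      by (simp only: HHip orth)
  next
    fix i r assume i: "i < Suc N" and r: "r < Suc N"
    have "mv (Suc N) a (?H (u' i)) r = ?H (?H (mv (Suc N) a (?H (u' i)))) r" using HH[OF r] by simp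
    also have "\<dots> = ?H (\<lambda>q. l' i * u' i q) r"
      by (rule mv_cong) (simp add: mvb[symmetric] eig[OF i])
    also have "\<dots> = l' i * ?H (u' i) r" by (simp add: mv_def sum_distrib_left algebra_simps del: sum.lessThan_Suc)
    finally show "mv (Suc N) a (?H (u' i)) r = l' i * ?H (u' i) r" .
  qed
  then show ?case by blast
qed

lemma eigenbasis_complete:
  assumes "eigenbasis N a l u" and "r < N" and "s < N"
  shows "(\<Sum>i<N. u i r * u i s) = (if r = s then 1 else 0)"
proof -
  define U where "U = Matrix.mat N N (\<lambda>(r, i). u i r)"
  have U: "U \<in> carrier_mat N N" "transpose_mat U \<in> carrier_mat N N" by (auto simp: U_def)
  have "transpose_mat U * U = 1\<^sub>m N"
    using assms(1) by (intro eq_matI) (auto simp: U_def scalar_prod_def eigenbasis_def ip_def lessThan_atLeast0)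
  then have "U * transpose_mat U = 1\<^sub>m N" using mat_mult_left_right_inverse[OF U(2,1)] by simp
  then have "(U * transpose_mat U) $$ (r, s) = 1\<^sub>m N $$ (r, s)" by simp
  then show ?thesis using assms(2,3) by (simp add: U_def scalar_prod_def lessThan_atLeast0)
qed

lemma char_poly_eigenbasis:
  assumes A: "A \<in> carrier_mat N N" and lu: "eigenbasis N (\<lambda>i j. A $$ (i, j)) l u"
  shows "char_poly A = (\<Prod>i<N. [:- l i, 1:])"
proof -
  define U where "U = Matrix.mat N N (\<lambda>(r, i). u i r)"
  define D where "D = Matrix.mat N N (\<lambda>(i, j). if i = j then l i else 0)"
  have c: "U \<in> carrier_mat N N" "transpose_mat U \<in> carrier_mat N N" "D \<in> carrier_mat N N"
    by (auto simp: U_def D_def)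
  have UU: "transpose_mat U * U = 1\<^sub>m N"
    using lu by (intro eq_matI) (auto simp: U_def scalar_prod_def eigenbasis_def ip_def lessThan_atLeast0)
  then have UU': "U * transpose_mat U = 1\<^sub>m N" using mat_mult_left_right_inverse[OF c(2,1)] by simp
  have AU: "A * U = U * D"
  proof (rule eq_matI)
    fix r i assume "r < dim_row (U * D)" "i < dim_col (U * D)"
    then have r: "r < N" and i: "i < N" using c by auto
    have "(A * U) $$ (r, i) = mv N (\<lambda>i j. A $$ (i, j)) (u i) r"
      using r i A by (simp add: U_def scalar_prod_def mv_def lessThan_atLeast0)
    also have "\<dots> = l i * u i r" using lu r i by (simp add: eigenbasis_def)
    also have "\<dots> = (U * D) $$ (r, i)"
      using r i by (simp add: U_def D_def scalar_prod_def if_distrib cong: if_cong)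
    finally show "(A * U) $$ (r, i) = (U * D) $$ (r, i)" .
  qed (use A c in auto)
  have "A = U * D * transpose_mat U"
    using AU UU' A c by (metis assoc_mult_mat right_mult_one_mat)
  then have "similar_mat A D"
    unfolding similar_mat_def using similar_mat_witI[OF UU' UU _ A c(3) c(1,2)] by blast
  then have "char_poly A = char_poly D" by (rule char_poly_similar)
  also have "\<dots> = (\<Prod>x\<leftarrow>diag_mat D. [:- x, 1:])"
    by (rule char_poly_upper_triangular[OF c(3)]) (auto simp: D_def)
  also have "diag_mat D = map l [0..<N]" by (auto simp: diag_mat_def D_def intro!: map_cong)
  also have "(\<Prod>x\<leftarrow>map l [0..<N]. [:- x, 1:]) = (\<Prod>i<N. [:- l i, 1:])"
    by (simp add: prod.distinct_set_conv_list[symmetric] lessThan_atLeast0 o_def)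
  finally show ?thesis .
qed

lemma eig_count_eigenbasis:
  assumes "A \<in> carrier_mat N N" and "eigenbasis N (\<lambda>i j. A $$ (i, j)) l u"
  shows "eig_count A S = card {i. i < N \<and> l i \<in> S}"
proof -
  have "proots (char_poly A) = (\<Sum>i<N. {#l i#})"
    unfolding char_poly_eigenbasis[OF assms] by (subst proots_prod) auto
  also have "\<dots> = image_mset l (mset_set {..<N})"
    by (induction N) (simp_all add: lessThan_Suc)
  finally have "eig_count A S = size (filter_mset (\<lambda>i. l i \<in> S) (mset_set {..<N}))"
    by (simp add: eig_count_def filter_mset_image_mset)
  also have "\<dots> = card {i. i < N \<and> l i \<in> S}"
    by simp
  finally show ?thesis .
qed

section \<open>Eigenvalue counting\<close>

text \<open>A homogeneous linear system with more unknowns than equations has a nontrivial solution.\<close>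

lemma homogeneous_system_solution:
  fixes f :: "'i \<Rightarrow> 'j \<Rightarrow> real"
  assumes "finite I" and "finite J" and "card I < card J"
  shows "\<exists>c. (\<exists>j\<in>J. c j \<noteq> 0) \<and> (\<forall>i\<in>I. (\<Sum>j\<in>J. c j * f i j) = 0)"
  using assms
proof (induction I arbitrary: J f rule: finite_induct)
  case empty
  then have "J \<noteq> {}" by auto
  then show ?case by (intro exI[of _ "\<lambda>_. 1"]) auto
next
  case (insert i0 I)
  show ?case
  proof (cases "\<forall>j\<in>J. f i0 j = 0")
    case True
    have "card I < card J" using insert by simp
    then obtain c where "\<exists>j\<in>J. c j \<noteq> 0" "\<forall>i\<in>I. (\<Sum>j\<in>J. c j * f i j) = 0"
      using insert.IH[OF insert.prems(1)] by blast
    then show ?thesis using True by (intro exI[of _ c]) auto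
  next
    case False
    then obtain j0 where j0: "j0 \<in> J" "f i0 j0 \<noteq> 0" by blast
    let ?J = "J - {j0}"
    have "card I < card ?J" using insert j0 by simp
    then obtain c where c: "\<exists>j\<in>?J. c j \<noteq> 0"
      "\<forall>i\<in>I. (\<Sum>j\<in>?J. c j * (f i j - f i j0 / f i0 j0 * f i0 j)) = 0"
      using insert.IH[of ?J "\<lambda>i j. f i j - f i j0 / f i0 j0 * f i0 j"] insert.prems(1) by blast
    define t where "t = (\<Sum>j\<in>?J. c j * f i0 j)"
    define c' where "c' = c(j0 := - t / f i0 j0)"
    have split: "(\<Sum>j\<in>J. c' j * f i j) = - t / f i0 j0 * f i j0 + (\<Sum>j\<in>?J. c j * f i j)" for i
    proof -
      have "(\<Sum>j\<in>J. c' j * f i j) = c' j0 * f i j0 + (\<Sum>j\<in>?J. c' j * f i j)"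
        by (rule sum.remove) (use insert.prems(1) j0 in auto)
      moreover have "(\<Sum>j\<in>?J. c' j * f i j) = (\<Sum>j\<in>?J. c j * f i j)"
        by (intro sum.cong) (auto simp: c'_def)
      ultimately show ?thesis by (simp add: c'_def)
    qed
    have "(\<Sum>j\<in>J. c' j * f i j) = 0" if "i \<in> insert i0 I" for i
    proof (cases "i = i0")
      case True
      then show ?thesis unfolding split using j0(2) by (simp add: t_def)
    next
      case False
      then have "(\<Sum>j\<in>?J. c j * (f i j - f i j0 / f i0 j0 * f i0 j)) = 0" using c(2) that by blast
      moreover have "(\<Sum>j\<in>?J. c j * (f i j - f i j0 / f i0 j0 * f i0 j)) =
          (\<Sum>j\<in>?J. c j * f i j) - f i j0 / f i0 j0 * t"
        by (simp add: t_def sum_subtractf sum_distrib_left algebra_simps)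
      ultimately show ?thesis unfolding split by (simp add: mult.commute)
    qed
    moreover have "\<exists>j\<in>J. c' j \<noteq> 0" using c(1) by (auto simp: c'_def)
    ultimately show ?thesis by blast
  qed
qed

text \<open>The quadratic form of a matrix.\<close>

definition qf :: "nat \<Rightarrow> (nat \<Rightarrow> nat \<Rightarrow> real) \<Rightarrow> (nat \<Rightarrow> real) \<Rightarrow> real" where
  "qf N a x = ip N x (mv N a x)"

text \<open>The part of the min-max principle that is needed: if the form of \<open>a\<close> is at most \<open>t\<close> on a subspace
  of codimension at most \<open>card F\<close>, then at most \<open>card F\<close> eigenvalues exceed \<open>t\<close>.  Otherwise the span of
  their eigenvectors would meet the subspace nontrivially.\<close>

lemma card_eigenvalues_greater_le:
  assumes lu: "eigenbasis N a l u" and F: "finite F"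
    and le: "\<And>x. (\<And>f. f \<in> F \<Longrightarrow> ip N (g f) x = 0) \<Longrightarrow> qf N a x \<le> t * ip N x x"
  shows "card {i. i < N \<and> l i > t} \<le> card F"
proof (rule ccontr)
  define J where "J = {i. i < N \<and> l i > t}"
  have J: "finite J" "J \<subseteq> {..<N}" by (auto simp: J_def)
  assume "\<not> card {i. i < N \<and> l i > t} \<le> card F"
  then have "card F < card J" by (simp add: J_def)
  then obtain c where c: "\<exists>j\<in>J. c j \<noteq> 0" "\<And>f. f \<in> F \<Longrightarrow> (\<Sum>j\<in>J. c j * ip N (g f) (u j)) = 0"
    using homogeneous_system_solution[OF F J(1), of "\<lambda>f j. ip N (g f) (u j)"] by blast
  define x where "x r = (\<Sum>j\<in>J. c j * u j r)" for r
  have orth: "ip N (u i) (u j) = (if i = j then 1 else 0)" if "i \<in> J" "j \<in> J" for i j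
  proof -
    have "i < N" "j < N" using that J(2) by auto
    then show ?thesis using lu by (simp add: eigenbasis_def)
  qed
  have ux: "ip N (u i) x = c i" if "i \<in> J" for i
  proof -
    have "ip N (u i) x = (\<Sum>j\<in>J. if i = j then c j else 0)"
      unfolding x_def ip_sum_right by (intro sum.cong refl) (auto simp: orth that)
    then show ?thesis using J(1) that by simp
  qed
  have mvx: "mv N a x r = (\<Sum>j\<in>J. (c j * l j) * u j r)" if "r < N" for r
    unfolding x_def mv_sum using lu J(2) that
    by (intro sum.cong refl) (auto simp: eigenbasis_def mult.assoc)
  have "qf N a x = ip N x (\<lambda>r. \<Sum>j\<in>J. (c j * l j) * u j r)"
    unfolding qf_def by (rule ip_cong) (auto simp: mvx)
  also have "\<dots> = (\<Sum>j\<in>J. l j * (c j)\<^sup>2)"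
    unfolding ip_sum_right by (intro sum.cong refl) (simp add: ux ip_commute[of N x "u i" for i] power2_eq_square)
  finally have qfx: "qf N a x = (\<Sum>j\<in>J. l j * (c j)\<^sup>2)" .
  have "ip N x x = ip N x (\<lambda>r. \<Sum>j\<in>J. c j * u j r)" by (rule ip_cong) (auto simp: x_def)
  also have "\<dots> = (\<Sum>j\<in>J. (c j)\<^sup>2)"
    unfolding ip_sum_right by (intro sum.cong refl) (simp add: ux ip_commute[of N x "u i" for i] power2_eq_square)
  finally have ipx: "ip N x x = (\<Sum>j\<in>J. (c j)\<^sup>2)" .
  have "(\<Sum>j\<in>J. t * (c j)\<^sup>2) < (\<Sum>j\<in>J. l j * (c j)\<^sup>2)"
  proof (rule sum_strict_mono_ex1)
    show "\<forall>j\<in>J. t * (c j)\<^sup>2 \<le> l j * (c j)\<^sup>2"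
      by (auto simp: J_def intro!: mult_right_mono)
    show "\<exists>j\<in>J. t * (c j)\<^sup>2 < l j * (c j)\<^sup>2"
      using c(1) by (auto simp: J_def)
  qed (rule J(1))
  then have "t * ip N x x < qf N a x" by (simp add: qfx ipx sum_distrib_left)
  moreover have "qf N a x \<le> t * ip N x x"
  proof (rule le)
    fix f assume "f \<in> F"
    then show "ip N (g f) x = 0" using c(2) unfolding x_def ip_sum_right by blast
  qed
  ultimately show False by simp
qed

lemma eigenbasis_expand:
  assumes lu: "eigenbasis N a l u"
  shows "ip N x x = (\<Sum>i<N. (ip N (u i) x)\<^sup>2)" and "qf N a x = (\<Sum>i<N. l i * (ip N (u i) x)\<^sup>2)"
proof -
  have x: "x r = (\<Sum>i<N. ip N (u i) x * u i r)" if "r < N" for r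
  proof -
    have "(\<Sum>i<N. ip N (u i) x * u i r) = (\<Sum>i<N. \<Sum>s<N. u i r * u i s * x s)"
      by (simp add: ip_def sum_distrib_right sum_distrib_left algebra_simps)
    also have "\<dots> = (\<Sum>s<N. (\<Sum>i<N. u i r * u i s) * x s)"
      by (subst sum.swap) (simp add: sum_distrib_right)
    also have "\<dots> = (\<Sum>s<N. if r = s then x s else 0)"
      by (intro sum.cong refl) (use eigenbasis_complete[OF lu that] in auto)
    also have "\<dots> = x r" using that by simp
    finally show ?thesis by simp
  qed
  have "ip N x x = ip N x (\<lambda>r. \<Sum>i<N. ip N (u i) x * u i r)" by (rule ip_cong) (auto simp: x[symmetric])
  then show "ip N x x = (\<Sum>i<N. (ip N (u i) x)\<^sup>2)"
    unfolding ip_sum_right by (simp add: ip_commute[of N x "u i" for i] power2_eq_square)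
  have "mv N a x r = mv N a (\<lambda>r. \<Sum>i<N. ip N (u i) x * u i r) r" for r
    unfolding mv_def by (intro sum.cong refl) (simp add: x[symmetric])
  also have "\<dots> r = (\<Sum>i<N. (ip N (u i) x * l i) * u i r)" if "r < N" for r
    unfolding mv_sum using lu that by (intro sum.cong refl) (auto simp: eigenbasis_def mult.assoc)
  finally have mvx: "mv N a x r = (\<Sum>i<N. (ip N (u i) x * l i) * u i r)" if "r < N" for r
    using that by simp
  have "qf N a x = ip N x (\<lambda>r. \<Sum>i<N. (ip N (u i) x * l i) * u i r)"
    unfolding qf_def by (rule ip_cong) (auto simp: mvx)
  then show "qf N a x = (\<Sum>i<N. l i * (ip N (u i) x)\<^sup>2)"
    unfolding ip_sum_right by (simp add: ip_commute[of N x "u i" for i] power2_eq_square mult.commute mult.left_commute)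
qed

text \<open>Weyl's inequality, as a comparison of eigenvalue counts.\<close>

lemma weyl_card_le:
  assumes a: "eigenbasis N a l u" and b: "eigenbasis N b m v"
    and d: "\<And>x. qf N a x - qf N b x \<le> d * ip N x x"
  shows "card {i. i < N \<and> l i > t} \<le> card {i. i < N \<and> m i > t - d}"
proof (rule card_eigenvalues_greater_le[OF a])
  fix x assume 0: "\<And>f. f \<in> {i. i < N \<and> m i > t - d} \<Longrightarrow> ip N (v f) x = 0"
  have "qf N b x \<le> (\<Sum>i<N. (t - d) * (ip N (v i) x)\<^sup>2)"
    unfolding eigenbasis_expand(2)[OF b]
  proof (rule sum_mono)
    fix i assume "i \<in> {..<N}"
    then show "m i * (ip N (v i) x)\<^sup>2 \<le> (t - d) * (ip N (v i) x)\<^sup>2"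
      using 0[of i] by (cases "m i > t - d") (auto intro!: mult_right_mono)
  qed
  also have "\<dots> = (t - d) * ip N x x"
    by (simp add: eigenbasis_expand(1)[OF b] sum_distrib_left)
  finally show "qf N a x \<le> t * ip N x x" using d[of x] by (simp add: algebra_simps)
qed simp

text \<open>One blip.  The forms \<open>a\<close> and \<open>b\<close> are close, and \<open>a\<close> vanishes on a subspace of
  codimension at most \<open>k\<close>; if \<open>k\<close> eigenvalues of \<open>a\<close> lie within \<open>r\<close> of \<open>L\<close>, then these are all
  the positive eigenvalues of \<open>a\<close>, and they carry over to \<open>b\<close>.\<close>

lemma blip_perturb:
  assumes a: "eigenbasis N a l u" and b: "eigenbasis N b m v"
    and d: "\<And>x. \<bar>qf N a x - qf N b x\<bar> \<le> d * ip N x x"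
    and F: "finite F" "card F \<le> k"
    and kernel: "\<And>x. (\<And>f. f \<in> F \<Longrightarrow> ip N (g f) x = 0) \<Longrightarrow> qf N a x = 0"
    and k: "card {i. i < N \<and> l i \<in> cball L r} = k"
    and R: "0 \<le> d" "0 \<le> r" "r + d < R" "2 * R < L"
  shows "card {i. i < N \<and> m i \<in> cball L R} = k"
    and "{i. i < N \<and> m i \<in> cball L R} = {i. i < N \<and> m i > d}"
proof -
  have cball: "t \<in> cball L s \<longleftrightarrow> L - s \<le> t \<and> t \<le> L + s" for t s :: real
    by (auto simp: dist_real_def)
  have d1: "qf N a x - qf N b x \<le> d * ip N x x" and d2: "qf N b x - qf N a x \<le> d * ip N x x" for x
    using d[of x] by linarith+
  have pos: "card {i. i < N \<and> l i > 0} \<le> k"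
    using card_eigenvalues_greater_le[OF a F(1), of g 0] kernel F(2) by fastforce
  have fin: "finite {i. i < N \<and> P i}" for P by simp
  have sub0: "{i. i < N \<and> l i \<in> cball L r} \<subseteq> {i. i < N \<and> l i > 0}"
    using R by (auto simp: cball simp del: mem_cball)
  then have "{i. i < N \<and> l i \<in> cball L r} = {i. i < N \<and> l i > 0}"
    using card_mono[OF fin sub0] k pos by (intro card_subset_eq[OF fin sub0]) linarith
  moreover have "{i. i < N \<and> l i > L + r} \<subseteq> {i. i < N \<and> l i > 0} - {i. i < N \<and> l i \<in> cball L r}"
    using R by (auto simp: cball simp del: mem_cball)
  ultimately have "{i. i < N \<and> l i > L + r} = {}" by blast
  moreover have "card {i. i < N \<and> m i > L + r + d} \<le> card {i. i < N \<and> l i > L + r}"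
    using weyl_card_le[OF b a d2, of "L + r + d"] by simp
  ultimately have top: "{i. i < N \<and> m i > L + r + d} = {}" using fin by (metis card_eq_0_iff le_zero_eq)
  have md: "card {i. i < N \<and> m i > d} \<le> k"
  proof -
    have "qf N b x \<le> d * ip N x x" if "\<And>f. f \<in> F \<Longrightarrow> ip N (g f) x = 0" for x
      using d2[of x] kernel[OF that] by simp
    then have "card {i. i < N \<and> m i > d} \<le> card F"
      by (rule card_eigenvalues_greater_le[OF b F(1)])
    then show ?thesis using F(2) by simp
  qed
  have "k \<le> card {i. i < N \<and> l i > L - R + d}"
    unfolding k[symmetric] by (rule card_mono[OF fin]) (use R in \<open>auto simp: cball simp del: mem_cball\<close>)
  also have "\<dots> \<le> card {i. i < N \<and> m i > L - R}"
    using weyl_card_le[OF a b d1, of "L - R + d"] by simp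
  finally have low: "k \<le> card {i. i < N \<and> m i > L - R}" .
  have sub: "{i. i < N \<and> m i > L - R} \<subseteq> {i. i < N \<and> m i > d}" using R by (auto simp: abs_if split: if_splits)
  then have eq: "{i. i < N \<and> m i > L - R} = {i. i < N \<and> m i > d}" 
    using card_mono[OF fin sub] low md by (intro card_subset_eq[OF fin sub]) linarith
  show *: "{i. i < N \<and> m i \<in> cball L R} = {i. i < N \<and> m i > d}"
  proof (intro equalityI subsetI)
    fix i assume "i \<in> {i. i < N \<and> m i > d}"
    then have "i \<in> {i. i < N \<and> m i > L - R}" "i \<notin> {i. i < N \<and> m i > L + r + d}" using eq top by blast+
    then show "i \<in> {i. i < N \<and> m i \<in> cball L R}" using R by (auto simp: cball simp del: mem_cball)
  next
    fix i assume "i \<in> {i. i < N \<and> m i \<in> cball L R}"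
    then show "i \<in> {i. i < N \<and> m i > d}" using R by (auto simp: cball simp del: mem_cball)
  qed
  show "card {i. i < N \<and> m i \<in> cball L R} = k"
    unfolding * using eq low md by simp
qed


text \<open>The operator norm of the \<open>N\<close> by \<open>N\<close> matrix \<open>a\<close> is at most \<open>c\<close>, stated for its bilinear form.\<close>

definition op_bound :: "nat \<Rightarrow> (nat \<Rightarrow> nat \<Rightarrow> real) \<Rightarrow> real \<Rightarrow> bool" where
  "op_bound N a c \<longleftrightarrow> (\<forall>x y. \<bar>ip N x (mv N a y)\<bar> \<le> c * sqrt (ip N x x) * sqrt (ip N y y))"

lemma op_bound_mv:
  assumes "op_bound N a c" and "c \<ge> 0"
  shows "sqrt (ip N (mv N a x) (mv N a x)) \<le> c * sqrt (ip N x x)"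
proof -
  define s where "s = sqrt (ip N (mv N a x) (mv N a x))"
  have s: "s \<ge> 0" "s * s = ip N (mv N a x) (mv N a x)" by (auto simp: s_def ip_self_nonneg)
  have "s * s \<le> s * (c * sqrt (ip N x x))"
    using assms(1)[unfolded op_bound_def, rule_format, of "mv N a x" x] s
    by (simp add: s_def[symmetric] mult.commute mult.left_commute)
  then have "s \<le> c * sqrt (ip N x x)"
    using s(1) assms(2) ip_self_nonneg[of N x] by (cases "s = 0") auto
  then show ?thesis by (simp add: s_def)
qed

lemma qf_anticommutator:
  assumes A: "A \<in> carrier_mat N N" "transpose_mat A = A"
    and B: "B \<in> carrier_mat N N" "transpose_mat B = B"
  shows "qf N (\<lambda>i j. anticommutator A B $$ (i, j)) x =
    2 * ip N (mv N (\<lambda>i j. A $$ (i, j)) x) (mv N (\<lambda>i j. B $$ (i, j)) x)"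
proof -
  have sym: "C $$ (i, j) = C $$ (j, i)" if "C \<in> carrier_mat N N" "transpose_mat C = C" "i < N" "j < N"
    for C :: "real mat" and i j
    using that by (metis carrier_matD index_transpose_mat(1))
  have mv_mult: "mv N (\<lambda>i j. (C * D) $$ (i, j)) x i =
      mv N (\<lambda>i j. C $$ (i, j)) (mv N (\<lambda>i j. D $$ (i, j)) x) i"
    if "C \<in> carrier_mat N N" "D \<in> carrier_mat N N" "i < N" for C D :: "real mat" and i
  proof -
    have "mv N (\<lambda>i j. (C * D) $$ (i, j)) x i = (\<Sum>j<N. \<Sum>r<N. C $$ (i, r) * D $$ (r, j) * x j)"
      using that by (auto simp: mv_def scalar_prod_def lessThan_atLeast0 sum_distrib_right intro!: sum.cong)
    also have "\<dots> = (\<Sum>r<N. \<Sum>j<N. C $$ (i, r) * D $$ (r, j) * x j)" by (rule sum.swap)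
    finally show ?thesis by (simp add: mv_def sum_distrib_left mult.assoc)
  qed
  have "mv N (\<lambda>i j. anticommutator A B $$ (i, j)) x i =
      mv N (\<lambda>i j. A $$ (i, j)) (mv N (\<lambda>i j. B $$ (i, j)) x) i +
      mv N (\<lambda>i j. B $$ (i, j)) (mv N (\<lambda>i j. A $$ (i, j)) x) i" if "i < N" for i
  proof -
    have "mv N (\<lambda>i j. anticommutator A B $$ (i, j)) x i =
        mv N (\<lambda>i j. (A * B) $$ (i, j)) x i + mv N (\<lambda>i j. (B * A) $$ (i, j)) x i"
      unfolding mv_def sum.distrib[symmetric]
      by (intro sum.cong refl) (use A B that in \<open>auto simp: anticommutator_def algebra_simps\<close>)
    then show ?thesis using that A B by (simp add: mv_mult)
  qed
  then have "qf N (\<lambda>i j. anticommutator A B $$ (i, j)) x =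
      ip N x (\<lambda>i. mv N (\<lambda>i j. A $$ (i, j)) (mv N (\<lambda>i j. B $$ (i, j)) x) i +
      mv N (\<lambda>i j. B $$ (i, j)) (mv N (\<lambda>i j. A $$ (i, j)) x) i)"
    unfolding qf_def by (intro ip_cong) auto
  also have "\<dots> = ip N x (mv N (\<lambda>i j. A $$ (i, j)) (mv N (\<lambda>i j. B $$ (i, j)) x)) +
      ip N x (mv N (\<lambda>i j. B $$ (i, j)) (mv N (\<lambda>i j. A $$ (i, j)) x))"
    by (simp add: ip_def sum.distrib algebra_simps)
  also have "ip N x (mv N (\<lambda>i j. A $$ (i, j)) (mv N (\<lambda>i j. B $$ (i, j)) x)) =
      ip N (mv N (\<lambda>i j. A $$ (i, j)) x) (mv N (\<lambda>i j. B $$ (i, j)) x)"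
    by (rule ip_mv_swap[symmetric]) (rule sym[OF A])
  also have "ip N x (mv N (\<lambda>i j. B $$ (i, j)) (mv N (\<lambda>i j. A $$ (i, j)) x)) =
      ip N (mv N (\<lambda>i j. B $$ (i, j)) x) (mv N (\<lambda>i j. A $$ (i, j)) x)"
    by (rule ip_mv_swap[symmetric]) (rule sym[OF B])
  finally show ?thesis by (simp add: ip_commute)
qed

lemma anticommutator_eigenbasis:
  assumes A: "A \<in> carrier_mat N N" "transpose_mat A = A"
    and B: "B \<in> carrier_mat N N" "transpose_mat B = B"
  obtains l u where "eigenbasis N (\<lambda>i j. anticommutator A B $$ (i, j)) l u"
    and "\<And>S. eig_count (anticommutator A B) S = card {i. i < N \<and> l i \<in> S}"
proof -
  have c: "anticommutator A B \<in> carrier_mat N N" using A B by (auto simp: anticommutator_def)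
  have "transpose_mat (anticommutator A B) = anticommutator A B"
    unfolding anticommutator_def using A B
    by (simp add: transpose_add[of _ N N] transpose_mult[of _ N N _ N] comm_add_mat[of _ N N])
  then have "anticommutator A B $$ (i, j) = anticommutator A B $$ (j, i)" if "i < N" "j < N" for i j
    using that c by (metis carrier_matD index_transpose_mat(1))
  then obtain l u where "eigenbasis N (\<lambda>i j. anticommutator A B $$ (i, j)) l u"
    using spectral_theorem[of N "\<lambda>i j. anticommutator A B $$ (i, j)"] by blast
  then show thesis using that eig_count_eigenbasis[OF c] by blast
qed

lemma eigenbasis_uminus: "eigenbasis N a l u \<Longrightarrow> eigenbasis N (\<lambda>i j. - a i j) (\<lambda>i. - l i) u"
  by (auto simp: eigenbasis_def mv_def sum_negf)

lemma qf_uminus: "qf N (\<lambda>i j. - a i j) x = - qf N a x"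
  by (simp add: qf_def ip_def mv_def sum_negf)

text \<open>The deterministic half of the argument.  The negative blip is the positive blip of the negated
  matrices.\<close>

lemma two_blips_and_bulk_perturb:
  assumes A: "A \<in> carrier_mat N N" "transpose_mat A = A"
    and B: "B \<in> carrier_mat N N" "transpose_mat B = B"
    and k: "k \<ge> 1" and N: "N > 0"
    and blips: "two_blips k N C (anticommutator (mean_checkerboard k N) B)"
    and nA: "op_bound N (\<lambda>i j. A $$ (i, j) - mean_checkerboard k N $$ (i, j)) cA" "cA \<ge> 0"
    and nB: "op_bound N (\<lambda>i j. B $$ (i, j)) cB" "cB \<ge> 0"
    and c: "2 * cA * cB \<le> c * real N"
    and large: "2 * ((C + c + 1) * real N) < real N powr (3/2) / real k"
  shows "two_blips_and_bulk k N (C + c + 1) (anticommutator A B)"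
proof -
  define Z where "Z = mean_checkerboard k N"
  have Z: "Z \<in> carrier_mat N N" "transpose_mat Z = Z"
    by (auto simp: Z_def mean_checkerboard_def)
  define L where "L = real N powr (3/2) / real k"
  define d where "d = c * real N"
  have "2 * cA * cB \<ge> 0" using nA(2) nB(2) by simp
  then have d0: "d \<ge> 0" using c by (simp add: d_def)
  obtain l u where lu: "eigenbasis N (\<lambda>i j. anticommutator Z B $$ (i, j)) l u"
    and cl: "\<And>S. eig_count (anticommutator Z B) S = card {i. i < N \<and> l i \<in> S}"
    using anticommutator_eigenbasis[OF Z B] by blast
  obtain m v where mv: "eigenbasis N (\<lambda>i j. anticommutator A B $$ (i, j)) m v"
    and cm: "\<And>S. eig_count (anticommutator A B) S = card {i. i < N \<and> m i \<in> S}"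
    using anticommutator_eigenbasis[OF A B] by blast
  let ?a = "\<lambda>i j. anticommutator Z B $$ (i, j)" and ?b = "\<lambda>i j. anticommutator A B $$ (i, j)"
  have close: "\<bar>qf N ?a x - qf N ?b x\<bar> \<le> d * ip N x x" for x
  proof -
    let ?W = "\<lambda>i j. A $$ (i, j) - Z $$ (i, j)"
    have mvA: "mv N (\<lambda>i j. A $$ (i, j)) x i = mv N (\<lambda>i j. Z $$ (i, j)) x i + mv N ?W x i" for i
      by (simp add: mv_def sum_subtractf algebra_simps)
    have "qf N ?b x - qf N ?a x = 2 * ip N (mv N (\<lambda>i j. B $$ (i, j)) x) (mv N ?W x)"
      unfolding qf_anticommutator[OF A B] qf_anticommutator[OF Z B]
      by (simp add: ip_def mvA sum.distrib algebra_simps)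
    then have "\<bar>qf N ?a x - qf N ?b x\<bar> = 2 * \<bar>ip N (mv N (\<lambda>i j. B $$ (i, j)) x) (mv N ?W x)\<bar>"
      by (simp add: abs_minus_commute abs_mult)
    also have "\<dots> \<le> 2 * (cA * sqrt (ip N (mv N (\<lambda>i j. B $$ (i, j)) x) (mv N (\<lambda>i j. B $$ (i, j)) x)) * sqrt (ip N x x))"
      using nA(1)[folded Z_def] unfolding op_bound_def by auto
    also have "\<dots> \<le> 2 * (cA * (cB * sqrt (ip N x x)) * sqrt (ip N x x))"
      by (intro mult_left_mono mult_right_mono op_bound_mv[OF nB]) (auto simp: nA(2) ip_self_nonneg)
    also have "\<dots> = 2 * cA * cB * ip N x x" using ip_self_nonneg[of N x] by simp
    also have "\<dots> \<le> d * ip N x x" using c ip_self_nonneg[of N x] by (intro mult_right_mono) (auto simp: d_def)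
    finally show ?thesis .
  qed
  \<comment> \<open>the mean matrix maps \<open>x\<close> to its sums over the residue classes modulo \<open>k\<close>; these are \<open>k\<close>
    linear conditions\<close>
  define g :: "nat \<Rightarrow> nat \<Rightarrow> real" where "g f i = (if i mod k = f then 1 else 0)" for f i
  have kernel: "qf N ?a x = 0" if "\<And>f. f \<in> {..<k} \<Longrightarrow> ip N (g f) x = 0" for x
  proof -
    have "mv N (\<lambda>i j. Z $$ (i, j)) x i = ip N (g (i mod k)) x" if "i < N" for i
      using that by (auto simp: mv_def Z_def mean_checkerboard_def ip_def g_def intro!: sum.cong)
    then have "mv N (\<lambda>i j. Z $$ (i, j)) x i = 0" if "i < N" for i
      using that \<open>\<And>f. f \<in> {..<k} \<Longrightarrow> ip N (g f) x = 0\<close>[of "i mod k"] k by simp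
    then show ?thesis unfolding qf_anticommutator[OF Z B] by (simp add: ip_def)
  qed
  have bl: "card {i. i < N \<and> l i \<in> cball L (C * real N)} = k"
    "card {i. i < N \<and> l i \<in> cball (- L) (C * real N)} = k"
    using blips[folded Z_def] by (auto simp: two_blips_def cl L_def)
  have C0: "0 \<le> C * real N"
  proof (rule ccontr)
    assume "\<not> 0 \<le> C * real N"
    then have "cball L (C * real N) = {}" by auto
    then show False using bl(1) k by simp
  qed
  define R where "R = (C + c + 1) * real N"
  have R: "0 \<le> d" "0 \<le> C * real N" "C * real N + d < R" "2 * R < L"
    using d0 C0 large N by (auto simp: R_def d_def L_def algebra_simps)
  have card_k: "card {..<k} \<le> k" by simp
  note up = blip_perturb[OF lu mv close finite_lessThan card_k kernel bl(1) R]
  have mir: "- t \<in> cball L s \<longleftrightarrow> t \<in> cball (- L) s" for t s by (auto simp: dist_real_def)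
  have neg: "card {i. i < N \<and> - l i \<in> cball L (C * real N)} = k"
    using bl(2) by (simp only: mir)
  note down = blip_perturb[OF eigenbasis_uminus[OF lu] eigenbasis_uminus[OF mv] _ finite_lessThan card_k _ neg R, of g,
      unfolded qf_uminus]
  have up1: "card {i. i < N \<and> m i \<in> cball L R} = k" by (rule up(1)) simp_all
  have up2: "{i. i < N \<and> m i \<in> cball L R} = {i. i < N \<and> m i > d}" by (rule up(2)) simp_all
  have close': "\<bar>- qf N ?a x - - qf N ?b x\<bar> \<le> d * ip N x x" for x
    using close[of x] by (simp add: abs_minus_commute)
  have down1: "card {i. i < N \<and> - m i \<in> cball L R} = k"
    by (rule down(1)[OF close']) (auto intro!: kernel simp del: mem_cball)
  have down2: "{i. i < N \<and> - m i \<in> cball L R} = {i. i < N \<and> - m i > d}"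
    by (rule down(2)[OF close']) (auto intro!: kernel simp del: mem_cball)
  have "{i. i < N \<and> m i \<in> cball 0 R} = {..<N} - ({i. i < N \<and> m i > d} \<union> {i. i < N \<and> - m i > d})"
  proof (intro equalityI subsetI)
    fix i assume "i \<in> {..<N} - ({i. i < N \<and> m i > d} \<union> {i. i < N \<and> - m i > d})"
    then show "i \<in> {i. i < N \<and> m i \<in> cball 0 R}" using R by (auto simp: dist_real_def)
  next
    fix i assume i: "i \<in> {i. i < N \<and> m i \<in> cball 0 R}"
    then have "m i \<notin> cball L R" "- m i \<notin> cball L R" using R by (auto simp: dist_real_def)
    then show "i \<in> {..<N} - ({i. i < N \<and> m i > d} \<union> {i. i < N \<and> - m i > d})"
      using i up2 down2 by blast
  qed
  moreover have "card ({i. i < N \<and> m i > d} \<union> {i. i < N \<and> - m i > d}) = k + k"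
    using up1 down1 unfolding up2 down2 by (subst card_Un_disjoint) (use d0 in auto)
  moreover have "card ({i. i < N \<and> m i > d} \<union> {i. i < N \<and> - m i > d}) \<le> card {..<N}"
    by (rule card_mono) auto
  ultimately have "int (card {i. i < N \<and> m i \<in> cball 0 R}) = int N - 2 * int k"
    by (simp add: card_Diff_subset[of "{i. i < N \<and> m i > d} \<union> {i. i < N \<and> - m i > d}" "{..<N}"] Un_subset_iff subset_iff)
  then show ?thesis
    using up1 down1 unfolding mir
    by (simp only: two_blips_and_bulk_def two_blips_def cm L_def[symmetric] R_def[symmetric] simp_thms)
qed

section \<open>Lattice nets\<close>

text \<open>Counting by exponential weights: the weights of all points of the product set add up to a
  power.\<close>

lemma card_PiE_le_weights:
  fixes w :: "int \<Rightarrow> real"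
  assumes Z: "finite Z" and F: "F \<subseteq> PiE {..<N::nat} (\<lambda>_. Z)"
    and w: "\<And>m. m \<in> Z \<Longrightarrow> 0 \<le> w m" and c: "0 \<le> c"
    and le: "\<And>n. n \<in> F \<Longrightarrow> 1 \<le> c * (\<Prod>i<N. w (n i))"
  shows "real (card F) \<le> c * (\<Sum>m\<in>Z. w m) ^ N"
proof -
  have fin: "finite (PiE {..<N} (\<lambda>_. Z))" using Z by (intro finite_PiE) auto
  have "real (card F) = (\<Sum>n\<in>F. 1)" by simp
  also have "\<dots> \<le> (\<Sum>n\<in>F. c * (\<Prod>i<N. w (n i)))" by (rule sum_mono) (rule le)
  also have "\<dots> \<le> (\<Sum>n\<in>PiE {..<N} (\<lambda>_. Z). c * (\<Prod>i<N. w (n i)))"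
    by (rule sum_mono2[OF fin F]) (auto intro!: mult_nonneg_nonneg c prod_nonneg w)
  also have "\<dots> = c * (\<Prod>i<N. \<Sum>m\<in>Z. w m)"
    by (subst prod_sum_PiE) (use Z in \<open>auto simp: sum_distrib_left\<close>)
  finally show ?thesis by simp
qed

text \<open>The points of the lattice of mesh \<open>1 / (4 * sqrt N)\<close> in the unit ball.  They are represented by
  their integer coordinates \<open>n\<close>, with \<open>lattice_point N n\<close> as the actual vector; the bound \<open>4 * N\<close> on
  the coordinates is implied and makes finiteness obvious.  The extensional function space \<open>PiE\<close>
  fixes the irrelevant values at \<open>N\<close> and beyond.\<close>

definition lattice_ball :: "nat \<Rightarrow> (nat \<Rightarrow> int) set" where
  "lattice_ball N = {n \<in> PiE {..<N} (\<lambda>_. {- int (4 * N)..int (4 * N)}).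
     (\<Sum>i<N. (n i)\<^sup>2) \<le> int (16 * N)}"

definition lattice_point :: "nat \<Rightarrow> (nat \<Rightarrow> int) \<Rightarrow> nat \<Rightarrow> real" where
  "lattice_point N n i = real_of_int (n i) / (4 * sqrt (real N))"

lemma finite_lattice_ball: "finite (lattice_ball N)"
proof -
  have "finite (PiE {..<N} (\<lambda>_. {- int (4 * N)..int (4 * N)}))" by (intro finite_PiE) auto
  then show ?thesis by (rule rev_finite_subset) (auto simp: lattice_ball_def)
qed

lemma ip_lattice_point_le:
  assumes "n \<in> lattice_ball N"
  shows "ip N (lattice_point N n) (lattice_point N n) \<le> 1"
proof (cases "N = 0")
  case False
  have "ip N (lattice_point N n) (lattice_point N n) = (\<Sum>i<N. (real_of_int (n i))\<^sup>2) / (16 * real N)"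
    unfolding ip_def sum_divide_distrib
    by (intro sum.cong refl) (simp add: lattice_point_def power2_eq_square)
  moreover have "real_of_int (\<Sum>i<N. (n i)\<^sup>2) \<le> real_of_int (int (16 * N))"
    using assms unfolding lattice_ball_def of_int_le_iff by auto
  ultimately show ?thesis using False by (simp add: divide_le_eq)
qed (simp add: ip_def)

lemma sum_half_powers: "(\<Sum>m\<in>{- int M..int M}. (1/2) ^ nat \<bar>m\<bar>) = 3 - 2 * (1/2 :: real) ^ M"
proof (induction M)
  case (Suc M)
  have "{- int (Suc M)..int (Suc M)} = insert (- int (Suc M)) (insert (int (Suc M)) {- int M..int M})"
    by auto
  then show ?case using Suc by (simp add: nat_add_distrib)
qed simp

lemma card_lattice_ball_le: "real (card (lattice_ball N)) \<le> exp (18 * real N)"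
proof -
  let ?Z = "{- int (4 * N)..int (4 * N)}"
  have "real (card (lattice_ball N)) \<le> 2 ^ (16 * N) * (\<Sum>m\<in>?Z. (1/2) ^ nat \<bar>m\<bar>) ^ N"
  proof (rule card_PiE_le_weights)
    fix n assume n: "n \<in> lattice_ball N"
    have sq: "\<bar>m\<bar> \<le> m\<^sup>2" for m :: int
    proof (cases "m = 0")
      case False
      then have "\<bar>m\<bar> * 1 \<le> \<bar>m\<bar> * \<bar>m\<bar>" by (intro mult_left_mono) auto
      then show ?thesis by (simp add: power2_eq_square)
    qed simp
    have "int (\<Sum>i<N. nat \<bar>n i\<bar>) = (\<Sum>i<N. \<bar>n i\<bar>)" by simp
    also have "\<dots> \<le> (\<Sum>i<N. (n i)\<^sup>2)" by (intro sum_mono sq)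
    also have "\<dots> \<le> int (16 * N)" using n by (simp add: lattice_ball_def)
    finally have "(\<Sum>i<N. nat \<bar>n i\<bar>) \<le> 16 * N" by linarith
    then have "(1/2 :: real) ^ (16 * N) \<le> (1/2) ^ (\<Sum>i<N. nat \<bar>n i\<bar>)"
      by (rule power_decreasing) auto
    then have "2 ^ (16 * N) * (1/2 :: real) ^ (16 * N) \<le> 2 ^ (16 * N) * (1/2) ^ (\<Sum>i<N. nat \<bar>n i\<bar>)"
      by (rule mult_left_mono) simp
    then show "1 \<le> 2 ^ (16 * N) * (\<Prod>i<N. (1/2 :: real) ^ nat \<bar>n i\<bar>)"
      by (simp add: power_sum power_mult_distrib[symmetric])
  qed (auto simp: lattice_ball_def)
  also have "\<dots> \<le> exp 1 ^ (16 * N) * (exp 2) ^ N"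
  proof (intro mult_mono power_mono)
    show "(2::real) \<le> exp 1" using exp_ge_add_one_self[of 1] by simp
    show "(\<Sum>m\<in>?Z. (1/2) ^ nat \<bar>m\<bar>) \<le> exp (2::real)"
      using exp_ge_add_one_self[of 2] unfolding sum_half_powers by (smt (verit) zero_le_power half_gt_zero_iff zero_less_one)
  qed (auto simp: sum_nonneg)
  also have "\<dots> = exp (18 * real N)" by (simp add: exp_of_nat_mult[symmetric] exp_add[symmetric])
  finally show ?thesis .
qed

text \<open>Points whose nonzero coordinates exceed \<open>\<tau>\<close> have few of them, and are therefore few.\<close>

lemma card_sparse_lattice_le:
  assumes \<tau>: "\<tau> > 0" and N: "N > 0"
  shows "real (card {n \<in> lattice_ball N. \<forall>i<N. n i = 0 \<or> \<tau> < \<bar>lattice_point N n i\<bar>})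
    \<le> exp (1 + ln (8 * (real N)\<^sup>2) / \<tau>\<^sup>2)"
proof -
  let ?F = "{n \<in> lattice_ball N. \<forall>i<N. n i = 0 \<or> \<tau> < \<bar>lattice_point N n i\<bar>}"
  let ?Z = "{- int (4 * N)..int (4 * N)}"
  \<comment> \<open>each nonzero coordinate gets the weight \<open>1 / q\<close>, with \<open>q\<close> so large that the at most \<open>8 * N\<close>
    nonzero values add only \<open>1 / N\<close> to the total weight per coordinate\<close>
  define q where "q = 8 * (real N)\<^sup>2"
  have q: "q \<ge> 1" using N by (simp add: q_def) (smt (verit) of_nat_1 of_nat_le_iff One_nat_def Suc_leI one_le_power)
  define w :: "int \<Rightarrow> real" where "w m = (if m = 0 then 1 else 1 / q)" for m
  have "real (card ?F) \<le> q powr (1 / \<tau>\<^sup>2) * (\<Sum>m\<in>?Z. w m) ^ N"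
  proof (rule card_PiE_le_weights)
    fix n assume n: "n \<in> ?F"
    define S where "S = {i \<in> {..<N}. n i \<noteq> 0}"
    have "real (card S) * \<tau>\<^sup>2 = (\<Sum>i\<in>S. \<tau>\<^sup>2)" by simp
    also have "\<dots> \<le> (\<Sum>i\<in>S. lattice_point N n i * lattice_point N n i)"
    proof (rule sum_mono)
      fix i assume "i \<in> S"
      then have "\<tau> < \<bar>lattice_point N n i\<bar>" using n by (auto simp: S_def)
      then have "\<tau>\<^sup>2 \<le> \<bar>lattice_point N n i\<bar>\<^sup>2" using \<tau> by (intro power_mono) auto
      then show "\<tau>\<^sup>2 \<le> lattice_point N n i * lattice_point N n i" by (simp add: power2_eq_square)
    qed
    also have "\<dots> \<le> ip N (lattice_point N n) (lattice_point N n)"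
      unfolding ip_def by (rule sum_mono2) (auto simp: S_def)
    also have "\<dots> \<le> 1" using n by (intro ip_lattice_point_le) auto
    finally have "real (card S) \<le> 1 / \<tau>\<^sup>2" using \<tau> by (simp add: field_simps)
    then have "q powr real (card S) \<le> q powr (1 / \<tau>\<^sup>2)" using q by (intro powr_mono) auto
    moreover have "(\<Prod>i<N. w (n i)) = (\<Prod>i\<in>S. 1 / q)"
      unfolding S_def by (subst prod.inter_filter) (auto simp: w_def intro!: prod.cong)
    then have "(\<Prod>i<N. w (n i)) = 1 / q powr real (card S)"
      using q by (simp add: powr_realpow power_one_over)
    ultimately show "1 \<le> q powr (1 / \<tau>\<^sup>2) * (\<Prod>i<N. w (n i))"
      using q by (simp add: le_divide_eq)
  qed (use q in \<open>auto simp: lattice_ball_def w_def\<close>)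
  also have "(\<Sum>m\<in>?Z. w m) = 1 + 1 / real N"
  proof -
    have "(\<Sum>m\<in>?Z. w m) = w 0 + (\<Sum>m\<in>?Z - {0}. w m)" by (rule sum.remove) auto
    also have "(\<Sum>m\<in>?Z - {0}. w m) = (\<Sum>m\<in>?Z - {0}. 1 / q)" by (intro sum.cong) (auto simp: w_def)
    also have "\<dots> = real (8 * N) / q" by (simp add: card_Diff_subset)
    finally show ?thesis using N by (simp add: w_def q_def power2_eq_square)
  qed
  also have "q powr (1 / \<tau>\<^sup>2) * (1 + 1 / real N) ^ N \<le> q powr (1 / \<tau>\<^sup>2) * exp 1"
  proof (rule mult_left_mono)
    have "(1 + 1 / real N) ^ N \<le> exp (1 / real N) ^ N" by (intro power_mono exp_ge_add_one_self) auto
    then show "(1 + 1 / real N) ^ N \<le> exp 1" using N by (simp add: exp_of_nat_mult[symmetric])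
  qed simp
  also have "\<dots> = exp (1 + ln q / \<tau>\<^sup>2)" using q by (simp add: powr_def exp_add)
  finally show ?thesis by (simp add: q_def)
qed

section \<open>From the net to the operator norm\<close>

text \<open>Rounding the coordinates toward zero keeps a vector in the unit ball and moves it by at most
  \<open>1 / 4\<close>.\<close>

lemma lattice_rounding:
  assumes N: "N > 0" and x: "ip N x x \<le> 1"
  obtains n where "n \<in> lattice_ball N"
    and "ip N (\<lambda>i. x i - lattice_point N n i) (\<lambda>i. x i - lattice_point N n i) \<le> 1 / 16"
proof -
  define h where "h = 1 / (4 * sqrt (real N))"
  have h: "h > 0" using N by (simp add: h_def)
  define n where "n = (\<lambda>i\<in>{..<N}. if x i \<ge> 0 then \<lfloor>x i / h\<rfloor> else \<lceil>x i / h\<rceil>)"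
  have lp: "lattice_point N n i = h * real_of_int (n i)" for i by (simp add: lattice_point_def h_def)
  have shrink: "\<bar>h * real_of_int (n i)\<bar> \<le> \<bar>x i\<bar>" and err: "\<bar>x i - h * real_of_int (n i)\<bar> \<le> h" if "i < N" for i
  proof -
    define t where "t = x i / h"
    have xt: "x i = h * t" using h by (simp add: t_def)
    have "\<bar>real_of_int (n i)\<bar> \<le> \<bar>t\<bar> \<and> \<bar>t - real_of_int (n i)\<bar> \<le> 1"
    proof (cases "x i \<ge> 0")
      case True
      then have "t \<ge> 0" using h by (simp add: t_def)
      moreover have "n i = \<lfloor>t\<rfloor>" using True that by (simp add: n_def t_def)
      moreover have "0 \<le> real_of_int \<lfloor>t\<rfloor>" using \<open>t \<ge> 0\<close> by simp
      moreover have "t - real_of_int \<lfloor>t\<rfloor> \<le> 1" "real_of_int \<lfloor>t\<rfloor> \<le> t" by linarith+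
      ultimately show ?thesis by simp
    next
      case False
      then have "t \<le> 0" using h by (simp add: t_def divide_le_0_iff)
      moreover have "n i = \<lceil>t\<rceil>" using False that by (simp add: n_def t_def)
      moreover have "real_of_int \<lceil>t\<rceil> \<le> 0" using \<open>t \<le> 0\<close> by simp
      moreover have "real_of_int \<lceil>t\<rceil> - t \<le> 1" "t \<le> real_of_int \<lceil>t\<rceil>" by linarith+
      ultimately show ?thesis by simp
    qed
    then have 1: "\<bar>real_of_int (n i)\<bar> \<le> \<bar>t\<bar>" and 2: "\<bar>t - real_of_int (n i)\<bar> \<le> 1" by auto
    show "\<bar>h * real_of_int (n i)\<bar> \<le> \<bar>x i\<bar>" using 1 h by (simp add: xt abs_mult)
    have "\<bar>x i - h * real_of_int (n i)\<bar> = h * \<bar>t - real_of_int (n i)\<bar>"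
      using h by (simp add: xt right_diff_distrib[symmetric] abs_mult)
    then show "\<bar>x i - h * real_of_int (n i)\<bar> \<le> h" using 2 h by simp
  qed
  have "(\<Sum>i<N. (h * real_of_int (n i))\<^sup>2) \<le> ip N x x"
    unfolding ip_def
  proof (rule sum_mono)
    fix i assume "i \<in> {..<N}"
    then have "\<bar>h * real_of_int (n i)\<bar>\<^sup>2 \<le> \<bar>x i\<bar>\<^sup>2" by (intro power_mono shrink) auto
    then show "(h * real_of_int (n i))\<^sup>2 \<le> x i * x i" by (simp add: power2_eq_square)
  qed
  then have "h\<^sup>2 * real_of_int (\<Sum>i<N. (n i)\<^sup>2) \<le> 1"
    using x by (simp add: power_mult_distrib sum_distrib_left)
  then have "real_of_int (\<Sum>i<N. (n i)\<^sup>2) \<le> real (16 * N)"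
    using N by (simp add: h_def power_divide power_mult_distrib field_simps del: of_int_sum)
  then have sq: "(\<Sum>i<N. (n i)\<^sup>2) \<le> int (16 * N)" by linarith
  have "n i \<in> {- int (4 * N)..int (4 * N)}" if "i < N" for i
  proof -
    have "(n i)\<^sup>2 \<le> (\<Sum>i<N. (n i)\<^sup>2)" by (rule member_le_sum) (use that in auto)
    also have "\<dots> \<le> int (16 * N)" by (rule sq)
    also have "\<dots> \<le> (int (4 * N))\<^sup>2" using N by (simp add: power2_eq_square)
    finally have "\<bar>n i\<bar> \<le> int (4 * N)" using abs_le_square_iff[of "n i" "int (4 * N)"] by simp
    then show ?thesis by auto
  qed
  then have mem: "n \<in> lattice_ball N" using sq by (auto simp: lattice_ball_def n_def)
  have "ip N (\<lambda>i. x i - lattice_point N n i) (\<lambda>i. x i - lattice_point N n i) \<le> (\<Sum>i<N. h * h)"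
    unfolding ip_def lp
  proof (rule sum_mono)
    fix i assume "i \<in> {..<N}"
    then have "\<bar>x i - h * real_of_int (n i)\<bar>\<^sup>2 \<le> h\<^sup>2" by (intro power_mono err) auto
    then show "(x i - h * real_of_int (n i)) * (x i - h * real_of_int (n i)) \<le> h * h"
      by (simp add: power2_eq_square)
  qed
  also have "\<dots> = 1 / 16" using N by (simp add: h_def)
  finally show thesis using that mem by blast
qed

lemma ip_scale_self: "ip N (\<lambda>i. c * x i) (\<lambda>i. c * x i) = c * (c * ip N x x)"
  by (simp add: ip_def sum_distrib_left algebra_simps)

lemma ip_mv_scale_right: "ip N x (mv N a (\<lambda>i. d * y i)) = d * ip N x (mv N a y)"
  by (simp add: ip_def mv_def sum_distrib_left algebra_simps)

lemma ip_mv_diff_left: "ip N (\<lambda>i. x i - x' i) z = ip N x z - ip N x' z"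
  by (simp add: ip_def sum_subtractf algebra_simps)

lemma ip_mv_diff_right: "ip N x (mv N a (\<lambda>i. y i - y' i)) = ip N x (mv N a y) - ip N x (mv N a y')"
  by (simp add: ip_def mv_def sum_subtractf algebra_simps)

text \<open>Replacing both arguments by lattice points costs at most half of the supremum of the form, so
  the supremum is at most twice the bound on the lattice.\<close>

lemma op_bound_lattice:
  assumes N: "N > 0"
    and b: "\<And>n n'. n \<in> lattice_ball N \<Longrightarrow> n' \<in> lattice_ball N \<Longrightarrow>
      \<bar>ip N (lattice_point N n) (mv N a (lattice_point N n'))\<bar> \<le> b"
  shows "op_bound N a (2 * b)"
proof -
  define S where "S = {\<bar>ip N x (mv N a y)\<bar> |x y. ip N x x \<le> 1 \<and> ip N y y \<le> 1}"
  have coord: "\<bar>x i\<bar> \<le> 1" if "ip N x x \<le> 1" "i < N" for x i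
  proof -
    have "x i * x i \<le> ip N x x" unfolding ip_def by (rule member_le_sum) (use that in auto)
    then have "\<bar>x i\<bar>\<^sup>2 \<le> 1\<^sup>2" using that by (simp add: power2_eq_square)
    then show ?thesis by (rule power2_le_imp_le) simp
  qed
  have bdd: "bdd_above S"
  proof (rule bdd_aboveI)
    fix s assume "s \<in> S"
    then obtain x y where s: "s = \<bar>ip N x (mv N a y)\<bar>" and xy: "ip N x x \<le> 1" "ip N y y \<le> 1"
      by (auto simp: S_def)
    have "s = \<bar>\<Sum>i<N. \<Sum>j<N. x i * (a i j * y j)\<bar>" by (simp add: s ip_def mv_def sum_distrib_left)
    also have "\<dots> \<le> (\<Sum>i<N. \<bar>\<Sum>j<N. x i * (a i j * y j)\<bar>)" by (rule sum_abs)
    also have "\<dots> \<le> (\<Sum>i<N. \<Sum>j<N. \<bar>x i * (a i j * y j)\<bar>)" by (intro sum_mono sum_abs)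
    also have "\<dots> \<le> (\<Sum>i<N. \<Sum>j<N. 1 * (\<bar>a i j\<bar> * 1))"
      unfolding abs_mult using xy by (intro sum_mono mult_mono coord) auto
    finally show "s \<le> (\<Sum>i<N. \<Sum>j<N. 1 * (\<bar>a i j\<bar> * 1))" .
  qed
  define B where "B = Sup S"
  have B: "\<bar>ip N x (mv N a y)\<bar> \<le> B" if "ip N x x \<le> 1" "ip N y y \<le> 1" for x y
    unfolding B_def by (rule cSup_upper[OF _ bdd]) (use that in \<open>auto simp: S_def\<close>)
  have "B \<le> b + B / 2"
    unfolding B_def[symmetric]
  proof (subst (1) B_def, rule cSup_least)
    have "ip N (\<lambda>_. 0) (\<lambda>_. 0) \<le> 1" by (simp add: ip_def)
    then show "S \<noteq> {}" unfolding S_def by blast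
    fix s assume "s \<in> S"
    then obtain x y where s: "s = \<bar>ip N x (mv N a y)\<bar>" and xy: "ip N x x \<le> 1" "ip N y y \<le> 1"
      by (auto simp: S_def)
    obtain n where n: "n \<in> lattice_ball N"
      "ip N (\<lambda>i. x i - lattice_point N n i) (\<lambda>i. x i - lattice_point N n i) \<le> 1 / 16"
      using lattice_rounding[OF N xy(1)] by blast
    obtain n' where n': "n' \<in> lattice_ball N"
      "ip N (\<lambda>i. y i - lattice_point N n' i) (\<lambda>i. y i - lattice_point N n' i) \<le> 1 / 16"
      using lattice_rounding[OF N xy(2)] by blast
    let ?x = "lattice_point N n" and ?y = "lattice_point N n'"
    let ?dx = "\<lambda>i. x i - ?x i" and ?dy = "\<lambda>i. y i - ?y i"
    have "\<bar>ip N (\<lambda>i. 4 * ?dx i) (mv N a y)\<bar> \<le> B"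
      by (rule B[OF _ xy(2)], unfold ip_scale_self) (use n in simp)
    then have 1: "\<bar>ip N ?dx (mv N a y)\<bar> \<le> B / 4"
      unfolding ip_scale_left by simp
    have "\<bar>ip N ?x (mv N a (\<lambda>i. 4 * ?dy i))\<bar> \<le> B"
      by (rule B[OF ip_lattice_point_le[OF n(1)]]) (unfold ip_scale_self, use n' in simp)
    then have 2: "\<bar>ip N ?x (mv N a ?dy)\<bar> \<le> B / 4"
      unfolding ip_mv_scale_right by simp
    have "ip N x (mv N a y) = ip N ?dx (mv N a y) + ip N ?x (mv N a ?dy) + ip N ?x (mv N a ?y)"
      by (simp add: ip_mv_diff_left ip_mv_diff_right)
    then show "s \<le> b + B / 2" using 1 2 b[OF n(1) n'(1)] unfolding s by linarith
  qed
  then have Bb: "B \<le> 2 * b" by simp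
  show ?thesis
    unfolding op_bound_def
  proof (intro allI)
    fix x y
    show "\<bar>ip N x (mv N a y)\<bar> \<le> 2 * b * sqrt (ip N x x) * sqrt (ip N y y)"
    proof (cases "ip N x x > 0 \<and> ip N y y > 0")
      case True
      define s t where "s = sqrt (ip N x x)" and "t = sqrt (ip N y y)"
      have st: "s > 0" "t > 0" "ip N x x = s * s" "ip N y y = t * t" using True by (auto simp: s_def t_def)
      have "\<bar>ip N (\<lambda>i. (1 / s) * x i) (mv N a (\<lambda>i. (1 / t) * y i))\<bar> \<le> B"
        by (rule B; unfold ip_scale_self) (use st in simp_all)
      then have "\<bar>ip N x (mv N a y)\<bar> / (s * t) \<le> 2 * b"
        using Bb st(1,2) unfolding ip_scale_left ip_mv_scale_right by (simp add: abs_mult)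
      then show ?thesis using st(1,2) by (simp add: s_def[symmetric] t_def[symmetric] field_simps)
    next
      case False
      then have "(\<forall>i<N. x i = 0) \<or> (\<forall>i<N. y i = 0)" using ip_self_pos by blast
      then have "ip N x (mv N a y) = 0" by (auto simp: ip_def mv_def)
      moreover have "ip N x x = 0 \<or> ip N y y = 0" using False ip_self_nonneg[of N x] ip_self_nonneg[of N y] by linarith
      ultimately show ?thesis by auto
    qed
  qed
qed


text \<open>Deleting coordinates does not leave the net, so a lattice point may be split according to the
  size of its coordinates.\<close>

lemma lattice_ball_restrict:
  assumes "n \<in> lattice_ball N"
  shows "(\<lambda>i\<in>{..<N}. if Q i then n i else 0) \<in> lattice_ball N"
proof -
  have "(\<Sum>i<N. ((\<lambda>i\<in>{..<N}. if Q i then n i else 0) i)\<^sup>2) \<le> (\<Sum>i<N. (n i)\<^sup>2)"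
    by (intro sum_mono) auto
  moreover have "(\<lambda>i\<in>{..<N}. if Q i then n i else 0) \<in> PiE {..<N} (\<lambda>_. {- int (4 * N)..int (4 * N)})"
    using assms by (auto simp: lattice_ball_def PiE_iff)
  ultimately show ?thesis using assms unfolding lattice_ball_def by (auto intro: order_trans)
qed

lemma abs_ip_le: "\<bar>ip N x y\<bar> \<le> sqrt (ip N x x) * sqrt (ip N y y)"
proof -
  have "(ip N x y)\<^sup>2 \<le> ip N x x * ip N y y"
    using Cauchy_Schwarz_ineq_sum[of x y "{..<N}"] by (simp add: ip_def power2_eq_square)
  then have "sqrt ((ip N x y)\<^sup>2) \<le> sqrt (ip N x x * ip N y y)" by (rule real_sqrt_le_mono)
  then show ?thesis by (simp add: real_sqrt_mult)
qed

text \<open>A vector of norm at most \<open>1\<close> all of whose nonzero coordinates exceed \<open>\<theta>\<close> has \<open>\<ell>\<^sup>1\<close> norm at most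
  \<open>1 / \<theta>\<close>, so that crude bounds on the Gram matrix of the columns control its image.\<close>

lemma ip_mv_le_of_gram:
  assumes col: "\<And>j. j < N \<Longrightarrow> (\<Sum>i<N. (a i j)\<^sup>2) \<le> s"
    and gram: "\<And>j l. j < N \<Longrightarrow> l < N \<Longrightarrow> j \<noteq> l \<Longrightarrow> \<bar>\<Sum>i<N. a i j * a i l\<bar> \<le> g"
    and s: "s \<ge> 0" and g: "0 \<le> g" and \<theta>: "\<theta> > 0" and x: "ip N x x \<le> 1"
    and big: "\<And>i. i < N \<Longrightarrow> x i = 0 \<or> \<theta> < \<bar>x i\<bar>"
  shows "ip N (mv N a x) (mv N a x) \<le> s + g / \<theta>\<^sup>2"
proof -
  define G where "G j l = (\<Sum>i<N. a i j * a i l)" for j l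
  have "ip N (mv N a x) (mv N a x) = (\<Sum>i<N. \<Sum>j<N. \<Sum>l<N. x j * x l * (a i j * a i l))"
    unfolding ip_def mv_def sum_product by (intro sum.cong refl) simp
  also have "\<dots> = (\<Sum>j<N. \<Sum>i<N. \<Sum>l<N. x j * x l * (a i j * a i l))" by (rule sum.swap)
  also have "\<dots> = (\<Sum>j<N. \<Sum>l<N. \<Sum>i<N. x j * x l * (a i j * a i l))"
    by (intro sum.cong refl sum.swap)
  also have "\<dots> = (\<Sum>j<N. \<Sum>l<N. x j * x l * G j l)" by (simp add: G_def sum_distrib_left)
  also have "\<dots> \<le> (\<Sum>j<N. \<Sum>l<N. (if j = l then s * (x j * x j) else 0) + g * (\<bar>x j\<bar> * \<bar>x l\<bar>))"
  proof (intro sum_mono)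
    fix j l assume "j \<in> {..<N}" "l \<in> {..<N}"
    then have jl: "j < N" "l < N" by auto
    show "x j * x l * G j l \<le> (if j = l then s * (x j * x j) else 0) + g * (\<bar>x j\<bar> * \<bar>x l\<bar>)"
    proof (cases "j = l")
      case True
      have "G j j \<le> s" using col[OF jl(1)] by (simp add: G_def power2_eq_square)
      then have "x j * x j * G j j \<le> x j * x j * s" by (intro mult_left_mono) auto
      moreover have "0 \<le> g * (\<bar>x j\<bar> * \<bar>x l\<bar>)" using g by simp
      ultimately show ?thesis using True by (simp add: mult.commute)
    next
      case False
      have "x j * x l * G j l \<le> \<bar>x j * x l\<bar> * \<bar>G j l\<bar>" by (metis abs_ge_self abs_mult)
      also have "\<dots> \<le> \<bar>x j * x l\<bar> * g" using gram[OF jl False] by (intro mult_left_mono) (auto simp: G_def)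
      finally show ?thesis using False by (simp add: abs_mult mult.commute)
    qed
  qed
  also have "\<dots> = s * ip N x x + g * (\<Sum>j<N. \<bar>x j\<bar>)\<^sup>2"
  proof -
    have "g * (\<Sum>j<N. \<bar>x j\<bar>)\<^sup>2 = (\<Sum>j<N. \<Sum>l<N. g * (\<bar>x j\<bar> * \<bar>x l\<bar>))"
      unfolding power2_eq_square sum_product by (simp add: sum_distrib_left)
    then show ?thesis by (simp add: sum.distrib ip_def sum_distrib_left)
  qed
  also have "\<dots> \<le> s * 1 + g * (1 / \<theta>)\<^sup>2"
  proof (intro add_mono mult_left_mono power_mono)
    have "(\<Sum>j<N. \<bar>x j\<bar>) \<le> (\<Sum>j<N. x j * x j / \<theta>)"
    proof (rule sum_mono)
      fix j assume "j \<in> {..<N}"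
      then have "x j = 0 \<or> \<theta> < \<bar>x j\<bar>" using big by auto
      then have "\<theta> * \<bar>x j\<bar> \<le> \<bar>x j\<bar> * \<bar>x j\<bar>"
        by (elim disjE) (simp, intro mult_right_mono, auto)
      then show "\<bar>x j\<bar> \<le> x j * x j / \<theta>" using \<theta> by (simp add: le_divide_eq mult.commute)
    qed
    also have "\<dots> = ip N x x / \<theta>" by (simp add: ip_def sum_divide_distrib)
    also have "\<dots> \<le> 1 / \<theta>" using x \<theta> by (intro divide_right_mono) auto
    finally show "(\<Sum>j<N. \<bar>x j\<bar>) \<le> 1 / \<theta>" .
  qed (use s g x in \<open>auto intro: sum_nonneg\<close>)
  finally show ?thesis by (simp add: power_one_over)
qed

text \<open>Both arguments of the form are split into big (beyond \<open>\<theta>\<close>), medium (between \<open>\<tau>\<close> and \<open>\<theta>\<close>) and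
  small (at most \<open>\<tau>\<close>) coordinates.  If either argument is big, the Gram bounds apply; what remains is
  small against small or medium (twice, by symmetry) and medium against medium.\<close>

lemma op_bound_of_classes:
  assumes N: "N > 0" and sym: "\<And>i j. i < N \<Longrightarrow> j < N \<Longrightarrow> a i j = a j i"
    and \<tau>: "0 < \<tau>" "\<tau> < \<theta>" and g: "0 \<le> g" "g \<le> real N * \<theta>\<^sup>2"
    and col: "\<And>j. j < N \<Longrightarrow> (\<Sum>i<N. (a i j)\<^sup>2) \<le> 3 * real N"
    and gram: "\<And>j l. j < N \<Longrightarrow> l < N \<Longrightarrow> j \<noteq> l \<Longrightarrow> \<bar>\<Sum>i<N. a i j * a i l\<bar> \<le> g"
    and small: "\<And>n n'. n \<in> lattice_ball N \<Longrightarrow> n' \<in> lattice_ball N \<Longrightarrow>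
        (\<And>i. i < N \<Longrightarrow> \<bar>lattice_point N n i\<bar> \<le> \<tau>) \<Longrightarrow> (\<And>i. i < N \<Longrightarrow> \<bar>lattice_point N n' i\<bar> \<le> \<theta>) \<Longrightarrow>
        \<bar>ip N (lattice_point N n) (mv N a (lattice_point N n'))\<bar> \<le> b"
    and medium: "\<And>n n'. n \<in> lattice_ball N \<Longrightarrow> n' \<in> lattice_ball N \<Longrightarrow>
        (\<And>i. i < N \<Longrightarrow> n i = 0 \<or> \<tau> < \<bar>lattice_point N n i\<bar>) \<Longrightarrow>
        (\<And>i. i < N \<Longrightarrow> n' i = 0 \<or> \<tau> < \<bar>lattice_point N n' i\<bar>) \<Longrightarrow>
        (\<And>i. i < N \<Longrightarrow> \<bar>lattice_point N n i\<bar> \<le> \<theta>) \<Longrightarrow> (\<And>i. i < N \<Longrightarrow> \<bar>lattice_point N n' i\<bar> \<le> \<theta>) \<Longrightarrow>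
        \<bar>ip N (lattice_point N n) (mv N a (lattice_point N n'))\<bar> \<le> b"
  shows "op_bound N a (2 * (4 * sqrt (real N) + 3 * b))"
proof (rule op_bound_lattice[OF N])
  let ?p = "lattice_point N"
  define res where "res Q n = (\<lambda>i\<in>{..<N}. if Q \<bar>?p n i\<bar> then n i else 0)" for Q n
  have res: "res Q n \<in> lattice_ball N" if "n \<in> lattice_ball N" for Q n
    unfolding res_def by (rule lattice_ball_restrict[OF that])
  have p_res: "?p (res Q n) i = (if Q \<bar>?p n i\<bar> then ?p n i else 0)" if "i < N" for Q n i
    using that by (auto simp: res_def lattice_point_def)
  let ?big = "\<lambda>t. \<theta> < t" and ?med = "\<lambda>t. \<tau> < t \<and> t \<le> \<theta>" and ?small = "\<lambda>t. t \<le> \<tau>" and ?rest = "\<lambda>t. t \<le> \<theta>"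
  have ip_swap: "ip N x (mv N a y) = ip N y (mv N a x)" for x y
    using ip_mv_swap[where N = N and a = a and x = x and y = y, OF sym] by (simp add: ip_commute)
  have big: "\<bar>ip N y (mv N a (?p (res ?big n)))\<bar> \<le> 2 * sqrt (real N)"
    if "n \<in> lattice_ball N" "ip N y y \<le> 1" for n y
  proof -
    have "ip N (mv N a (?p (res ?big n))) (mv N a (?p (res ?big n))) \<le> 3 * real N + g / \<theta>\<^sup>2"
      by (rule ip_mv_le_of_gram[OF col gram _ g(1)]) (use \<tau> ip_lattice_point_le[OF res[OF that(1)]] p_res in auto)
    also have "\<dots> \<le> 4 * real N" using g(2) \<tau> by (simp add: divide_le_eq)
    finally have "sqrt (ip N (mv N a (?p (res ?big n))) (mv N a (?p (res ?big n)))) \<le> sqrt (4 * real N)"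
      by (rule real_sqrt_le_mono)
    then have "sqrt (ip N y y) * sqrt (ip N (mv N a (?p (res ?big n))) (mv N a (?p (res ?big n)))) \<le> 1 * (2 * sqrt (real N))"
      using that(2) by (intro mult_mono) (auto simp: real_sqrt_mult ip_self_nonneg)
    then show ?thesis using abs_ip_le[of N y "mv N a (?p (res ?big n))"] by simp
  qed
  fix n n' assume n: "n \<in> lattice_ball N" "n' \<in> lattice_ball N"
  have split_left: "ip N (?p (res P n)) z = ip N (?p (res Q n)) z + ip N (?p (res R n)) z"
    if "\<And>t. (P t \<longleftrightarrow> Q t \<or> R t) \<and> \<not> (Q t \<and> R t)" for P Q R n z
  proof -
    have "ip N (?p (res P n)) z = ip N (\<lambda>i. ?p (res Q n) i + ?p (res R n) i) z"
      by (intro ip_cong) (use that in \<open>auto simp: p_res\<close>)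
    then show ?thesis by (simp add: ip_add_left)
  qed
  have all: "ip N (?p n) z = ip N (?p (res (\<lambda>_. True) n)) z" for n z
    by (intro ip_cong) (auto simp: p_res)
  have 0: "ip N (?p n) z = ip N (?p (res ?big n)) z + ip N (?p (res ?rest n)) z" for n z
    by (rule trans[OF all split_left]) auto
  have 1: "ip N (?p (res ?rest n)) z = ip N (?p (res ?small n)) z + ip N (?p (res ?med n)) z" for n z
    by (rule split_left) (use \<tau> in auto)
  have med: "res ?med n i = 0 \<or> \<tau> < \<bar>?p (res ?med n) i\<bar>" if "i < N" for i n
    using that by (auto simp: p_res) (auto simp: res_def)
  have "ip N (?p n) (mv N a (?p n')) =
      ip N (?p n') (mv N a (?p (res ?big n))) + ip N (?p (res ?rest n)) (mv N a (?p (res ?big n'))) +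
      ip N (?p (res ?small n)) (mv N a (?p (res ?rest n'))) +
      ip N (?p (res ?small n')) (mv N a (?p (res ?med n))) +
      ip N (?p (res ?med n)) (mv N a (?p (res ?med n')))"
    (is "_ = ?t1 + ?t2 + ?t3 + ?t4 + ?t5")
  proof -
    have "ip N (?p n) (mv N a (?p n')) = ?t1 + ip N (?p (res ?rest n)) (mv N a (?p n'))"
      by (rule trans[OF 0]) (simp add: ip_swap[of "?p (res ?big n)"])
    also have "ip N (?p (res ?rest n)) (mv N a (?p n')) = ?t2 + ip N (?p (res ?rest n)) (mv N a (?p (res ?rest n')))"
      by (subst (1 2 3) ip_swap) (rule 0)
    also have "ip N (?p (res ?rest n)) (mv N a (?p (res ?rest n'))) = ?t3 + ip N (?p (res ?med n)) (mv N a (?p (res ?rest n')))"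
      by (rule 1)
    also have "ip N (?p (res ?med n)) (mv N a (?p (res ?rest n'))) = ?t4 + ?t5"
      by (subst (1 2) ip_swap, subst (3) ip_swap) (rule trans[OF 1], simp add: ip_swap[of "?p (res ?med n)" "?p (res ?med n')"])
    finally show ?thesis by simp
  qed
  moreover have "\<bar>?t1\<bar> \<le> 2 * sqrt (real N)" by (rule big) (use n ip_lattice_point_le in auto)
  moreover have "\<bar>?t2\<bar> \<le> 2 * sqrt (real N)" by (rule big) (use n ip_lattice_point_le res in auto)
  moreover have "\<bar>?t3\<bar> \<le> b" by (rule small) (use n res p_res \<tau> in auto)
  moreover have "\<bar>?t4\<bar> \<le> b" by (rule small) (use n res p_res \<tau> in auto)
  moreover have "\<bar>?t5\<bar> \<le> b"
    by (rule medium[OF res[OF n(1)] res[OF n(2)] med med]) (use p_res \<tau> in auto)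
  ultimately show "\<bar>ip N (?p n) (mv N a (?p n'))\<bar> \<le> 4 * sqrt (real N) + 3 * b" by linarith
qed

section \<open>Exponential moments\<close>

lemma exp_le_quadratic:
  fixes u :: real
  assumes "\<bar>u\<bar> \<le> 1"
  shows "exp u \<le> 1 + u + u\<^sup>2"
proof (cases "u \<ge> 0")
  case True
  then show ?thesis using exp_bound[of u] assms by simp
next
  case False
  define x where "x = - u"
  have x: "0 \<le> x" "x \<le> 1" using False assms by (auto simp: x_def)
  have "1 \<le> (1 - x + x\<^sup>2) * (1 + x + x\<^sup>2 / 2)"
  proof -
    have "(1 - x + x\<^sup>2) * (1 + x + x\<^sup>2 / 2) = 1 + (x\<^sup>2 / 2 + x ^ 3 / 2 + x ^ 4 / 2)"
      by (simp add: field_simps power2_eq_square power3_eq_cube power4_eq_xxxx)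
    then show ?thesis using x by simp
  qed
  also have "\<dots> \<le> (1 - x + x\<^sup>2) * exp x"
  proof (rule mult_left_mono)
    show "1 + x + x\<^sup>2 / 2 \<le> exp x" using exp_lower_Taylor_quadratic[OF x(1)] by simp
    show "0 \<le> 1 - x + x\<^sup>2" using x zero_le_power2[of x] by linarith
  qed
  finally have "1 / exp x \<le> 1 - x + x\<^sup>2" by (simp add: divide_le_eq)
  then show ?thesis by (simp add: x_def exp_minus inverse_eq_divide)
qed

text \<open>A Bernstein bound for independent variables of absolute value at most \<open>1\<close>, not necessarily
  centred.\<close>

lemma (in prob_space) prob_sum_ge_le:
  fixes Y :: "'i \<Rightarrow> 'a \<Rightarrow> real"
  assumes I: "finite I" and indep: "indep_vars (\<lambda>_. borel) Y I"
    and bound: "\<And>i \<omega>. i \<in> I \<Longrightarrow> \<omega> \<in> space M \<Longrightarrow> \<bar>Y i \<omega>\<bar> \<le> 1"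
    and b: "(\<Sum>i\<in>I. expectation (Y i) + expectation (\<lambda>\<omega>. (Y i \<omega>)\<^sup>2)) \<le> b"
  shows "prob {\<omega> \<in> space M. t \<le> (\<Sum>i\<in>I. Y i \<omega>)} \<le> exp (b - t)"
proof -
  have meas [measurable]: "Y i \<in> borel_measurable M" if "i \<in> I" for i
    using indep that by (auto simp: indep_vars_def)
  have intb: "integrable M (\<lambda>\<omega>. f (Y i \<omega>))" if "i \<in> I" "f \<in> borel_measurable borel" "\<And>u. \<bar>u\<bar> \<le> 1 \<Longrightarrow> \<bar>f u\<bar> \<le> 3" for i and f :: "real \<Rightarrow> real"
    by (rule integrable_const_bound[where B = 3]) (use that bound in \<open>auto intro!: AE_I2\<close>)
  have exp3: "exp u \<le> 3" if "\<bar>u\<bar> \<le> 1" for u :: real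
  proof -
    have "u\<^sup>2 \<le> 1" using that by (simp add: abs_square_le_1)
    then show ?thesis using exp_le_quadratic[OF that] that by linarith
  qed
  have int1: "integrable M (\<lambda>\<omega>. exp (Y i \<omega>))" if "i \<in> I" for i
    by (rule intb[OF that]) (use exp3 in auto)
  have int2: "integrable M (Y i)" if "i \<in> I" for i
    using intb[OF that, of "\<lambda>u. u"] by simp
  have int3: "integrable M (\<lambda>\<omega>. (Y i \<omega>)\<^sup>2)" if "i \<in> I" for i
  proof (rule intb[OF that])
    fix u :: real assume "\<bar>u\<bar> \<le> 1"
    then have "u\<^sup>2 \<le> 1" by (simp add: abs_square_le_1)
    then show "\<bar>u\<^sup>2\<bar> \<le> 3" by simp
  qed simp
  have indep': "indep_vars (\<lambda>_. borel) (\<lambda>i \<omega>. exp (Y i \<omega>)) I"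
    by (rule indep_vars_compose2[OF indep]) auto
  have int: "integrable M (\<lambda>\<omega>. exp (\<Sum>i\<in>I. Y i \<omega>))"
    using indep_vars_integrable[OF I indep' int1] by (simp add: exp_sum[OF I])
  have "expectation (\<lambda>\<omega>. exp (\<Sum>i\<in>I. Y i \<omega>)) = (\<Prod>i\<in>I. expectation (\<lambda>\<omega>. exp (Y i \<omega>)))"
    using indep_vars_lebesgue_integral[OF I indep' int1] by (simp add: exp_sum[OF I])
  also have "\<dots> \<le> (\<Prod>i\<in>I. exp (expectation (Y i) + expectation (\<lambda>\<omega>. (Y i \<omega>)\<^sup>2)))"
  proof (rule prod_mono, intro conjI)
    fix i assume i: "i \<in> I"
    show "0 \<le> expectation (\<lambda>\<omega>. exp (Y i \<omega>))" by (simp add: integral_nonneg_AE)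
    have "expectation (\<lambda>\<omega>. exp (Y i \<omega>)) \<le> expectation (\<lambda>\<omega>. 1 + Y i \<omega> + (Y i \<omega>)\<^sup>2)"
      by (rule integral_mono) (use int1 int2 int3 i bound exp_le_quadratic in auto)
    also have "\<dots> = 1 + (expectation (Y i) + expectation (\<lambda>\<omega>. (Y i \<omega>)\<^sup>2))"
      using int2[OF i] int3[OF i] by (simp add: prob_space)
    also have "\<dots> \<le> exp (expectation (Y i) + expectation (\<lambda>\<omega>. (Y i \<omega>)\<^sup>2))"
      by (rule exp_ge_add_one_self)
    finally show "expectation (\<lambda>\<omega>. exp (Y i \<omega>)) \<le> exp (expectation (Y i) + expectation (\<lambda>\<omega>. (Y i \<omega>)\<^sup>2))" .
  qed
  also have "\<dots> \<le> exp b" using b by (simp add: exp_sum[OF I, symmetric])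
  finally have E: "expectation (\<lambda>\<omega>. exp (\<Sum>i\<in>I. Y i \<omega>)) \<le> exp b" .
  have "prob {\<omega> \<in> space M. t \<le> (\<Sum>i\<in>I. Y i \<omega>)} = prob {\<omega> \<in> space M. exp t \<le> exp (\<Sum>i\<in>I. Y i \<omega>)}"
    by simp
  also have "\<dots> \<le> expectation (\<lambda>\<omega>. exp (\<Sum>i\<in>I. Y i \<omega>)) / exp t"
    by (rule integral_Markov_inequality_measure[OF int sets.empty_sets]) auto
  also have "\<dots> \<le> exp b / exp t" using E by (intro divide_right_mono) auto
  finally show ?thesis by (simp add: exp_diff)
qed

section \<open>Truncation\<close>

text \<open>Truncation replaces values beyond \<open>K\<close> by \<open>0\<close>.\<close>

definition trunc :: "real \<Rightarrow> real \<Rightarrow> real" where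
  "trunc K x = (if \<bar>x\<bar> \<le> K then x else 0)"

lemma trunc_measurable [measurable]: "trunc K \<in> borel_measurable borel"
  unfolding trunc_def[abs_def] by measurable

lemma abs_trunc_le: "K \<ge> 0 \<Longrightarrow> \<bar>trunc K x\<bar> \<le> K"
  by (simp add: trunc_def)

text \<open>Moments of a truncated entry.  The truncated mean need not vanish, but it decays in \<open>K\<close> faster
  than any given power.\<close>

lemma
  assumes D: "entry_law D" and K: "K > 0"
  shows tail_entry_law: "measure D {x. \<bar>x\<bar> > K} \<le> (\<integral>x. x ^ (2 * p) \<partial>D) / K ^ (2 * p)"
    and trunc_second_moment: "(\<integral>x. (trunc K x)\<^sup>2 \<partial>D) \<le> 1"
    and trunc_fourth_moment: "(\<integral>x. (trunc K x) ^ 4 \<partial>D) \<le> (\<integral>x. x ^ 4 \<partial>D)"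
    and trunc_mean: "\<bar>\<integral>x. trunc K x \<partial>D\<bar> \<le> (\<integral>x. x ^ (2 * (p + 1)) \<partial>D) / K ^ (2 * p + 1)"
proof -
  interpret real_distribution D using D by (simp add: entry_law_def)
  have mom: "integrable D (\<lambda>x. x ^ p)" for p :: nat using D by (simp add: entry_law_def)
  have mean: "expectation (\<lambda>x. x) = 0" and var: "variance (\<lambda>x. x) = 1" using D by (auto simp: entry_law_def)
  have second: "expectation (\<lambda>x. x\<^sup>2) = 1" using var mean by simp
  have [measurable]: "trunc K \<in> borel_measurable D" by simp
  have bd: "integrable D (\<lambda>x. trunc K x ^ q)" for q
    by (rule integrable_const_bound[where B = "K ^ q"])
      (use K in \<open>auto intro!: AE_I2 power_mono abs_trunc_le simp: power_abs\<close>)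
  show "(\<integral>x. (trunc K x)\<^sup>2 \<partial>D) \<le> 1"
    unfolding second[symmetric] by (rule integral_mono[OF bd mom]) (simp add: trunc_def)
  show "(\<integral>x. (trunc K x) ^ 4 \<partial>D) \<le> (\<integral>x. x ^ 4 \<partial>D)"
    by (rule integral_mono[OF bd mom]) (simp add: trunc_def)
  have "measure D {x. \<bar>x\<bar> > K} \<le> measure D {x \<in> space D. K ^ (2 * p) \<le> x ^ (2 * p)}"
  proof (rule finite_measure_mono)
    show "{x. \<bar>x\<bar> > K} \<subseteq> {x \<in> space D. K ^ (2 * p) \<le> x ^ (2 * p)}"
    proof clarsimp
      fix x assume "K < \<bar>x\<bar>"
      then have "K ^ (2 * p) \<le> \<bar>x\<bar> ^ (2 * p)" using K by (intro power_mono) auto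
      then show "K ^ (2 * p) \<le> x ^ (2 * p)" by (simp add: power_even_abs)
    qed
  qed measurable
  also have "\<dots> \<le> (\<integral>x. x ^ (2 * p) \<partial>D) / K ^ (2 * p)"
    by (rule integral_Markov_inequality_measure[OF mom sets.empty_sets]) (use K in auto)
  finally show "measure D {x. \<bar>x\<bar> > K} \<le> (\<integral>x. x ^ (2 * p) \<partial>D) / K ^ (2 * p)" .
  have int1: "integrable D (\<lambda>x. x)" using mom[of 1] by simp
  have int2: "integrable D (trunc K)" using bd[of 1] by simp
  \<comment> \<open>as \<open>D\<close> is centred, the truncated mean is minus the mean of the part cut off\<close>
  have "(\<integral>x. trunc K x \<partial>D) = - (\<integral>x. x - trunc K x \<partial>D)"
    using int1 int2 mean by simp
  then have "\<bar>\<integral>x. trunc K x \<partial>D\<bar> = \<bar>\<integral>x. x - trunc K x \<partial>D\<bar>" by simp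
  also have "\<dots> \<le> (\<integral>x. \<bar>x - trunc K x\<bar> \<partial>D)" by (rule integral_abs_bound)
  also have "\<dots> \<le> (\<integral>x. x ^ (2 * (p + 1)) / K ^ (2 * p + 1) \<partial>D)"
  proof (rule integral_mono)
    fix x
    show "\<bar>x - trunc K x\<bar> \<le> x ^ (2 * (p + 1)) / K ^ (2 * p + 1)"
    proof (cases "\<bar>x\<bar> \<le> K")
      case False
      then have "\<bar>x\<bar> * K ^ (2 * p + 1) \<le> \<bar>x\<bar> * \<bar>x\<bar> ^ (2 * p + 1)"
        using K by (intro mult_left_mono power_mono) auto
      also have "\<dots> = \<bar>x\<bar> ^ (2 * (p + 1))" by (simp add: power_add algebra_simps)
      also have "\<dots> = x ^ (2 * (p + 1))" by (rule power_even_abs) simp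
      finally show ?thesis using False K by (simp add: trunc_def pos_le_divide_eq)
    next
      case True
      have "0 \<le> x ^ (2 * (p + 1))" by (rule zero_le_even_power) simp
      then show ?thesis using True K by (simp add: trunc_def del: mult_Suc_right power_Suc)
    qed
  qed (use int1 int2 mom[of "2 * (p + 1)"] in auto)
  finally show "\<bar>\<integral>x. trunc K x \<partial>D\<bar> \<le> (\<integral>x. x ^ (2 * (p + 1)) \<partial>D) / K ^ (2 * p + 1)"
    by simp
qed

section \<open>Random symmetric matrices\<close>

text \<open>The position in the upper triangle that determines the entry at \<open>(i, j)\<close>, and the symmetric
  matrix with entries \<open>f p\<close> at the positions \<open>p\<close> in \<open>P\<close> and at their mirror images, and \<open>0\<close> elsewhere.\<close>

definition upos :: "nat \<Rightarrow> nat \<Rightarrow> nat \<times> nat" where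
  "upos i j = (min i j, max i j)"

definition sym_mat :: "(nat \<times> nat) set \<Rightarrow> (nat \<times> nat \<Rightarrow> real) \<Rightarrow> nat \<Rightarrow> nat \<Rightarrow> real" where
  "sym_mat P f i j = (if upos i j \<in> P then f (upos i j) else 0)"

lemma sym_mat_commute: "sym_mat P f i j = sym_mat P f j i"
  by (simp add: sym_mat_def upos_def min.commute max.commute)

text \<open>A sum over the support of such a matrix, collected over the positions above the diagonal.\<close>

lemma sum_sym_pairs:
  fixes h :: "nat \<Rightarrow> nat \<Rightarrow> real"
  assumes P: "P \<subseteq> {(i, j). i < j \<and> j < N}"
  shows "(\<Sum>i<N. \<Sum>j<N. if upos i j \<in> P then h i j else 0) = (\<Sum>p\<in>P. h (fst p) (snd p) + h (snd p) (fst p))"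
proof -
  have finP: "finite P" by (rule finite_subset[of _ "{..<N} \<times> {..<N}"]) (use P in auto)
  let ?Q = "(\<lambda>p. (snd p, fst p)) ` P"
  have inj: "inj_on (\<lambda>p. (snd p, fst p)) P" by (auto simp: inj_on_def)
  have PQ: "P \<inter> ?Q = {}"
  proof (rule ccontr)
    assume "P \<inter> ?Q \<noteq> {}"
    then obtain p where p: "p \<in> P" "(snd p, fst p) \<in> P" by auto
    have "fst p < snd p" "snd p < fst p" using subsetD[OF P p(1)] subsetD[OF P p(2)] by auto
    then show False by simp
  qed
  have "(\<Sum>i<N. \<Sum>j<N. if upos i j \<in> P then h i j else 0) =
      (\<Sum>q\<in>{..<N} \<times> {..<N}. if upos (fst q) (snd q) \<in> P then h (fst q) (snd q) else 0)"
    by (simp add: sum.cartesian_product case_prod_unfold)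
  also have "\<dots> = (\<Sum>q\<in>{q \<in> {..<N} \<times> {..<N}. upos (fst q) (snd q) \<in> P}. h (fst q) (snd q))"
    by (rule sum.inter_filter[symmetric]) simp
  also have "{q \<in> {..<N} \<times> {..<N}. upos (fst q) (snd q) \<in> P} = P \<union> ?Q"
  proof (intro equalityI subsetI)
    fix q assume q: "q \<in> {q \<in> {..<N} \<times> {..<N}. upos (fst q) (snd q) \<in> P}"
    obtain i j where ij: "q = (i, j)" by (cases q)
    show "q \<in> P \<union> ?Q"
    proof (cases "i \<le> j")
      case True
      then show ?thesis using q by (simp add: ij upos_def)
    next
      case False
      then have "(j, i) \<in> P" using q by (simp add: ij upos_def)
      then show ?thesis by (force simp: ij)
    qed
  next
    fix q assume "q \<in> P \<union> ?Q"
    then obtain p where p: "p \<in> P" "q = p \<or> q = (snd p, fst p)" by blast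
    moreover have "fst p < snd p" "snd p < N" using P p(1) by auto
    ultimately show "q \<in> {q \<in> {..<N} \<times> {..<N}. upos (fst q) (snd q) \<in> P}"
      by (cases p) (auto simp: upos_def)
  qed
  also have "(\<Sum>q\<in>P \<union> ?Q. h (fst q) (snd q)) = (\<Sum>q\<in>P. h (fst q) (snd q)) + (\<Sum>q\<in>?Q. h (fst q) (snd q))"
    by (rule sum.union_disjoint) (use finP PQ in auto)
  also have "(\<Sum>q\<in>?Q. h (fst q) (snd q)) = (\<Sum>p\<in>P. h (snd p) (fst p))"
    by (simp add: sum.reindex[OF inj] o_def)
  finally show ?thesis by (simp add: sum.distrib)
qed


lemma upos_eq_iff: "upos a b = upos c d \<longleftrightarrow> a = c \<and> b = d \<or> a = d \<and> b = c"
  by (auto simp: upos_def min_def max_def split: if_splits)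

text \<open>Independent entries of law \<open>D\<close> at positions \<open>P\<close> strictly above the diagonal.  The set \<open>P\<close> is
  arbitrary: it is the whole triangle for the off-diagonal part of the GOE, and the pairs of
  incongruent indices for a centred checkerboard matrix.\<close>

locale random_sym_mat = prob_space M for M :: "'a measure" +
  fixes D :: "real measure" and N :: nat and P :: "(nat \<times> nat) set" and X :: "nat \<times> nat \<Rightarrow> 'a \<Rightarrow> real"
  assumes law: "entry_law D"
    and P: "P \<subseteq> {(i, j). i < j \<and> j < N}"
    and indep: "indep_vars (\<lambda>_. borel) X P"
    and distr_X: "\<And>p. p \<in> P \<Longrightarrow> distr M borel (X p) = D"
begin

text \<open>The random symmetric matrix with truncated entries.\<close>

definition V :: "real \<Rightarrow> 'a \<Rightarrow> nat \<Rightarrow> nat \<Rightarrow> real" where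
  "V K \<omega> = sym_mat P (\<lambda>p. trunc K (X p \<omega>))"

lemma finite_P: "finite P"
  by (rule finite_subset[of _ "{..<N} \<times> {..<N}"]) (use P in auto)

lemma card_P: "real (card P) \<le> (real N)\<^sup>2"
proof -
  have "card P \<le> card ({..<N} \<times> {..<N})" by (rule card_mono) (use P in auto)
  then have "real (card P) \<le> real (N * N)" unfolding of_nat_le_iff by (simp add: card_cartesian_product)
  then show ?thesis by (simp add: power2_eq_square)
qed

lemma X_measurable: "p \<in> P \<Longrightarrow> X p \<in> borel_measurable M"
  using indep by (auto simp: indep_vars_def)

lemma upos_refl_notin: "upos i i \<notin> P"
  using P by (auto simp: upos_def)

lemma expectation_X:
  fixes f :: "real \<Rightarrow> real"
  assumes "p \<in> P" and "f \<in> borel_measurable borel"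
  shows "expectation (\<lambda>\<omega>. f (X p \<omega>)) = (\<integral>x. f x \<partial>D)"
  using integral_distr[OF X_measurable[OF assms(1)] assms(2)] distr_X[OF assms(1)] by simp

lemma V_measurable [measurable]: "(\<lambda>\<omega>. V K \<omega> i j) \<in> borel_measurable M"
proof (cases "upos i j \<in> P")
  case True
  then have [measurable]: "X (upos i j) \<in> borel_measurable M" by (rule X_measurable)
  show ?thesis using True by (simp add: V_def sym_mat_def)
qed (simp add: V_def sym_mat_def)

lemma ip_V_measurable [measurable]: "(\<lambda>\<omega>. ip N x (mv N (V K \<omega>) y)) \<in> borel_measurable M"
  unfolding ip_def mv_def by measurable

text \<open>In this and the following tail bounds, \<open>l\<close> is the parameter of the exponential moment; the
  truncation level and the coefficients limit how large it may be.\<close>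

lemma prob_linear_form_ge:
  assumes K: "K > 0" and l: "l > 0" and small: "\<And>p. p \<in> P \<Longrightarrow> \<bar>l * c p\<bar> * K \<le> 1"
    and c2: "(\<Sum>p\<in>P. (c p)\<^sup>2) \<le> 2" and c1: "(\<Sum>p\<in>P. \<bar>c p\<bar>) \<le> S"
    and \<mu>: "\<bar>\<integral>x. trunc K x \<partial>D\<bar> \<le> \<mu>"
  shows "prob {\<omega> \<in> space M. t \<le> (\<Sum>p\<in>P. c p * trunc K (X p \<omega>))} \<le> exp (l * S * \<mu> + 2 * l\<^sup>2 - l * t)"
proof -
  define Y where "Y p \<omega> = l * c p * trunc K (X p \<omega>)" for p \<omega>
  have \<mu>0: "\<mu> \<ge> 0" using \<mu> by linarith
  have "prob {\<omega> \<in> space M. l * t \<le> (\<Sum>p\<in>P. Y p \<omega>)} \<le> exp ((l * S * \<mu> + 2 * l\<^sup>2) - l * t)"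
  proof (rule prob_sum_ge_le[OF finite_P])
    show "indep_vars (\<lambda>_. borel) Y P"
      unfolding Y_def[abs_def] by (rule indep_vars_compose2[OF indep]) measurable
    fix p \<omega> assume p: "p \<in> P"
    have "\<bar>l * c p\<bar> * \<bar>trunc K (X p \<omega>)\<bar> \<le> \<bar>l * c p\<bar> * K"
      using K by (intro mult_left_mono abs_trunc_le) auto
    then show "\<bar>Y p \<omega>\<bar> \<le> 1" using small[OF p] by (simp add: Y_def abs_mult)
  next
    have "expectation (Y p) + expectation (\<lambda>\<omega>. (Y p \<omega>)\<^sup>2) \<le> l * \<mu> * \<bar>c p\<bar> + l\<^sup>2 * (c p)\<^sup>2" if p: "p \<in> P" for p
    proof (rule add_mono)
      have "expectation (Y p) = l * c p * (\<integral>x. trunc K x \<partial>D)"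
        unfolding Y_def by (simp add: expectation_X[OF p])
      also have "\<dots> \<le> \<bar>l * c p\<bar> * \<bar>\<integral>x. trunc K x \<partial>D\<bar>" by (metis abs_ge_self abs_mult)
      also have "\<dots> \<le> \<bar>l * c p\<bar> * \<mu>" using \<mu> by (intro mult_left_mono) auto
      finally show "expectation (Y p) \<le> l * \<mu> * \<bar>c p\<bar>" using l by (simp add: abs_mult algebra_simps)
      have "expectation (\<lambda>\<omega>. (Y p \<omega>)\<^sup>2) = (l * c p)\<^sup>2 * expectation (\<lambda>\<omega>. (trunc K (X p \<omega>))\<^sup>2)"
        unfolding Y_def power_mult_distrib[of _ "trunc K _"] by simp
      also have "expectation (\<lambda>\<omega>. (trunc K (X p \<omega>))\<^sup>2) = (\<integral>x. (trunc K x)\<^sup>2 \<partial>D)"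
        by (rule expectation_X[OF p]) simp
      also have "(l * c p)\<^sup>2 * (\<integral>x. (trunc K x)\<^sup>2 \<partial>D) \<le> (l * c p)\<^sup>2 * 1"
        by (intro mult_left_mono trunc_second_moment[OF law K]) simp
      finally show "expectation (\<lambda>\<omega>. (Y p \<omega>)\<^sup>2) \<le> l\<^sup>2 * (c p)\<^sup>2" by (simp add: power_mult_distrib)
    qed
    then have "(\<Sum>p\<in>P. expectation (Y p) + expectation (\<lambda>\<omega>. (Y p \<omega>)\<^sup>2)) \<le>
        (\<Sum>p\<in>P. l * \<mu> * \<bar>c p\<bar> + l\<^sup>2 * (c p)\<^sup>2)" by (rule sum_mono)
    also have "\<dots> = l * \<mu> * (\<Sum>p\<in>P. \<bar>c p\<bar>) + l\<^sup>2 * (\<Sum>p\<in>P. (c p)\<^sup>2)"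
      by (simp add: sum.distrib sum_distrib_left)
    also have "\<dots> \<le> l * \<mu> * S + l\<^sup>2 * 2"
      using l \<mu>0 c1 c2 by (intro add_mono mult_left_mono) auto
    finally show "(\<Sum>p\<in>P. expectation (Y p) + expectation (\<lambda>\<omega>. (Y p \<omega>)\<^sup>2)) \<le> l * S * \<mu> + 2 * l\<^sup>2"
      by (simp add: algebra_simps)
  qed
  moreover have "l * t \<le> (\<Sum>p\<in>P. Y p \<omega>) \<longleftrightarrow> t \<le> (\<Sum>p\<in>P. c p * trunc K (X p \<omega>))" for \<omega>
  proof -
    have "(\<Sum>p\<in>P. Y p \<omega>) = l * (\<Sum>p\<in>P. c p * trunc K (X p \<omega>))"
      by (simp add: Y_def sum_distrib_left mult.assoc)
    then show ?thesis using l by simp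
  qed
  ultimately show ?thesis by simp
qed

lemma bilinear_form_V:
  "ip N x (mv N (V K \<omega>) y) = (\<Sum>p\<in>P. (x (fst p) * y (snd p) + x (snd p) * y (fst p)) * trunc K (X p \<omega>))"
proof -
  let ?f = "\<lambda>p. trunc K (X p \<omega>)"
  have "ip N x (mv N (V K \<omega>) y) = (\<Sum>i<N. \<Sum>j<N. if upos i j \<in> P then x i * ?f (upos i j) * y j else 0)"
    unfolding ip_def mv_def sum_distrib_left V_def sym_mat_def by (intro sum.cong refl) auto
  also have "\<dots> = (\<Sum>p\<in>P. x (fst p) * ?f (upos (fst p) (snd p)) * y (snd p) +
      x (snd p) * ?f (upos (snd p) (fst p)) * y (fst p))"
    by (rule sum_sym_pairs[OF P])
  also have "\<dots> = (\<Sum>p\<in>P. (x (fst p) * y (snd p) + x (snd p) * y (fst p)) * ?f p)"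
  proof (rule sum.cong[OF refl])
    fix p assume "p \<in> P"
    then have "fst p < snd p" using P by auto
    then have "upos (fst p) (snd p) = p" "upos (snd p) (fst p) = p" by (auto simp: upos_def)
    then show "x (fst p) * ?f (upos (fst p) (snd p)) * y (snd p) + x (snd p) * ?f (upos (snd p) (fst p)) * y (fst p) =
        (x (fst p) * y (snd p) + x (snd p) * y (fst p)) * ?f p"
      by (simp add: algebra_simps)
  qed
  finally show ?thesis .
qed

lemma prob_bilinear_form_ge:
  assumes K: "K > 0" and l: "l > 0" and \<alpha>: "0 \<le> \<alpha>" "\<alpha> \<le> 1" and \<beta>: "0 \<le> \<beta>" "\<beta> \<le> 1"
    and small: "l * (2 * \<alpha> * \<beta>) * K \<le> 1" and \<mu>: "\<bar>\<integral>x. trunc K x \<partial>D\<bar> \<le> \<mu>"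
    and x: "ip N x x \<le> 1" "\<And>i. i < N \<Longrightarrow> \<bar>x i\<bar> \<le> \<alpha>"
    and y: "ip N y y \<le> 1" "\<And>i. i < N \<Longrightarrow> \<bar>y i\<bar> \<le> \<beta>"
  shows "prob {\<omega> \<in> space M. t \<le> \<bar>ip N x (mv N (V K \<omega>) y)\<bar>} \<le>
    2 * exp (l * (real N)\<^sup>2 * \<mu> + 2 * l\<^sup>2 - l * t)"
proof -
  define c where "c p = x (fst p) * y (snd p) + x (snd p) * y (fst p)" for p
  have le: "\<bar>x i * y j\<bar> \<le> \<alpha> * \<beta>" if "i < N" "j < N" for i j
    unfolding abs_mult using that x(2) y(2) \<alpha> \<beta> by (intro mult_mono) auto
  have Pd: "fst p < N" "snd p < N" if "p \<in> P" for p using P that by fastforce+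
  have small': "\<bar>l * c p\<bar> * K \<le> 1" if p: "p \<in> P" for p
  proof -
    have "\<bar>c p\<bar> \<le> 2 * \<alpha> * \<beta>" using le[OF Pd(1)[OF p] Pd(2)[OF p]] le[OF Pd(2)[OF p] Pd(1)[OF p]] by (simp add: c_def)
    then have "\<bar>l * c p\<bar> * K \<le> l * (2 * \<alpha> * \<beta>) * K"
      using l K by (simp add: abs_mult)
    then show ?thesis using small by simp
  qed
  have c2: "(\<Sum>p\<in>P. (c p)\<^sup>2) \<le> 2"
  proof -
    have "(\<Sum>p\<in>P. (c p)\<^sup>2) \<le> (\<Sum>p\<in>P. 2 * ((x (fst p) * y (snd p))\<^sup>2) + 2 * ((x (snd p) * y (fst p))\<^sup>2))"
    proof (rule sum_mono)
      fix p
      have "0 \<le> (x (fst p) * y (snd p) - x (snd p) * y (fst p))\<^sup>2" by simp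
      then show "(c p)\<^sup>2 \<le> 2 * ((x (fst p) * y (snd p))\<^sup>2) + 2 * ((x (snd p) * y (fst p))\<^sup>2)"
        unfolding c_def power2_sum power2_diff by simp
    qed
    also have "\<dots> = (\<Sum>i<N. \<Sum>j<N. if upos i j \<in> P then 2 * (x i * y j)\<^sup>2 else 0)"
      by (rule sum_sym_pairs[OF P, symmetric])
    also have "\<dots> \<le> (\<Sum>i<N. \<Sum>j<N. 2 * (x i * y j)\<^sup>2)" by (intro sum_mono) auto
    also have "\<dots> = 2 * (ip N x x * ip N y y)"
      unfolding ip_def sum_product by (simp add: sum_distrib_left power2_eq_square algebra_simps)
    also have "\<dots> \<le> 2 * (1 * 1)"
      using x(1) y(1) by (intro mult_left_mono mult_mono) (auto simp: ip_self_nonneg)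
    finally show ?thesis by simp
  qed
  have c1: "(\<Sum>p\<in>P. \<bar>c p\<bar>) \<le> (real N)\<^sup>2"
  proof -
    have "(\<Sum>p\<in>P. \<bar>c p\<bar>) \<le> (\<Sum>p\<in>P. \<bar>x (fst p) * y (snd p)\<bar> + \<bar>x (snd p) * y (fst p)\<bar>)"
      unfolding c_def by (intro sum_mono abs_triangle_ineq)
    also have "\<dots> = (\<Sum>i<N. \<Sum>j<N. if upos i j \<in> P then \<bar>x i * y j\<bar> else 0)"
      by (rule sum_sym_pairs[OF P, symmetric])
    also have "\<dots> \<le> (\<Sum>i<N. \<Sum>j<N. 1)"
    proof (intro sum_mono)
      fix i j assume "i \<in> {..<N}" "j \<in> {..<N}"
      then have "\<bar>x i * y j\<bar> \<le> \<alpha> * \<beta>" using le by auto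
      also have "\<dots> \<le> 1 * 1" using \<alpha> \<beta> by (intro mult_mono) auto
      finally show "(if upos i j \<in> P then \<bar>x i * y j\<bar> else 0) \<le> 1" by simp
    qed
    finally show ?thesis by (simp add: power2_eq_square)
  qed
  have Xm [measurable]: "(\<lambda>\<omega>. \<Sum>p\<in>P. c p * trunc K (X p \<omega>)) \<in> borel_measurable M"
    by (intro borel_measurable_sum borel_measurable_times measurable_compose[OF X_measurable trunc_measurable]) auto
  have pos: "prob {\<omega> \<in> space M. t \<le> (\<Sum>p\<in>P. c p * trunc K (X p \<omega>))} \<le> exp (l * (real N)\<^sup>2 * \<mu> + 2 * l\<^sup>2 - l * t)"
    by (rule prob_linear_form_ge[OF K l small' c2 c1 \<mu>])
  have neg: "prob {\<omega> \<in> space M. t \<le> (\<Sum>p\<in>P. - c p * trunc K (X p \<omega>))} \<le> exp (l * (real N)\<^sup>2 * \<mu> + 2 * l\<^sup>2 - l * t)"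
    by (rule prob_linear_form_ge[OF K l _ _ _ \<mu>]) (use small' c2 c1 in auto)
  have "prob {\<omega> \<in> space M. t \<le> \<bar>ip N x (mv N (V K \<omega>) y)\<bar>} \<le>
      prob ({\<omega> \<in> space M. t \<le> (\<Sum>p\<in>P. c p * trunc K (X p \<omega>))} \<union>
        {\<omega> \<in> space M. t \<le> (\<Sum>p\<in>P. - c p * trunc K (X p \<omega>))})"
  proof (rule finite_measure_mono)
    show "{\<omega> \<in> space M. t \<le> \<bar>ip N x (mv N (V K \<omega>) y)\<bar>} \<subseteq> {\<omega> \<in> space M. t \<le> (\<Sum>p\<in>P. c p * trunc K (X p \<omega>))} \<union>
        {\<omega> \<in> space M. t \<le> (\<Sum>p\<in>P. - c p * trunc K (X p \<omega>))}"
      unfolding bilinear_form_V c_def[symmetric] by (auto simp: sum_negf abs_if split: if_splits)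
    show "{\<omega> \<in> space M. t \<le> (\<Sum>p\<in>P. c p * trunc K (X p \<omega>))} \<union>
        {\<omega> \<in> space M. t \<le> (\<Sum>p\<in>P. - c p * trunc K (X p \<omega>))} \<in> events"
      unfolding mult_minus_left sum_negf by measurable
  qed
  also have "\<dots> \<le> prob {\<omega> \<in> space M. t \<le> (\<Sum>p\<in>P. c p * trunc K (X p \<omega>))} +
        prob {\<omega> \<in> space M. t \<le> (\<Sum>p\<in>P. - c p * trunc K (X p \<omega>))}"
  proof (rule measure_Un_le)
    show "{\<omega> \<in> space M. t \<le> (\<Sum>p\<in>P. - c p * trunc K (X p \<omega>))} \<in> events"
      unfolding mult_minus_left sum_negf by measurable
  qed measurable
  also have "\<dots> \<le> 2 * exp (l * (real N)\<^sup>2 * \<mu> + 2 * l\<^sup>2 - l * t)" using pos neg by linarith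
  finally show ?thesis .
qed

text \<open>Functions of the entries in columns \<open>j\<close> and \<open>l\<close> of distinct rows are independent: as the
  diagonal vanishes, \<open>i\<close> differs from \<open>j\<close> and \<open>l\<close>, so that no entry is used for two rows.\<close>

lemma indep_rows:
  fixes F :: "real \<Rightarrow> real \<Rightarrow> real"
  assumes F: "case_prod F \<in> borel_measurable (borel \<Otimes>\<^sub>M borel)"
  shows "indep_vars (\<lambda>_. borel) (\<lambda>i \<omega>. F (X (upos i j) \<omega>) (X (upos i l) \<omega>))
    {i. i < N \<and> upos i j \<in> P \<and> upos i l \<in> P}"
proof -
  let ?L = "{i. i < N \<and> upos i j \<in> P \<and> upos i l \<in> P}" and ?K = "\<lambda>i. {upos i j, upos i l}"
  have "disjoint_family_on ?K ?L"
    unfolding disjoint_family_on_def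
  proof (intro ballI impI)
    fix i i' assume i: "i \<in> ?L" "i' \<in> ?L" "i \<noteq> i'"
    then have "i \<noteq> j" "i \<noteq> l" "i' \<noteq> j" "i' \<noteq> l" using upos_refl_notin by auto
    then show "?K i \<inter> ?K i' = {}" using i(3) by (auto simp: upos_eq_iff)
  qed
  then have "indep_vars (\<lambda>i. PiM (?K i) (\<lambda>_. borel)) (\<lambda>i \<omega>. restrict (\<lambda>p. X p \<omega>) (?K i)) ?L"
    by (intro indep_vars_restrict[OF indep]) auto
  then have "indep_vars (\<lambda>_. borel) (\<lambda>i \<omega>. case_prod F (restrict (\<lambda>p. X p \<omega>) (?K i) (upos i j), restrict (\<lambda>p. X p \<omega>) (?K i) (upos i l))) ?L"
  proof (rule indep_vars_compose2)
    fix i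
    have "(\<lambda>f. (f (upos i j), f (upos i l))) \<in> measurable (PiM (?K i) (\<lambda>_. borel)) (borel \<Otimes>\<^sub>M borel)"
      by (intro measurable_Pair measurable_component_singleton) auto
    then show "(\<lambda>f. case_prod F (f (upos i j), f (upos i l))) \<in> measurable (PiM (?K i) (\<lambda>_. borel)) borel"
      by (rule measurable_compose[OF _ F])
  qed
  then show ?thesis by simp
qed

text \<open>Squared column norms have mean at most \<open>N\<close>; the exponential parameter is \<open>1 / sqrt N\<close>, which the
  truncation level admits.\<close>

lemma prob_column_ge:
  assumes K: "K > 0" "K\<^sup>2 \<le> sqrt (real N)" and N: "N > 0"
  shows "prob {\<omega> \<in> space M. 3 * real N \<le> (\<Sum>i<N. (V K \<omega> i j)\<^sup>2)} \<le> exp ((\<integral>x. x ^ 4 \<partial>D) - 2 * sqrt (real N))"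
proof -
  define s where "s = sqrt (real N)"
  have s: "s > 0" "s * s = real N" using N by (auto simp: s_def)
  let ?L = "{i. i < N \<and> upos i j \<in> P}"
  let ?Y = "\<lambda>i \<omega>. (trunc K (X (upos i j) \<omega>))\<^sup>2 / s"
  have "prob {\<omega> \<in> space M. 3 * s \<le> (\<Sum>i\<in>?L. ?Y i \<omega>)} \<le> exp ((s + (\<integral>x. x ^ 4 \<partial>D)) - 3 * s)"
  proof (rule prob_sum_ge_le)
    show "indep_vars (\<lambda>_. borel) ?Y ?L"
      using indep_rows[of "\<lambda>x y. (trunc K x)\<^sup>2 / s" j j] by simp
    fix i \<omega>
    have "(trunc K (X (upos i j) \<omega>))\<^sup>2 \<le> K\<^sup>2"
      using abs_trunc_le[of K "X (upos i j) \<omega>"] K by (simp add: abs_le_square_iff[symmetric])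
    then show "\<bar>?Y i \<omega>\<bar> \<le> 1" using K(2) s by (simp add: s_def[symmetric] divide_le_eq)
  next
    have "(\<Sum>i\<in>?L. expectation (?Y i) + expectation (\<lambda>\<omega>. (?Y i \<omega>)\<^sup>2)) \<le> (\<Sum>i\<in>?L. 1 / s + (\<integral>x. x ^ 4 \<partial>D) / (s * s))"
    proof (rule sum_mono)
      fix i assume "i \<in> ?L"
      then have i: "upos i j \<in> P" by simp
      have "expectation (?Y i) = (\<integral>x. (trunc K x)\<^sup>2 \<partial>D) / s"
        using expectation_X[OF i, of "\<lambda>x. (trunc K x)\<^sup>2"] by simp
      also have "\<dots> \<le> 1 / s" using s trunc_second_moment[OF law K(1)] by (intro divide_right_mono) auto
      finally have 1: "expectation (?Y i) \<le> 1 / s" .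
      have "(\<lambda>\<omega>. (?Y i \<omega>)\<^sup>2) = (\<lambda>\<omega>. trunc K (X (upos i j) \<omega>) ^ 4 / (s * s))"
        by (simp add: power_divide power2_eq_square power4_eq_xxxx fun_eq_iff)
      then have "expectation (\<lambda>\<omega>. (?Y i \<omega>)\<^sup>2) = (\<integral>x. (trunc K x) ^ 4 \<partial>D) / (s * s)"
        using expectation_X[OF i, of "\<lambda>x. (trunc K x) ^ 4"] by simp
      also have "\<dots> \<le> (\<integral>x. x ^ 4 \<partial>D) / (s * s)"
        using s trunc_fourth_moment[OF law K(1)] by (intro divide_right_mono) auto
      finally show "expectation (?Y i) + expectation (\<lambda>\<omega>. (?Y i \<omega>)\<^sup>2) \<le> 1 / s + (\<integral>x. x ^ 4 \<partial>D) / (s * s)"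
        using 1 by simp
    qed
    also have "\<dots> \<le> (\<Sum>i<N. 1 / s + (\<integral>x. x ^ 4 \<partial>D) / (s * s))"
      using s by (intro sum_mono2) (auto intro!: add_nonneg_nonneg integral_nonneg_AE)
    also have "\<dots> = s + (\<integral>x. x ^ 4 \<partial>D)" using s by (simp add: s(2)[symmetric] field_simps)
    finally show "(\<Sum>i\<in>?L. expectation (?Y i) + expectation (\<lambda>\<omega>. (?Y i \<omega>)\<^sup>2)) \<le> s + (\<integral>x. x ^ 4 \<partial>D)" .
  qed simp
  moreover have "3 * s \<le> (\<Sum>i\<in>?L. ?Y i \<omega>) \<longleftrightarrow> 3 * real N \<le> (\<Sum>i<N. (V K \<omega> i j)\<^sup>2)" for \<omega>
  proof -
    have "(\<Sum>i<N. (V K \<omega> i j)\<^sup>2) = (\<Sum>i<N. if upos i j \<in> P then (trunc K (X (upos i j) \<omega>))\<^sup>2 else 0)"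
      by (intro sum.cong) (auto simp: V_def sym_mat_def)
    also have "\<dots> = (\<Sum>i\<in>{i\<in>{..<N}. upos i j \<in> P}. (trunc K (X (upos i j) \<omega>))\<^sup>2)"
      by (rule sum.inter_filter[symmetric]) simp
    also have "{i\<in>{..<N}. upos i j \<in> P} = ?L" by auto
    finally show ?thesis using s(1)
      by (simp add: sum_divide_distrib[symmetric] pos_le_divide_eq s(2)[symmetric] mult.assoc)
  qed
  ultimately show ?thesis by (simp add: s_def)
qed

lemma expectation_product:
  fixes f :: "real \<Rightarrow> real"
  assumes p: "p \<in> P" "q \<in> P" "p \<noteq> q" and f: "f \<in> borel_measurable borel" "\<And>x. \<bar>f x\<bar> \<le> C"
  shows "expectation (\<lambda>\<omega>. f (X p \<omega>) * f (X q \<omega>)) = (\<integral>x. f x \<partial>D)\<^sup>2"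
proof -
  have ind: "indep_vars (\<lambda>_. borel) (\<lambda>p \<omega>. f (X p \<omega>)) {p, q}"
    by (rule indep_vars_compose2[OF indep_vars_subset[OF indep]]) (use p f in auto)
  have "integrable M (\<lambda>\<omega>. f (X i \<omega>))" if "i \<in> {p, q}" for i
  proof (rule integrable_const_bound[where B = C])
    show "(\<lambda>\<omega>. f (X i \<omega>)) \<in> borel_measurable M"
      by (rule measurable_compose[OF X_measurable f(1)]) (use that p in auto)
  qed (use f in auto)
  then have "expectation (\<lambda>\<omega>. \<Prod>i\<in>{p, q}. f (X i \<omega>)) = (\<Prod>i\<in>{p, q}. expectation (\<lambda>\<omega>. f (X i \<omega>)))"
    by (intro indep_vars_lebesgue_integral ind) auto
  then show ?thesis using p(3) by (simp add: expectation_X[OF p(1) f(1)] expectation_X[OF p(2) f(1)] power2_eq_square)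
qed

text \<open>Inner products of two different columns, whose terms have mean at most \<open>\<mu>\<^sup>2\<close>.  The sign \<open>\<sigma>\<close>
  serves to bound the absolute value.\<close>

lemma prob_gram_signed_ge:
  assumes K: "K > 0" "K\<^sup>2 \<le> sqrt (real N)" and N: "N > 0" and jl: "j \<noteq> l"
    and \<mu>: "\<bar>\<integral>x. trunc K x \<partial>D\<bar> \<le> \<mu>" and \<sigma>: "\<bar>\<sigma>\<bar> = 1"
  shows "prob {\<omega> \<in> space M. g \<le> \<sigma> * (\<Sum>i<N. V K \<omega> i j * V K \<omega> i l)} \<le>
    exp (sqrt (real N) * \<mu>\<^sup>2 + 1 - g / sqrt (real N))"
proof -
  define s where "s = sqrt (real N)"
  have s: "s > 0" "s * s = real N" using N by (auto simp: s_def)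
  let ?L = "{i. i < N \<and> upos i j \<in> P \<and> upos i l \<in> P}"
  let ?T = "\<lambda>i j \<omega>. trunc K (X (upos i j) \<omega>)"
  let ?Y = "\<lambda>i \<omega>. \<sigma> / s * (?T i j \<omega> * ?T i l \<omega>)"
  have "prob {\<omega> \<in> space M. g / s \<le> (\<Sum>i\<in>?L. ?Y i \<omega>)} \<le> exp ((s * \<mu>\<^sup>2 + 1) - g / s)"
  proof (rule prob_sum_ge_le)
    show "indep_vars (\<lambda>_. borel) ?Y ?L"
      using indep_rows[of "\<lambda>x y. \<sigma> / s * (trunc K x * trunc K y)" j l] by simp
    fix i \<omega>
    have "\<bar>?T i j \<omega>\<bar> * \<bar>?T i l \<omega>\<bar> \<le> K * K"
      using K by (intro mult_mono abs_trunc_le) auto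
    then have "\<bar>?T i j \<omega>\<bar> * \<bar>?T i l \<omega>\<bar> \<le> s" using K(2) by (simp add: s_def power2_eq_square)
    then show "\<bar>?Y i \<omega>\<bar> \<le> 1" using \<sigma> s by (simp add: abs_mult divide_le_eq)
  next
    have "(\<Sum>i\<in>?L. expectation (?Y i) + expectation (\<lambda>\<omega>. (?Y i \<omega>)\<^sup>2)) \<le> (\<Sum>i\<in>?L. \<mu>\<^sup>2 / s + 1 / (s * s))"
    proof (rule sum_mono)
      fix i assume "i \<in> ?L"
      then have i: "upos i j \<in> P" "upos i l \<in> P" "upos i j \<noteq> upos i l" using jl by (auto simp: upos_eq_iff)
      have bd: "\<bar>trunc K x\<bar> \<le> K" for x using K by (intro abs_trunc_le) auto
      have "expectation (?Y i) = \<sigma> / s * (\<integral>x. trunc K x \<partial>D)\<^sup>2"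
        using expectation_product[OF i trunc_measurable bd] by simp
      also have "\<dots> \<le> 1 / s * \<mu>\<^sup>2"
      proof (rule mult_mono)
        show "\<sigma> / s \<le> 1 / s" using \<sigma> s by (intro divide_right_mono) auto
        show "(\<integral>x. trunc K x \<partial>D)\<^sup>2 \<le> \<mu>\<^sup>2" using \<mu> by (simp add: abs_le_square_iff[symmetric])
      qed (use s in auto)
      finally have 1: "expectation (?Y i) \<le> \<mu>\<^sup>2 / s" by simp
      have "(\<lambda>\<omega>. (?Y i \<omega>)\<^sup>2) = (\<lambda>\<omega>. (\<sigma>\<^sup>2 / (s * s)) * ((?T i j \<omega>)\<^sup>2 * (?T i l \<omega>)\<^sup>2))"
        by (simp add: power_divide power_mult_distrib power2_eq_square fun_eq_iff)
      moreover have "\<sigma>\<^sup>2 = 1" using \<sigma> by (metis power2_abs one_power2)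
      moreover have "expectation (\<lambda>\<omega>. (?T i j \<omega>)\<^sup>2 * (?T i l \<omega>)\<^sup>2) = (\<integral>x. (trunc K x)\<^sup>2 \<partial>D)\<^sup>2"
      proof (rule expectation_product[OF i, of "\<lambda>x. (trunc K x)\<^sup>2" "K\<^sup>2"])
        show "\<bar>(trunc K x)\<^sup>2\<bar> \<le> K\<^sup>2" for x using bd[of x] K by (simp add: abs_le_square_iff[symmetric])
      qed simp
      ultimately have "expectation (\<lambda>\<omega>. (?Y i \<omega>)\<^sup>2) = (\<integral>x. (trunc K x)\<^sup>2 \<partial>D)\<^sup>2 / (s * s)" by simp
      also have "\<dots> \<le> 1 / (s * s)"
      proof (rule divide_right_mono)
        have "0 \<le> (\<integral>x. (trunc K x)\<^sup>2 \<partial>D)" by (simp add: integral_nonneg_AE)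
        then show "(\<integral>x. (trunc K x)\<^sup>2 \<partial>D)\<^sup>2 \<le> 1" using trunc_second_moment[OF law K(1)] by (simp add: power_le_one)
      qed (use s in simp)
      finally show "expectation (?Y i) + expectation (\<lambda>\<omega>. (?Y i \<omega>)\<^sup>2) \<le> \<mu>\<^sup>2 / s + 1 / (s * s)"
        using 1 by simp
    qed
    also have "\<dots> \<le> (\<Sum>i<N. \<mu>\<^sup>2 / s + 1 / (s * s))"
      using s by (intro sum_mono2) auto
    also have "\<dots> = s * \<mu>\<^sup>2 + 1" using s by (simp add: s(2)[symmetric] field_simps)
    finally show "(\<Sum>i\<in>?L. expectation (?Y i) + expectation (\<lambda>\<omega>. (?Y i \<omega>)\<^sup>2)) \<le> s * \<mu>\<^sup>2 + 1" .
  qed simp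
  moreover have "g / s \<le> (\<Sum>i\<in>?L. ?Y i \<omega>) \<longleftrightarrow> g \<le> \<sigma> * (\<Sum>i<N. V K \<omega> i j * V K \<omega> i l)" for \<omega>
  proof -
    have "(\<Sum>i<N. V K \<omega> i j * V K \<omega> i l) = (\<Sum>i<N. if upos i j \<in> P \<and> upos i l \<in> P then ?T i j \<omega> * ?T i l \<omega> else 0)"
      by (intro sum.cong) (auto simp: V_def sym_mat_def)
    also have "\<dots> = (\<Sum>i\<in>{i\<in>{..<N}. upos i j \<in> P \<and> upos i l \<in> P}. ?T i j \<omega> * ?T i l \<omega>)"
      by (rule sum.inter_filter[symmetric]) simp
    also have "{i\<in>{..<N}. upos i j \<in> P \<and> upos i l \<in> P} = ?L" by auto
    finally have "(\<Sum>i\<in>?L. ?Y i \<omega>) = \<sigma> * (\<Sum>i<N. V K \<omega> i j * V K \<omega> i l) / s"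
      by (simp add: sum_distrib_left sum_divide_distrib)
    then show ?thesis using s(1) by (simp add: divide_le_cancel)
  qed
  ultimately show ?thesis by (simp add: s_def)
qed

end

section \<open>The norm of a random symmetric matrix\<close>

lemma (in prob_space) prob_UN_le:
  assumes "finite I" and "\<And>i. i \<in> I \<Longrightarrow> A i \<in> events" and "\<And>i. i \<in> I \<Longrightarrow> prob (A i) \<le> c"
    and "real (card I) \<le> m" and "0 \<le> c"
  shows "prob (\<Union>i\<in>I. A i) \<le> m * c"
proof -
  have "prob (\<Union>i\<in>I. A i) \<le> (\<Sum>i\<in>I. prob (A i))" by (rule measure_UNION_le[OF assms(1,2)])
  also have "\<dots> \<le> (\<Sum>i\<in>I. c)" by (rule sum_mono) (rule assms(3))
  also have "\<dots> \<le> m * c" using assms(4,5) by (simp add: mult_right_mono)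
  finally show ?thesis .
qed

text \<open>The union bound.  The five terms of the failure probability belong to: an entry beyond the
  truncation level; a long column; two columns with a large inner product; the net for small against
  small or medium; the net for medium against medium.\<close>

lemma (in random_sym_mat) op_bound_event:
  assumes N: "N > 0" and K: "K > 0" "K\<^sup>2 \<le> sqrt (real N)"
    and \<tau>: "0 < \<tau>" "\<tau> < \<theta>" "\<theta> \<le> 1" and g: "0 \<le> g" "g \<le> real N * \<theta>\<^sup>2"
    and l: "l > 0" "l * (2 * \<tau> * \<theta>) * K \<le> 1" and l': "l' > 0" "l' * (2 * \<theta> * \<theta>) * K \<le> 1"
    and \<mu>: "\<bar>\<integral>x. trunc K x \<partial>D\<bar> \<le> \<mu>" and q: "measure D {x. \<bar>x\<bar> > K} \<le> q"
  shows "\<exists>E\<in>events. 1 - ((real N)\<^sup>2 * q + real N * exp ((\<integral>x. x ^ 4 \<partial>D) - 2 * sqrt (real N)) +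
      2 * (real N)\<^sup>2 * exp (sqrt (real N) * \<mu>\<^sup>2 + 1 - g / sqrt (real N)) +
      exp (36 * real N) * (2 * exp (l * (real N)\<^sup>2 * \<mu> + 2 * l\<^sup>2 - l * (40 * sqrt (real N)))) +
      exp (2 * (1 + ln (8 * (real N)\<^sup>2) / \<tau>\<^sup>2)) * (2 * exp (l' * (real N)\<^sup>2 * \<mu> + 2 * l'\<^sup>2 - l' * (40 * sqrt (real N)))))
      \<le> prob E \<and> (\<forall>\<omega>\<in>E. op_bound N (sym_mat P (\<lambda>p. X p \<omega>)) (248 * sqrt (real N)))"
proof -
  let ?p = "lattice_point N"
  \<comment> \<open>the factor \<open>40\<close> has to exceed \<open>36\<close> from the cardinality of the net plus \<open>2\<close> from the variance\<close>
  define b where "b = 40 * sqrt (real N)"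
  define A1 where "A1 p = {\<omega> \<in> space M. K < \<bar>X p \<omega>\<bar>}" for p
  define A2 where "A2 j = {\<omega> \<in> space M. 3 * real N \<le> (\<Sum>i<N. (V K \<omega> i j)\<^sup>2)}" for j
  define A3 where "A3 = (\<lambda>(j, l, \<sigma>). {\<omega> \<in> space M. g \<le> \<sigma> * (\<Sum>i<N. V K \<omega> i j * V K \<omega> i l)})"
  define A4 where "A4 = (\<lambda>(n, n'). {\<omega> \<in> space M. b \<le> \<bar>ip N (?p n) (mv N (V K \<omega>) (?p n'))\<bar>})"
  define J3 where "J3 = {(j, l, \<sigma>). (j, l, \<sigma>) \<in> {..<N} \<times> {..<N} \<times> {1, -1::real} \<and> j \<noteq> l}"
  define S where "S = {n \<in> lattice_ball N. \<forall>i<N. \<bar>?p n i\<bar> \<le> \<tau>}"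
  define R where "R = {n \<in> lattice_ball N. \<forall>i<N. \<bar>?p n i\<bar> \<le> \<theta>}"
  define Q where "Q = {n \<in> lattice_ball N. (\<forall>i<N. n i = 0 \<or> \<tau> < \<bar>?p n i\<bar>) \<and> (\<forall>i<N. \<bar>?p n i\<bar> \<le> \<theta>)}"
  have fin: "finite S" "finite R" "finite Q"
    by (auto simp: S_def R_def Q_def intro: finite_subset[OF _ finite_lattice_ball])
  have cardSR: "real (card (S \<times> R)) \<le> exp (36 * real N)"
  proof -
    have "card S \<le> card (lattice_ball N)" "card R \<le> card (lattice_ball N)"
      by (auto simp: S_def R_def intro!: card_mono finite_lattice_ball)
    then have "real (card S) \<le> exp (18 * real N)" "real (card R) \<le> exp (18 * real N)"
      using card_lattice_ball_le[of N] by linarith+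
    then have "real (card S) * real (card R) \<le> exp (18 * real N) * exp (18 * real N)"
      by (intro mult_mono) auto
    then show ?thesis by (simp add: card_cartesian_product exp_add[symmetric])
  qed
  have cardQ: "real (card (Q \<times> Q)) \<le> exp (2 * (1 + ln (8 * (real N)\<^sup>2) / \<tau>\<^sup>2))"
  proof -
    let ?F = "{n \<in> lattice_ball N. \<forall>i<N. n i = 0 \<or> \<tau> < \<bar>?p n i\<bar>}"
    have "card Q \<le> card ?F"
      by (rule card_mono) (auto simp: Q_def intro: finite_subset[OF _ finite_lattice_ball])
    then have "real (card Q) \<le> exp (1 + ln (8 * (real N)\<^sup>2) / \<tau>\<^sup>2)"
      using card_sparse_lattice_le[OF \<tau>(1) N] by linarith
    then have "real (card Q) * real (card Q) \<le> exp (1 + ln (8 * (real N)\<^sup>2) / \<tau>\<^sup>2) * exp (1 + ln (8 * (real N)\<^sup>2) / \<tau>\<^sup>2)"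
      by (intro mult_mono) auto
    then show ?thesis by (simp add: card_cartesian_product exp_add[symmetric])
  qed
  have cardJ3: "finite J3" "real (card J3) \<le> 2 * (real N)\<^sup>2"
  proof -
    have sub: "J3 \<subseteq> {..<N} \<times> {..<N} \<times> {1, -1}" by (auto simp: J3_def)
    then show "finite J3" by (rule finite_subset) simp
    have "card J3 \<le> card ({..<N} \<times> {..<N} \<times> {1, -1::real})" by (rule card_mono[OF _ sub]) simp
    also have "\<dots> = N * N * 2" by (simp add: card_cartesian_product)
    finally have "real (card J3) \<le> real (N * N * 2)" unfolding of_nat_le_iff .
    then show "real (card J3) \<le> 2 * (real N)\<^sup>2" by (simp add: power2_eq_square)
  qed
  have m1: "A1 p \<in> events" if "p \<in> P" for p
    using X_measurable[OF that] unfolding A1_def by measurable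
  have m2: "A2 j \<in> events" for j unfolding A2_def by measurable
  have m3: "A3 i \<in> events" for i by (cases i) (simp add: A3_def)
  have m4: "A4 i \<in> events" for i by (cases i) (simp add: A4_def)
  have q0: "q \<ge> 0" using q measure_nonneg[of D] order_trans by blast
  have p1: "prob (\<Union>p\<in>P. A1 p) \<le> (real N)\<^sup>2 * q"
  proof (rule prob_UN_le[OF finite_P m1 _ card_P q0])
    fix p assume p: "p \<in> P"
    have "{x. \<bar>x\<bar> > K} \<in> sets (borel :: real measure)" by measurable
    then have "measure D {x. \<bar>x\<bar> > K} = prob (X p -` {x. \<bar>x\<bar> > K} \<inter> space M)"
      unfolding distr_X[OF p, symmetric] by (rule measure_distr[OF X_measurable[OF p]])
    also have "X p -` {x. \<bar>x\<bar> > K} \<inter> space M = A1 p" by (auto simp: A1_def)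
    finally show "prob (A1 p) \<le> q" using q by simp
  qed
  have p2: "prob (\<Union>j\<in>{..<N}. A2 j) \<le> real N * exp ((\<integral>x. x ^ 4 \<partial>D) - 2 * sqrt (real N))"
    by (rule prob_UN_le[OF _ m2]) (auto simp: A2_def intro!: prob_column_ge[OF K N])
  have p3: "prob (\<Union>i\<in>J3. A3 i) \<le> 2 * (real N)\<^sup>2 * exp (sqrt (real N) * \<mu>\<^sup>2 + 1 - g / sqrt (real N))"
    by (rule prob_UN_le[OF cardJ3(1) m3 _ cardJ3(2)])
      (auto simp: A3_def J3_def simp del: mult_1 mult_minus1 intro!: prob_gram_signed_ge[OF K N _ \<mu>])
  have p4: "prob (\<Union>i\<in>S \<times> R. A4 i) \<le>
      exp (36 * real N) * (2 * exp (l * (real N)\<^sup>2 * \<mu> + 2 * l\<^sup>2 - l * b))"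
  proof (rule prob_UN_le[OF _ m4 _ cardSR])
    fix i assume "i \<in> S \<times> R"
    then obtain n n' where i: "i = (n, n')" "n \<in> S" "n' \<in> R" by auto
    show "prob (A4 i) \<le> 2 * exp (l * (real N)\<^sup>2 * \<mu> + 2 * l\<^sup>2 - l * b)"
      unfolding i(1) A4_def prod.case
      by (rule prob_bilinear_form_ge[OF K(1) l(1) _ _ _ _ l(2) \<mu>])
        (use \<tau> i(2,3) ip_lattice_point_le in \<open>auto simp: S_def R_def\<close>)
  qed (use fin in auto)
  have p5: "prob (\<Union>i\<in>Q \<times> Q. A4 i) \<le> exp (2 * (1 + ln (8 * (real N)\<^sup>2) / \<tau>\<^sup>2)) *
      (2 * exp (l' * (real N)\<^sup>2 * \<mu> + 2 * l'\<^sup>2 - l' * b))"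
  proof (rule prob_UN_le[OF _ m4 _ cardQ])
    fix i assume "i \<in> Q \<times> Q"
    then obtain n n' where i: "i = (n, n')" "n \<in> Q" "n' \<in> Q" by auto
    show "prob (A4 i) \<le> 2 * exp (l' * (real N)\<^sup>2 * \<mu> + 2 * l'\<^sup>2 - l' * b)"
      unfolding i(1) A4_def prod.case
      by (rule prob_bilinear_form_ge[OF K(1) l'(1) _ _ _ _ l'(2) \<mu>])
        (use \<tau> i(2,3) ip_lattice_point_le in \<open>auto simp: Q_def\<close>)
  qed (use fin in auto)
  define B1 where "B1 = (\<Union>p\<in>P. A1 p)"
  define B2 where "B2 = (\<Union>j\<in>{..<N}. A2 j)"
  define B3 where "B3 = (\<Union>i\<in>J3. A3 i)"
  define B4 where "B4 = (\<Union>i\<in>S \<times> R. A4 i)"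
  define B5 where "B5 = (\<Union>i\<in>Q \<times> Q. A4 i)"
  have ev: "B1 \<in> events" "B2 \<in> events" "B3 \<in> events" "B4 \<in> events" "B5 \<in> events"
    unfolding B1_def B2_def B3_def B4_def B5_def using m1 m2 m3 m4 fin cardJ3(1) finite_P
    by (auto intro!: sets.finite_UN)
  define E where "E = space M - (B1 \<union> B2 \<union> B3 \<union> B4 \<union> B5)"
  have E: "E \<in> events" using ev by (auto simp: E_def)
  have "prob (B1 \<union> B2 \<union> B3 \<union> B4 \<union> B5) \<le> prob B1 + prob B2 + prob B3 + prob B4 + prob B5"
    using ev measure_Un_le[of "B1 \<union> B2 \<union> B3 \<union> B4" M B5] measure_Un_le[of "B1 \<union> B2 \<union> B3" M B4]
      measure_Un_le[of "B1 \<union> B2" M B3] measure_Un_le[of "B1" M B2] by (auto simp: sets.Un)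
  moreover have "prob E = 1 - prob (B1 \<union> B2 \<union> B3 \<union> B4 \<union> B5)"
    unfolding E_def by (rule prob_compl) (use ev in auto)
  moreover note p1[folded B1_def] p2[folded B2_def] p3[folded B3_def]
    p4[folded B4_def, unfolded b_def] p5[folded B5_def, unfolded b_def]
  ultimately have "1 - ((real N)\<^sup>2 * q + real N * exp ((\<integral>x. x ^ 4 \<partial>D) - 2 * sqrt (real N)) +
      2 * (real N)\<^sup>2 * exp (sqrt (real N) * \<mu>\<^sup>2 + 1 - g / sqrt (real N)) +
      exp (36 * real N) * (2 * exp (l * (real N)\<^sup>2 * \<mu> + 2 * l\<^sup>2 - l * (40 * sqrt (real N)))) +
      exp (2 * (1 + ln (8 * (real N)\<^sup>2) / \<tau>\<^sup>2)) * (2 * exp (l' * (real N)\<^sup>2 * \<mu> + 2 * l'\<^sup>2 - l' * (40 * sqrt (real N)))))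
      \<le> prob E" by linarith
  moreover have "op_bound N (sym_mat P (\<lambda>p. X p \<omega>)) (248 * sqrt (real N))" if \<omega>: "\<omega> \<in> E" for \<omega>
  proof -
    have sp: "\<omega> \<in> space M" using \<omega> by (simp add: E_def)
    have n1: "\<bar>X p \<omega>\<bar> \<le> K" if "p \<in> P" for p
      using \<omega> that by (force simp: E_def B1_def A1_def)
    have VX: "sym_mat P (\<lambda>p. X p \<omega>) = V K \<omega>"
      by (intro ext) (auto simp: V_def sym_mat_def trunc_def n1)
    have "op_bound N (V K \<omega>) (2 * (4 * sqrt (real N) + 3 * b))"
    proof (rule op_bound_of_classes[OF N _ \<tau>(1,2) g])
      show "V K \<omega> i j = V K \<omega> j i" for i j unfolding V_def by (rule sym_mat_commute)
      show "(\<Sum>i<N. (V K \<omega> i j)\<^sup>2) \<le> 3 * real N" if "j < N" for j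
        using \<omega> sp that by (force simp: E_def B2_def A2_def)
      show "\<bar>\<Sum>i<N. V K \<omega> i j * V K \<omega> i l\<bar> \<le> g" if "j < N" "l < N" "j \<noteq> l" for j l
      proof -
        have "\<omega> \<notin> A3 (j, l, 1)" "\<omega> \<notin> A3 (j, l, -1)"
          using \<omega> that by (auto simp: E_def B3_def J3_def)
        then show ?thesis using sp by (auto simp: A3_def)
      qed
      fix n n' assume n: "n \<in> lattice_ball N" "n' \<in> lattice_ball N"
      have A4: "\<bar>ip N (?p n) (mv N (V K \<omega>) (?p n'))\<bar> \<le> b" if "\<omega> \<notin> A4 (n, n')"
        using that sp by (auto simp: A4_def)
      show "\<bar>ip N (?p n) (mv N (V K \<omega>) (?p n'))\<bar> \<le> b"
        if "\<And>i. i < N \<Longrightarrow> \<bar>?p n i\<bar> \<le> \<tau>" "\<And>i. i < N \<Longrightarrow> \<bar>?p n' i\<bar> \<le> \<theta>"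
      proof (rule A4)
        have "n \<in> S" "n' \<in> R" using n that by (auto simp: S_def R_def)
        then show "\<omega> \<notin> A4 (n, n')" using \<omega> by (auto simp: E_def B4_def)
      qed
      show "\<bar>ip N (?p n) (mv N (V K \<omega>) (?p n'))\<bar> \<le> b"
        if "\<And>i. i < N \<Longrightarrow> n i = 0 \<or> \<tau> < \<bar>?p n i\<bar>" "\<And>i. i < N \<Longrightarrow> n' i = 0 \<or> \<tau> < \<bar>?p n' i\<bar>"
          "\<And>i. i < N \<Longrightarrow> \<bar>?p n i\<bar> \<le> \<theta>" "\<And>i. i < N \<Longrightarrow> \<bar>?p n' i\<bar> \<le> \<theta>"
      proof (rule A4)
        have "n \<in> Q" "n' \<in> Q" using n that by (auto simp: Q_def)
        then show "\<omega> \<notin> A4 (n, n')" using \<omega> by (auto simp: E_def B5_def)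
      qed
    qed
    then show ?thesis by (simp add: VX b_def)
  qed
  ultimately show ?thesis using E by blast
qed

text \<open>The failure probability of \<open>op_bound_event\<close> for \<open>K = n powr (1/32)\<close>, \<open>\<tau> = n powr (-3/8)\<close>,
  \<open>\<theta> = n powr (-3/16)\<close>, \<open>g = n powr (5/8)\<close> and exponential parameters \<open>sqrt n\<close> and
  \<open>n powr (11/32) / 2\<close>, where \<open>m\<close> bounds the moment of order \<open>128\<close> of the entries and \<open>m'\<close> is their fourth
  moment.  The tail and the truncated mean enter through their bounds \<open>m / K ^ 128\<close>, which is
  negligible against the number of entries, and \<open>m / K ^ 127\<close>.  The exponents are chosen such that \<open>g = n * \<theta>\<^sup>2\<close>, that \<open>sqrt n * \<tau> * \<theta> * K\<close> tends to \<open>0\<close>, that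
  \<open>n powr (11/32) * \<theta>\<^sup>2 * K = 1\<close>, and that the exponent \<open>27/32\<close> of the last Bernstein bound exceeds the
  exponent \<open>3/4\<close> of the logarithm of the cardinality of the net.\<close>

definition norm_failure :: "real \<Rightarrow> real \<Rightarrow> real \<Rightarrow> real" where
  "norm_failure m m' n =
     n\<^sup>2 * (m / n powr 4) + n * exp (m' - 2 * sqrt n) +
     2 * n\<^sup>2 * exp (sqrt n * (m / n powr (127/32))\<^sup>2 + 1 - n powr (5/8) / sqrt n) +
     exp (36 * n) * (2 * exp (sqrt n * n\<^sup>2 * (m / n powr (127/32)) + 2 * (sqrt n)\<^sup>2 - sqrt n * (40 * sqrt n))) +
     exp (2 * (1 + ln (8 * n\<^sup>2) / (n powr (-3/8))\<^sup>2)) *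
       (2 * exp (n powr (11/32) / 2 * n\<^sup>2 * (m / n powr (127/32)) + 2 * (n powr (11/32) / 2)\<^sup>2
         - n powr (11/32) / 2 * (40 * sqrt n)))"

lemma norm_failure_tendsto_0:
  assumes "m > 0"
  shows "((\<lambda>N. norm_failure m m' (real N)) \<longlongrightarrow> 0) sequentially"
proof -
  have 1: "((\<lambda>n. n\<^sup>2 * (m / n powr 4)) \<longlongrightarrow> 0) at_top" using assms by real_asymp
  have 2: "((\<lambda>n. n * exp (m' - 2 * sqrt n)) \<longlongrightarrow> 0) at_top" by real_asymp
  have 3: "((\<lambda>n. 2 * n\<^sup>2 * exp (sqrt n * (m / n powr (127/32))\<^sup>2 + 1 - n powr (5/8) / sqrt n)) \<longlongrightarrow> 0) at_top"
    using assms by real_asymp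
  have 4: "((\<lambda>n. exp (36 * n) * (2 * exp (sqrt n * n\<^sup>2 * (m / n powr (127/32)) + 2 * (sqrt n)\<^sup>2 - sqrt n * (40 * sqrt n)))) \<longlongrightarrow> 0) at_top"
    using assms by real_asymp
  have 5: "((\<lambda>n. exp (2 * (1 + ln (8 * n\<^sup>2) / (n powr (-3/8))\<^sup>2)) *
       (2 * exp (n powr (11/32) / 2 * n\<^sup>2 * (m / n powr (127/32)) + 2 * (n powr (11/32) / 2)\<^sup>2
         - n powr (11/32) / 2 * (40 * sqrt n)))) \<longlongrightarrow> 0) at_top"
    using assms by real_asymp
  have "(norm_failure m m' \<longlongrightarrow> 0 + 0 + 0 + 0 + 0) at_top"
    unfolding norm_failure_def[abs_def] by (intro tendsto_add 1 2 3 4 5)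
  then show ?thesis by (simp add: filterlim_compose[OF _ filterlim_real_sequentially])
qed

text \<open>The bound \<open>\<delta> N\<close> on the failure probability depends on the law \<open>D\<close> only.\<close>

lemma op_bound_whp:
  assumes D: "entry_law D"
  shows "\<exists>\<delta>. \<delta> \<longlonglongrightarrow> 0 \<and> (\<forall>\<^sub>F N in sequentially. \<forall>(M :: 'a measure) P X. random_sym_mat M D N P X \<longrightarrow>
    (\<exists>E\<in>sets M. 1 - \<delta> N \<le> measure M E \<and> (\<forall>\<omega>\<in>E. op_bound N (sym_mat P (\<lambda>p. X p \<omega>)) (248 * sqrt (real N)))))"
proof -
  define m where "m = (\<integral>x. x ^ 128 \<partial>D) + 1"
  define m' where "m' = (\<integral>x. x ^ 4 \<partial>D)"
  have "(\<integral>x. x ^ 128 \<partial>D) \<ge> 0" by (intro integral_nonneg_AE) (auto intro!: AE_I2 zero_le_even_power)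
  then have m: "m > 0" "(\<integral>x. x ^ 128 \<partial>D) \<le> m" unfolding m_def by linarith+
  have small: "\<forall>\<^sub>F N in sequentially. sqrt (real N) * (2 * real N powr (-3/8) * real N powr (-3/16)) * real N powr (1/32) \<le> 1"
    by real_asymp
  have "\<forall>\<^sub>F N in sequentially. \<forall>(M :: 'a measure) P X. random_sym_mat M D N P X \<longrightarrow>
    (\<exists>E\<in>sets M. 1 - norm_failure m m' (real N) \<le> measure M E \<and>
       (\<forall>\<omega>\<in>E. op_bound N (sym_mat P (\<lambda>p. X p \<omega>)) (248 * sqrt (real N))))"
    using small eventually_gt_at_top[of 1]
  proof eventually_elim
    case (elim N)
    define n where "n = real N"
    have n: "n > 1" using elim by (simp add: n_def)
    have K: "n powr (1/32) > 0" using n by simp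
    have pw: "(n powr (1/32)) ^ j = n powr (real j / 32)" for j
      using n by (simp add: powr_realpow[symmetric] powr_powr)
    show ?case
    proof (intro allI impI)
      fix M :: "'a measure" and P X assume "random_sym_mat M D N P X"
      then interpret random_sym_mat M D N P X .
      have q: "measure D {x. \<bar>x\<bar> > n powr (1/32)} \<le> m / n powr 4"
      proof -
        have "measure D {x. \<bar>x\<bar> > n powr (1/32)} \<le> (\<integral>x. x ^ 128 \<partial>D) / n powr 4"
          using tail_entry_law[OF D K, of 64] by (simp add: pw)
        also have "\<dots> \<le> m / n powr 4" using m by (intro divide_right_mono) auto
        finally show ?thesis .
      qed
      have \<mu>: "\<bar>\<integral>x. trunc (n powr (1/32)) x \<partial>D\<bar> \<le> m / n powr (127/32)"
      proof -
        have "\<bar>\<integral>x. trunc (n powr (1/32)) x \<partial>D\<bar> \<le> (\<integral>x. x ^ 128 \<partial>D) / n powr (127/32)"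
          using trunc_mean[OF D K, of 63] by (simp add: pw del: power_Suc)
        also have "\<dots> \<le> m / n powr (127/32)" using m by (intro divide_right_mono) auto
        finally show ?thesis .
      qed
      have sq: "sqrt n = n powr (1/2)" using n by (simp add: powr_half_sqrt)
      show "\<exists>E\<in>events. 1 - norm_failure m m' (real N) \<le> prob E \<and>
         (\<forall>\<omega>\<in>E. op_bound N (sym_mat P (\<lambda>p. X p \<omega>)) (248 * sqrt (real N)))"
        unfolding norm_failure_def m'_def n_def[symmetric]
      proof (rule op_bound_event[of "n powr (1/32)" _ "n powr (-3/16)", folded n_def])
        show "(n powr (1/32))\<^sup>2 \<le> sqrt n" unfolding pw sq using n by (intro powr_mono) auto
        show "n powr (-3/8) < n powr (-3/16)" using n by (intro powr_less_mono) auto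
        show "n powr (-3/16) \<le> 1" using powr_mono[of "-3/16" 0 n] n by simp
        show "n powr (5/8) \<le> n * (n powr (-3/16))\<^sup>2"
          using n by (simp add: power2_eq_square powr_add[symmetric] powr_mult_base)
        show "n powr (11/32) / 2 * (2 * n powr (-3/16) * n powr (-3/16)) * n powr (1/32) \<le> 1"
          using n by (simp add: powr_add[symmetric])
      qed (use n elim q \<mu> in \<open>auto simp: n_def\<close>)
    qed
  qed
  then show ?thesis using norm_failure_tendsto_0[OF m(1), of m'] by blast
qed

section \<open>The two ensembles\<close>

lemma op_bound_cong:
  assumes "op_bound N a c" and "\<And>i j. i < N \<Longrightarrow> j < N \<Longrightarrow> a i j = b i j"
  shows "op_bound N b c"
proof -
  have "ip N x (mv N b y) = ip N x (mv N a y)" for x y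
    unfolding ip_def mv_def by (intro sum.cong refl) (use assms(2) in auto)
  then show ?thesis using assms(1) by (simp add: op_bound_def)
qed

lemma op_bound_add:
  assumes "op_bound N a c" and "op_bound N b d"
  shows "op_bound N (\<lambda>i j. a i j + b i j) (c + d)"
  unfolding op_bound_def
proof (intro allI)
  fix x y
  have "ip N x (mv N (\<lambda>i j. a i j + b i j) y) = ip N x (mv N a y) + ip N x (mv N b y)"
    by (simp add: ip_def mv_def sum.distrib algebra_simps)
  also have "\<bar>\<dots>\<bar> \<le> c * sqrt (ip N x x) * sqrt (ip N y y) + d * sqrt (ip N x x) * sqrt (ip N y y)"
    using assms unfolding op_bound_def by (meson abs_triangle_ineq add_mono order_trans)
  finally show "\<bar>ip N x (mv N (\<lambda>i j. a i j + b i j) y)\<bar> \<le> (c + d) * sqrt (ip N x x) * sqrt (ip N y y)"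
    by (simp add: algebra_simps)
qed

lemma op_bound_diagonal:
  assumes d: "\<And>i. i < N \<Longrightarrow> \<bar>d i\<bar> \<le> c" and c: "c \<ge> 0"
  shows "op_bound N (\<lambda>i j. if i = j then d i else 0) c"
  unfolding op_bound_def
proof (intro allI)
  fix x y
  have "\<bar>ip N x (mv N (\<lambda>i j. if i = j then d i else 0) y)\<bar> = \<bar>\<Sum>i<N. d i * (x i * y i)\<bar>"
    unfolding ip_def mv_def by (intro arg_cong[of _ _ abs] sum.cong refl) (simp add: if_distrib[of "\<lambda>t. t * _"] cong: if_cong)
  also have "\<dots> \<le> (\<Sum>i<N. \<bar>d i\<bar> * (\<bar>x i\<bar> * \<bar>y i\<bar>))"
    by (rule order_trans[OF sum_abs]) (simp add: abs_mult)
  also have "\<dots> \<le> (\<Sum>i<N. c * (\<bar>x i\<bar> * \<bar>y i\<bar>))" by (intro sum_mono mult_right_mono d) auto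
  also have "\<dots> = c * ip N (\<lambda>i. \<bar>x i\<bar>) (\<lambda>i. \<bar>y i\<bar>)" by (simp add: ip_def sum_distrib_left)
  also have "\<dots> \<le> c * (sqrt (ip N x x) * sqrt (ip N y y))"
    using abs_ip_le[of N "\<lambda>i. \<bar>x i\<bar>" "\<lambda>i. \<bar>y i\<bar>"] c by (intro mult_left_mono) (auto simp: ip_def)
  finally show "\<bar>ip N x (mv N (\<lambda>i j. if i = j then d i else 0) y)\<bar> \<le> c * sqrt (ip N x x) * sqrt (ip N y y)"
    by (simp add: mult.assoc)
qed

lemma checkerboard_random_sym_mat:
  assumes "entry_law D" and "prob_space M" and A: "checkerboard_matrix M D k N A"
  shows "random_sym_mat M D N {(i, j). i < j \<and> j < N \<and> i mod k \<noteq> j mod k} (\<lambda>p \<omega>. A \<omega> $$ p)"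
proof -
  interpret prob_space M by fact
  show ?thesis
    by unfold_locales (use assms in \<open>auto simp: checkerboard_matrix_def\<close>)
qed

lemma checkerboard_centred_eq:
  assumes A: "checkerboard_matrix M D k N A" and \<omega>: "\<omega> \<in> space M" and ij: "i < N" "j < N"
  shows "sym_mat {(i, j). i < j \<and> j < N \<and> i mod k \<noteq> j mod k} (\<lambda>p. A \<omega> $$ p) i j
    = A \<omega> $$ (i, j) - mean_checkerboard k N $$ (i, j)"
proof -
  have c: "A \<omega> \<in> carrier_mat N N" "transpose_mat (A \<omega>) = A \<omega>"
    and one: "i mod k = j mod k \<Longrightarrow> A \<omega> $$ (i, j) = 1"
    using A \<omega> ij by (auto simp: checkerboard_matrix_def)
  have sym: "A \<omega> $$ (j, i) = A \<omega> $$ (i, j)"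
    using c ij by (metis carrier_matD index_transpose_mat(1))
  show ?thesis
    using one sym ij by (cases "i \<le> j") (auto simp: sym_mat_def upos_def mean_checkerboard_def)
qed

text \<open>The standard normal distribution, as a measure on the Borel sets.\<close>

definition std_normal_law :: "real measure" where
  "std_normal_law = density lborel (\<lambda>x. ennreal (std_normal_density x))"

lemma integrable_std_normal_law: "integrable std_normal_law (\<lambda>x. x ^ p)"
  unfolding std_normal_law_def
  by (subst integrable_density) (auto simp: integrable_std_normal_moment)

lemma integral_std_normal_law: "(\<integral>x. x ^ p \<partial>std_normal_law) = (\<integral>x. std_normal_density x * x ^ p \<partial>lborel)"
  unfolding std_normal_law_def by (subst integral_density) auto

lemma entry_law_std_normal_law: "entry_law std_normal_law"
proof -
  have rd: "real_distribution std_normal_law"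
    using real_dist_normal_dist by (simp add: std_normal_law_def)
  interpret real_distribution std_normal_law by (rule rd)
  have 1: "expectation (\<lambda>x. x) = 0"
    using integral_std_normal_law[of 1] integral_std_normal_moment_odd[of 0] by simp
  moreover have "variance (\<lambda>x. x) = 1"
    unfolding 1 using integral_std_normal_law[of 2] integral_std_normal_moment_even[of 1] by simp
  ultimately show ?thesis
    using integrable_std_normal_law rd by (simp add: entry_law_def)
qed

lemma distributed_distr_borel:
  assumes "distributed M lborel Z std_normal_density"
  shows "distr M borel Z = std_normal_law"
proof -
  have "distr M borel Z = distr M lborel Z" by (rule distr_cong) auto
  also have "\<dots> = std_normal_law"
    using assms by (simp add: distributed_def std_normal_law_def)
  finally show ?thesis .
qed

lemma goe_random_sym_mat:
  assumes "prob_space M" and B: "goe_matrix M N B"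
  shows "random_sym_mat M std_normal_law N {(i, j). i < j \<and> j < N} (\<lambda>p \<omega>. B \<omega> $$ p)"
proof -
  interpret prob_space M by fact
  show ?thesis
  proof unfold_locales
    have "indep_vars (\<lambda>_. borel) (\<lambda>ij \<omega>. B \<omega> $$ ij) {(i, j). i \<le> j \<and> j < N}"
      using B by (simp add: goe_matrix_def)
    then show "indep_vars (\<lambda>_. borel) (\<lambda>ij \<omega>. B \<omega> $$ ij) {(i, j). i < j \<and> j < N}"
      by (rule indep_vars_subset) auto
    fix p assume "p \<in> {(i, j). i < j \<and> j < N}"
    then show "distr M borel (\<lambda>\<omega>. B \<omega> $$ p) = std_normal_law"
      using B by (auto simp: goe_matrix_def intro!: distributed_distr_borel)
  qed (use entry_law_std_normal_law in auto)
qed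

text \<open>The diagonal of the GOE is not covered by \<open>random_sym_mat\<close>; a fourth moment suffices for it.\<close>

lemma goe_diagonal_event:
  assumes "prob_space M" and B: "goe_matrix M N B" and N: "N > 0"
  shows "\<exists>E\<in>sets M. 1 - (\<integral>x. x ^ 4 \<partial>std_normal_law) / real N \<le> measure M E \<and>
    (\<forall>\<omega>\<in>E. \<forall>i<N. \<bar>B \<omega> $$ (i, i)\<bar> \<le> 2 * sqrt (real N))"
proof -
  interpret prob_space M by fact
  define m where "m = (\<integral>x. x ^ 4 \<partial>std_normal_law)"
  have m: "m \<ge> 0" by (simp add: m_def integral_nonneg_AE)
  define Z where "Z i \<omega> = B \<omega> $$ (i, i) / sqrt 2" for i \<omega>
  have Z: "distributed M lborel (Z i) std_normal_density" if "i < N" for i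
  proof -
    have "distributed M lborel (\<lambda>\<omega>. B \<omega> $$ (i, i)) (normal_density 0 (sqrt 2))"
      using B that by (simp add: goe_matrix_def)
    then show ?thesis
      using normal_standard_normal_convert[of "sqrt 2" "\<lambda>\<omega>. B \<omega> $$ (i, i)" 0] by (simp add: Z_def[abs_def])
  qed
  have Zm: "Z i \<in> borel_measurable M" if "i < N" for i
    using distributed_measurable[OF Z[OF that]] by simp
  define A where "A i = {\<omega> \<in> space M. sqrt (real N) < \<bar>Z i \<omega>\<bar>}" for i
  have Am: "A i \<in> events" if "i < N" for i using Zm[OF that] unfolding A_def by measurable
  have "prob (\<Union>i\<in>{..<N}. A i) \<le> real N * (m / (real N)\<^sup>2)"
  proof (rule prob_UN_le)
    fix i assume i: "i \<in> {..<N}"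
    have "{x. \<bar>x\<bar> > sqrt (real N)} \<in> sets (borel :: real measure)" by measurable
    then have "measure (distr M borel (Z i)) {x. \<bar>x\<bar> > sqrt (real N)} = prob (Z i -` {x. \<bar>x\<bar> > sqrt (real N)} \<inter> space M)"
      using i by (intro measure_distr[OF Zm]) auto
    also have "Z i -` {x. \<bar>x\<bar> > sqrt (real N)} \<inter> space M = A i" by (auto simp: A_def)
    finally have "prob (A i) = measure std_normal_law {x. \<bar>x\<bar> > sqrt (real N)}"
      using i distributed_distr_borel[OF Z] by simp
    also have "\<dots> \<le> m / sqrt (real N) ^ 4"
      using tail_entry_law[OF entry_law_std_normal_law, of "sqrt (real N)" 2] N by (simp add: m_def)
    also have "sqrt (real N) ^ 4 = (real N)\<^sup>2"
      by (simp add: power4_eq_xxxx power2_eq_square)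
    finally show "prob (A i) \<le> m / (real N)\<^sup>2" .
  qed (use Am m in auto)
  then have bad: "prob (\<Union>i\<in>{..<N}. A i) \<le> m / real N" using N by (simp add: power2_eq_square)
  have badm: "(\<Union>i\<in>{..<N}. A i) \<in> events" using Am by auto
  show ?thesis
  proof (intro bexI conjI)
    show "space M - (\<Union>i\<in>{..<N}. A i) \<in> events" using badm by auto
    show "1 - (\<integral>x. x ^ 4 \<partial>std_normal_law) / real N \<le> prob (space M - (\<Union>i\<in>{..<N}. A i))"
      using bad prob_compl[OF badm] by (simp add: m_def)
    show "\<forall>\<omega>\<in>space M - (\<Union>i\<in>{..<N}. A i). \<forall>i<N. \<bar>B \<omega> $$ (i, i)\<bar> \<le> 2 * sqrt (real N)"
    proof (intro ballI allI impI)
      fix \<omega> i assume "\<omega> \<in> space M - (\<Union>i\<in>{..<N}. A i)" "i < N"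
      then have "\<bar>Z i \<omega>\<bar> \<le> sqrt (real N)" by (force simp: A_def)
      then have "\<bar>B \<omega> $$ (i, i)\<bar> \<le> sqrt (real N) * sqrt 2" by (simp add: Z_def divide_le_eq)
      also have "\<dots> \<le> sqrt (real N) * 2" by (intro mult_left_mono) (auto simp: real_sqrt_le_iff[of 2 4, simplified])
      finally show "\<bar>B \<omega> $$ (i, i)\<bar> \<le> 2 * sqrt (real N)" by simp
    qed
  qed
qed

lemma goe_eq:
  assumes B: "goe_matrix M N B" and \<omega>: "\<omega> \<in> space M" and ij: "i < N" "j < N"
  shows "sym_mat {(i, j). i < j \<and> j < N} (\<lambda>p. B \<omega> $$ p) i j + (if i = j then B \<omega> $$ (i, i) else 0) = B \<omega> $$ (i, j)"
proof -
  have c: "B \<omega> \<in> carrier_mat N N" "transpose_mat (B \<omega>) = B \<omega>"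
    using B \<omega> by (auto simp: goe_matrix_def)
  have "B \<omega> $$ (j, i) = B \<omega> $$ (i, j)"
    using c ij by (metis carrier_matD index_transpose_mat(1))
  then show ?thesis
    using ij by (cases "i \<le> j") (auto simp: sym_mat_def upos_def)
qed

section \<open>Inner probability\<close>

lemma inner_prob_le_1: "prob_space M \<Longrightarrow> inner_prob M S \<le> 1"
  unfolding inner_prob_def
  by (rule cSUP_least) (auto intro: prob_space.prob_le_1)

text \<open>An event \<open>E\<close> of probability at least \<open>1 - \<epsilon>\<close> on which \<open>S\<close> implies \<open>S'\<close> costs at most \<open>\<epsilon>\<close>.  Only \<open>E\<close> has
  to be measurable.\<close>

lemma inner_prob_transfer:
  assumes M: "prob_space M" and E: "E \<in> sets M" "1 - \<epsilon> \<le> measure M E" and sub: "S \<inter> E \<subseteq> S'"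
  shows "inner_prob M S - \<epsilon> \<le> inner_prob M S'"
proof -
  interpret prob_space M by fact
  have "inner_prob M S \<le> inner_prob M S' + \<epsilon>"
    unfolding inner_prob_def[of M S]
  proof (rule cSUP_least)
    show "{F \<in> events. F \<subseteq> S} \<noteq> {}" by auto
    fix F assume F: "F \<in> {F \<in> events. F \<subseteq> S}"
    have "prob F \<le> prob ((F \<inter> E) \<union> (space M - E))"
      by (rule finite_measure_mono) (use F E sets.sets_into_space[of F M] in auto)
    also have "\<dots> \<le> prob (F \<inter> E) + prob (space M - E)"
      by (rule measure_Un_le) (use F E in auto)
    also have "prob (F \<inter> E) \<le> inner_prob M S'"
      unfolding inner_prob_def
      by (rule cSUP_upper) (use F E sub in \<open>auto intro!: bdd_aboveI[of _ 1]\<close>)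
    also have "prob (space M - E) \<le> \<epsilon>" using E by (simp add: prob_compl)
    finally show "prob F \<le> inner_prob M S' + \<epsilon>" by simp
  qed
  then show ?thesis by simp
qed

section \<open>Transfer of the blips\<close>

lemma eventually_multiples_at_top:
  "eventually Q (multiples_at_top k) \<longleftrightarrow> eventually (\<lambda>N. k dvd N \<longrightarrow> Q N) sequentially"
  by (simp add: multiples_at_top_def eventually_inf_principal)

text \<open>Neither \<open>\<epsilon>\<close> nor \<open>c\<close> depends on \<open>C\<close>, as both come from the norm bounds; only how large \<open>N\<close> has
  to be, for the blips and the bulk to be disjoint, depends on \<open>C\<close>.\<close>

lemma good_event:
  fixes k :: nat and D :: "real measure" and M :: "nat \<Rightarrow> 'a measure" and A B :: "nat \<Rightarrow> 'a \<Rightarrow> real mat"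
  assumes k: "k \<ge> 1" and D: "entry_law D"
    and M: "\<And>N. N > 0 \<Longrightarrow> k dvd N \<Longrightarrow> prob_space (M N)"
    and A: "\<And>N. N > 0 \<Longrightarrow> k dvd N \<Longrightarrow> checkerboard_matrix (M N) D k N (A N)"
    and B: "\<And>N. N > 0 \<Longrightarrow> k dvd N \<Longrightarrow> goe_matrix (M N) N (B N)"
  obtains \<epsilon> c where "\<epsilon> \<longlonglongrightarrow> 0" and
    "\<And>C. \<forall>\<^sub>F N in multiples_at_top k. N > 0 \<and> (\<exists>E\<in>sets (M N). 1 - \<epsilon> N \<le> measure (M N) E \<and>
      (\<forall>\<omega>\<in>E. two_blips k N C (anticommutator (mean_checkerboard k N) (B N \<omega>)) \<longrightarrow>
        two_blips_and_bulk k N (C + c) (anticommutator (A N \<omega>) (B N \<omega>))))"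
proof -
  let ?PA = "\<lambda>N. {(i, j). i < j \<and> j < N \<and> i mod k \<noteq> j mod k}" and ?PB = "\<lambda>N. {(i, j). i < j \<and> j < (N::nat)}"
  obtain \<delta> where \<delta>: "\<delta> \<longlonglongrightarrow> 0" "\<forall>\<^sub>F N in sequentially. \<forall>(M :: 'a measure) P X. random_sym_mat M D N P X \<longrightarrow>
    (\<exists>E\<in>sets M. 1 - \<delta> N \<le> measure M E \<and> (\<forall>\<omega>\<in>E. op_bound N (sym_mat P (\<lambda>p. X p \<omega>)) (248 * sqrt (real N))))"
    using op_bound_whp[OF D] by blast
  obtain \<delta>' where \<delta>': "\<delta>' \<longlonglongrightarrow> 0" "\<forall>\<^sub>F N in sequentially. \<forall>(M :: 'a measure) P X. random_sym_mat M std_normal_law N P X \<longrightarrow>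
    (\<exists>E\<in>sets M. 1 - \<delta>' N \<le> measure M E \<and> (\<forall>\<omega>\<in>E. op_bound N (sym_mat P (\<lambda>p. X p \<omega>)) (248 * sqrt (real N))))"
    using op_bound_whp[OF entry_law_std_normal_law] by blast
  define m where "m = (\<integral>x. x ^ 4 \<partial>std_normal_law)"
  define \<epsilon> where "\<epsilon> N = \<delta> N + \<delta>' N + m / real N" for N
  have "(\<lambda>N. m / real N) \<longlonglongrightarrow> 0" by (rule lim_const_over_n)
  then have \<epsilon>: "\<epsilon> \<longlonglongrightarrow> 0" unfolding \<epsilon>_def using \<delta>(1) \<delta>'(1) by (auto intro!: tendsto_eq_intros)
  \<comment> \<open>the norm of \<open>{W, B}\<close> is at most twice the product of the norms, \<open>248 * sqrt N\<close> and \<open>250 * sqrt N\<close>\<close>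
  define c :: real where "c = 2 * 248 * 250"
  have main: "\<forall>\<^sub>F N in multiples_at_top k. N > 0 \<and> (\<exists>E\<in>sets (M N). 1 - \<epsilon> N \<le> measure (M N) E \<and>
      (\<forall>\<omega>\<in>E. two_blips k N C (anticommutator (mean_checkerboard k N) (B N \<omega>)) \<longrightarrow>
        two_blips_and_bulk k N (C + (c + 1)) (anticommutator (A N \<omega>) (B N \<omega>))))" for C
  proof -
    have "\<forall>\<^sub>F N in sequentially. 2 * ((C + c + 1) * real N) < real N powr (3/2) / real k"
      using k by real_asymp
    then show ?thesis
      unfolding eventually_multiples_at_top using \<delta>(2) \<delta>'(2) eventually_gt_at_top[of 0]
    proof eventually_elim
      case (elim N)
      show ?case
      proof
        assume dvd: "k dvd N"
        have N: "N > 0" using elim by simp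
        interpret prob_space "M N" by (rule M[OF N dvd])
        obtain E1 where E1: "E1 \<in> events" "1 - \<delta> N \<le> prob E1"
          "\<And>\<omega>. \<omega> \<in> E1 \<Longrightarrow> op_bound N (sym_mat (?PA N) (\<lambda>p. A N \<omega> $$ p)) (248 * sqrt (real N))"
          using elim(2)[rule_format, OF checkerboard_random_sym_mat[OF D M[OF N dvd] A[OF N dvd]]] by auto
        obtain E2 where E2: "E2 \<in> events" "1 - \<delta>' N \<le> prob E2"
          "\<And>\<omega>. \<omega> \<in> E2 \<Longrightarrow> op_bound N (sym_mat (?PB N) (\<lambda>p. B N \<omega> $$ p)) (248 * sqrt (real N))"
          using elim(3)[rule_format, OF goe_random_sym_mat[OF M[OF N dvd] B[OF N dvd]]] by auto
        obtain E3 where E3: "E3 \<in> events" "1 - m / real N \<le> prob E3"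
          "\<And>\<omega> i. \<omega> \<in> E3 \<Longrightarrow> i < N \<Longrightarrow> \<bar>B N \<omega> $$ (i, i)\<bar> \<le> 2 * sqrt (real N)"
          using goe_diagonal_event[OF M[OF N dvd] B[OF N dvd] N] unfolding m_def by blast
        define E where "E = space (M N) - ((space (M N) - E1) \<union> (space (M N) - E2) \<union> (space (M N) - E3))"
        have E: "E \<in> events" using E1 E2 E3 by (auto simp: E_def)
        have "prob ((space (M N) - E1) \<union> (space (M N) - E2) \<union> (space (M N) - E3)) \<le>
            prob (space (M N) - E1) + prob (space (M N) - E2) + prob (space (M N) - E3)"
          using E1(1) E2(1) E3(1) measure_Un_le[of "space (M N) - E1" "M N" "space (M N) - E2"]
            measure_Un_le[of "(space (M N) - E1) \<union> (space (M N) - E2)" "M N" "space (M N) - E3"] by auto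
        also have "\<dots> \<le> \<epsilon> N" using E1 E2 E3 by (simp add: prob_compl \<epsilon>_def)
        finally have PE: "1 - \<epsilon> N \<le> prob E"
          unfolding E_def using E1(1) E2(1) E3(1) by (subst prob_compl) auto
        have "two_blips_and_bulk k N (C + (c + 1)) (anticommutator (A N \<omega>) (B N \<omega>))"
          if \<omega>: "\<omega> \<in> E" and blips: "two_blips k N C (anticommutator (mean_checkerboard k N) (B N \<omega>))" for \<omega>
        proof -
          have in_E: "\<omega> \<in> space (M N)" "\<omega> \<in> E1" "\<omega> \<in> E2" "\<omega> \<in> E3" using \<omega> by (auto simp: E_def)
          have nA: "op_bound N (\<lambda>i j. A N \<omega> $$ (i, j) - mean_checkerboard k N $$ (i, j)) (248 * sqrt (real N))"
            by (rule op_bound_cong[OF E1(3)[OF in_E(2)]]) (rule checkerboard_centred_eq[OF A[OF N dvd] in_E(1)])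
          have "op_bound N (\<lambda>i j. sym_mat (?PB N) (\<lambda>p. B N \<omega> $$ p) i j + (if i = j then B N \<omega> $$ (i, i) else 0))
              (248 * sqrt (real N) + 2 * sqrt (real N))"
            by (intro op_bound_add E2(3)[OF in_E(3)] op_bound_diagonal E3(3)[OF in_E(4)]) auto
          then have nB: "op_bound N (\<lambda>i j. B N \<omega> $$ (i, j)) (250 * sqrt (real N))"
            by (intro op_bound_cong[OF _ goe_eq[OF B[OF N dvd] in_E(1)]]) (simp add: algebra_simps)
          have "two_blips_and_bulk k N (C + c + 1) (anticommutator (A N \<omega>) (B N \<omega>))"
          proof (rule two_blips_and_bulk_perturb[OF _ _ _ _ k N blips nA _ nB])
            show "2 * (248 * sqrt (real N)) * (250 * sqrt (real N)) \<le> c * real N"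
              by (simp add: c_def)
          qed (use A[OF N dvd] B[OF N dvd] in_E(1) elim(1) in \<open>auto simp: checkerboard_matrix_def goe_matrix_def\<close>)
          then show ?thesis by (simp add: add.assoc)
        qed
        then show "N > 0 \<and> (\<exists>E\<in>events. 1 - \<epsilon> N \<le> prob E \<and>
          (\<forall>\<omega>\<in>E. two_blips k N C (anticommutator (mean_checkerboard k N) (B N \<omega>)) \<longrightarrow>
            two_blips_and_bulk k N (C + (c + 1)) (anticommutator (A N \<omega>) (B N \<omega>))))"
          using N E PE by blast
      qed
    qed
  qed
  show thesis by (rule that[OF \<epsilon> main])
qed

theorem lemmaB5:
  fixes k :: nat and D :: "real measure" and M :: "nat \<Rightarrow> 'a measure"
    and A B :: "nat \<Rightarrow> 'a \<Rightarrow> real mat"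
  assumes "k \<ge> 1"
    and "entry_law D"
    and "\<And>N. N > 0 \<Longrightarrow> k dvd N \<Longrightarrow> prob_space (M N)"
    and "\<And>N. N > 0 \<Longrightarrow> k dvd N \<Longrightarrow> checkerboard_matrix (M N) D k N (A N)"
    and "\<And>N. N > 0 \<Longrightarrow> k dvd N \<Longrightarrow> goe_matrix (M N) N (B N)"
    and "\<And>N. N > 0 \<Longrightarrow> k dvd N \<Longrightarrow> indep_random_matrices (M N) N (A N) (B N)"
  shows "(whp_O k M (\<lambda>C N \<omega>. two_blips k N C (anticommutator (mean_checkerboard k N) (B N \<omega>)))
           \<longrightarrow> whp_O k M (\<lambda>C N \<omega>. two_blips_and_bulk k N C (anticommutator (A N \<omega>) (B N \<omega>)))) \<and>
         (whp_O_tight k M (\<lambda>C N \<omega>. two_blips k N C (anticommutator (mean_checkerboard k N) (B N \<omega>)))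
           \<longrightarrow> whp_O_tight k M (\<lambda>C N \<omega>. two_blips_and_bulk k N C (anticommutator (A N \<omega>) (B N \<omega>))))"
proof -
  obtain \<epsilon> c where \<epsilon>: "\<epsilon> \<longlonglongrightarrow> 0" and good:
    "\<And>C. \<forall>\<^sub>F N in multiples_at_top k. N > 0 \<and> (\<exists>E\<in>sets (M N). 1 - \<epsilon> N \<le> measure (M N) E \<and>
      (\<forall>\<omega>\<in>E. two_blips k N C (anticommutator (mean_checkerboard k N) (B N \<omega>)) \<longrightarrow>
        two_blips_and_bulk k N (C + c) (anticommutator (A N \<omega>) (B N \<omega>))))"
    using good_event[OF assms(1-5)] by blast
  define p where "p C N = inner_prob (M N) {\<omega> \<in> space (M N).
    two_blips k N C (anticommutator (mean_checkerboard k N) (B N \<omega>))}" for C N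
  define q where "q C N = inner_prob (M N) {\<omega> \<in> space (M N).
    two_blips_and_bulk k N C (anticommutator (A N \<omega>) (B N \<omega>))}" for C N
  have dvd: "\<forall>\<^sub>F N in multiples_at_top k. k dvd N"
    by (simp add: eventually_multiples_at_top)
  have pq: "\<forall>\<^sub>F N in multiples_at_top k. p C N - \<epsilon> N \<le> q (C + c) N" for C
    using good[of C] dvd
  proof eventually_elim
    case (elim N)
    then obtain E where E: "E \<in> sets (M N)" "1 - \<epsilon> N \<le> measure (M N) E"
      "\<And>\<omega>. \<omega> \<in> E \<Longrightarrow> two_blips k N C (anticommutator (mean_checkerboard k N) (B N \<omega>)) \<Longrightarrow>
        two_blips_and_bulk k N (C + c) (anticommutator (A N \<omega>) (B N \<omega>))" by blast
    show ?case unfolding p_def q_def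
      by (rule inner_prob_transfer[OF assms(3) E(1,2)]) (use elim E(3) in auto)
  qed
  have q1: "\<forall>\<^sub>F N in multiples_at_top k. q C N \<le> 1" for C
    using good[of C] dvd by eventually_elim (auto simp: q_def intro!: inner_prob_le_1 assms(3))
  have \<epsilon>': "(\<epsilon> \<longlongrightarrow> 0) (multiples_at_top k)"
    using \<epsilon> by (rule tendsto_mono[rotated]) (simp add: multiples_at_top_def)
  show ?thesis
    unfolding whp_O_def whp_O_tight_def p_def[symmetric] q_def[symmetric]
  proof (intro conjI impI)
    assume "\<exists>C. (p C \<longlongrightarrow> 1) (multiples_at_top k)"
    then obtain C where "(p C \<longlongrightarrow> 1) (multiples_at_top k)" by blast
    then have "((\<lambda>N. p C N - \<epsilon> N) \<longlongrightarrow> 1) (multiples_at_top k)"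
      using tendsto_diff[OF _ \<epsilon>', of "p C" 1] by simp
    then have "(q (C + c) \<longlongrightarrow> 1) (multiples_at_top k)"
      by (rule tendsto_sandwich[OF pq q1 _ tendsto_const])
    then show "\<exists>C. (q C \<longlongrightarrow> 1) (multiples_at_top k)" by blast
  next
    assume tight: "\<forall>e>0. \<exists>C. \<forall>\<^sub>F N in multiples_at_top k. 1 - e \<le> p C N"
    show "\<forall>e>0. \<exists>C. \<forall>\<^sub>F N in multiples_at_top k. 1 - e \<le> q C N"
    proof (intro allI impI)
      fix e :: real assume e: "e > 0"
      then obtain C where "\<forall>\<^sub>F N in multiples_at_top k. 1 - e / 2 \<le> p C N"
        using tight by (meson half_gt_zero)
      moreover have "\<forall>\<^sub>F N in multiples_at_top k. \<epsilon> N < e / 2"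
        using \<epsilon>' e by (intro order_tendstoD) auto
      ultimately have "\<forall>\<^sub>F N in multiples_at_top k. 1 - e \<le> q (C + c) N"
        using pq[of C] by eventually_elim (simp add: field_simps)
      then show "\<exists>C. \<forall>\<^sub>F N in multiples_at_top k. 1 - e \<le> q C N" by blast
    qed
  qed
qed

end
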